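(* Let $f_a:\mathbb R^3\to\mathbb R^3$, $f_a(x)=F(x)-(0,0,a)$, be a Zorich map whose parameter $a\in\mathbb R$ satisfies $a\geq e^M-m$. Then there exists a unique fixed point $\xi=(\xi_1,\xi_2,\xi_3)$ of $f_a$ satisfying $\xi_3\leq m$; the set $$J:=\{x\in\mathbb R^3:\ f_a^k(x)\not\to\xi \text{ as } k\to\infty\}$$ consists of uncountably many pairwise disjoint hairs (i.e. $J$ is the union of an uncountable family of pairwise disjoint hairs); and the set $C$ of endpoints of these hairs has Hausdorff dimension $3$, while $J\setminus C$ has Hausdorff dimension $1$.
   Context: Zorich maps. Let $Q=\{(x_1,x_2)\in\mathbb R^2: |x_1|\le 1, |x_2|\le 1\}$ and $U=\{x\in\mathbb R^3: x_1^2+x_2^2+x_3^2=1,\ x_3\ge 0\}$, and let $h=(h_1,h_2,h_3):Q\to U$ be a bilipschitz homeomorphism onto $U$ (so $h$ maps $\partial Q$ onto $\{x\in U:x_3=0\}$). Define $F(x_1,x_2,x_3)=e^{x_3}h(x_1,x_2)$ on $Q\times\mathbb R$, and extend $F$ to $\mathbb R^3$ by repeated reflection in the sides of the square beams in the domain and in the $(x_1,x_2)$-plane in the range. Explicitly, let $\varphi:\mathbb R\to[-1,1]$ be the $4$-periodic function with $\varphi(u)=u$ for $-1\le u\le 1$ and $\varphi(u)=2-u$ for $1\le u\le 3$; if $r_1,r_2\in\mathbb Z$ and $|x_1-2r_1|\le 1$, $|x_2-2r_2|\le 1$, then $F(x)=e^{x_3}\big(h_1(p),h_2(p),(-1)^{r_1+r_2}h_3(p)\big)$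 with $p=(\varphi(x_1),\varphi(x_2))$. The map $F$ is differentiable a.e. Write $|DF(x)|=\sup_{|v|=1}|DF(x)v|$ and $\ell(DF(x))=\inf_{|v|=1}|DF(x)v|$. Real numbers $\alpha,m,M$ with $0<\alpha<1$ and $m<M$ (such numbers exist) are fixed such that $|DF(x)|\le\alpha$ for a.e. $x$ with $x_3\le m$, and $\ell(DF(x))\ge 1/\alpha$ for a.e. $x$ with $x_3\ge M$. A subset $H\subset\mathbb R^3$ is a hair if there is a homeomorphism $\gamma:[0,\infty)\to H$ with $\gamma(t)\to\infty$ as $t\to\infty$; $\gamma(0)$ is called the endpoint of $H$. $f_a^k$ denotes the $k$-th iterate. *)

theory Defs
  imports "HOL-Analysis.Analysis"
begin

section \<open>Hausdorff dimension\<close>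

text \<open>
  The covering sets are required to be bounded because \<open>diameter\<close> is real-valued and carries no
  information for unbounded sets. The measures are only used for exponents \<open>s > 0\<close>, so that no
  convention for \<open>0\<^sup>0\<close> is involved; the dimension is not affected by leaving out \<open>s = 0\<close>.
  The dimension is extended real valued, the infimum of the empty set being \<open>\<infinity>\<close>.
\<close>

definition hausdorff_premeasure :: "real \<Rightarrow> real \<Rightarrow> 'a::metric_space set \<Rightarrow> ennreal" where
  "hausdorff_premeasure s \<delta> A =
     (INF U \<in> {U :: nat \<Rightarrow> 'a set. A \<subseteq> (\<Union>i. U i) \<and> (\<forall>i. bounded (U i) \<and> diameter (U i) \<le> \<delta>)}.
        \<Sum>i. ennreal (diameter (U i) powr s))"

definition hausdorff_measure :: "real \<Rightarrow> 'a::metric_space set \<Rightarrow> ennreal" where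
  "hausdorff_measure s A = (SUP \<delta> \<in> {0<..}. hausdorff_premeasure s \<delta> A)"

definition hausdorff_dim :: "'a::metric_space set \<Rightarrow> ennreal" where
  "hausdorff_dim A = (INF s \<in> {s. 0 < s \<and> hausdorff_measure s A = 0}. ennreal s)"


section \<open>Hairs\<close>

text \<open>
  The endpoint of a hair does not depend on the parametrization: a homeomorphism of the half-line
  \<open>[0,\<infinity>)\<close> onto itself fixes \<open>0\<close>. Hence it can be treated as a property of the set \<open>H\<close>.
\<close>

definition hair_endpoint :: "'a::real_normed_vector set \<Rightarrow> 'a \<Rightarrow> bool" where
  "hair_endpoint H e \<longleftrightarrow>
     (\<exists>\<gamma> \<gamma>'. homeomorphism {0::real..} H \<gamma> \<gamma>' \<and> filterlim \<gamma> at_infinity at_top \<and> \<gamma> 0 = e)"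

definition hair :: "'a::real_normed_vector set \<Rightarrow> bool" where
  "hair H \<longleftrightarrow> (\<exists>e. hair_endpoint H e)"


section \<open>Zorich maps\<close>

definition bilipschitz_homeomorphism ::
    "'a::metric_space set \<Rightarrow> 'b::metric_space set \<Rightarrow> ('a \<Rightarrow> 'b) \<Rightarrow> bool" where
  "bilipschitz_homeomorphism S T h \<longleftrightarrow>
     (\<exists>g L. homeomorphism S T h g \<and> L-lipschitz_on S h \<and> L-lipschitz_on T g)"

definition unit_square :: "(real^2) set" where
  "unit_square = {x. \<bar>x$1\<bar> \<le> 1 \<and> \<bar>x$2\<bar> \<le> 1}"

definition upper_hemisphere :: "(real^3) set" where
  "upper_hemisphere = {x. (x$1)\<^sup>2 + (x$2)\<^sup>2 + (x$3)\<^sup>2 = 1 \<and> x$3 \<ge> 0}"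

text \<open>The argument is first translated by a multiple of the period 4 into \<open>[-1,3)\<close>.\<close>

definition fold_coord :: "real \<Rightarrow> real" where
  "fold_coord u = (let v = u - 4 * of_int \<lfloor>(u + 1) / 4\<rfloor> in if v \<le> 1 then v else 2 - v)"

text \<open>
  Only the values of \<open>h\<close> on the square matter. The beam containing \<open>x\<close> is selected by
  \<open>r\<^sub>i = \<lfloor>(x\<^sub>i + 1) / 2\<rfloor>\<close>, so that \<open>2 r\<^sub>i - 1 \<le> x\<^sub>i < 2 r\<^sub>i + 1\<close>; for points on the common boundary
  of several beams the choice does not matter, see \<open>zorich_beam\<close> below.
\<close>

definition zorich :: "(real^2 \<Rightarrow> real^3) \<Rightarrow> real^3 \<Rightarrow> real^3" where
  "zorich h x =
     (let y = h (vector [fold_coord (x$1), fold_coord (x$2)]);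
          r\<^sub>1 = \<lfloor>(x$1 + 1) / 2\<rfloor>; r\<^sub>2 = \<lfloor>(x$2 + 1) / 2\<rfloor>
      in exp (x$3) *\<^sub>R vector [y$1, y$2, (-1) powi (r\<^sub>1 + r\<^sub>2) * y$3])"

definition zorich_shift :: "(real^2 \<Rightarrow> real^3) \<Rightarrow> real \<Rightarrow> real^3 \<Rightarrow> real^3" where
  "zorich_shift h a x = zorich h x - vector [0, 0, a]"

definition lower_norm :: "('a::real_normed_vector \<Rightarrow> 'b::real_normed_vector) \<Rightarrow> real" where
  "lower_norm D = (INF v \<in> sphere 0 1. norm (D v))"

definition non_convergence_set :: "('a::topological_space \<Rightarrow> 'a) \<Rightarrow> 'a \<Rightarrow> 'a set" where
  "non_convergence_set f \<xi> = {x. \<not> (\<lambda>k. (f ^^ k) x) \<longlonglongrightarrow> \<xi>}"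


subsection \<open>Consistency of the definition on the sides of the beams\<close>

lemma fold_coord_periodic: "fold_coord (u + 4) = fold_coord u"
proof -
  have "(u + 4 + 1) / 4 = (u + 1) / 4 + 1" by (simp add: field_simps)
  then have "\<lfloor>(u + 4 + 1) / 4\<rfloor> = \<lfloor>(u + 1) / 4\<rfloor> + 1" by linarith
  then show ?thesis by (simp add: fold_coord_def Let_def)
qed

lemma fold_coord_middle: "fold_coord u = u" if "-1 \<le> u" "u \<le> 1"
proof -
  have "\<lfloor>(u + 1) / 4\<rfloor> = 0" using that by (simp add: floor_eq_iff)
  then show ?thesis using that by (simp add: fold_coord_def)
qed

lemma fold_coord_right: "fold_coord u = 2 - u" if "1 \<le> u" "u \<le> 3"
proof (cases "u = 3")
  case True
  then show ?thesis by (simp add: fold_coord_def)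
next
  case False
  have "\<lfloor>(u + 1) / 4\<rfloor> = 0" using that False by (simp add: floor_eq_iff)
  then show ?thesis using that by (auto simp: fold_coord_def)
qed

lemma fold_coord_bound: "\<bar>fold_coord u\<bar> \<le> 1"
proof -
  have "of_int \<lfloor>(u + 1) / 4\<rfloor> \<le> (u + 1) / 4" "(u + 1) / 4 < of_int \<lfloor>(u + 1) / 4\<rfloor> + 1"
    by linarith+
  then show ?thesis unfolding fold_coord_def Let_def by (auto simp: field_simps)
qed

lemma beam_index:
  fixes r :: int
  assumes "\<bar>u - 2 * of_int r\<bar> \<le> 1"
  shows "r = \<lfloor>(u + 1) / 2\<rfloor> \<or> \<bar>fold_coord u\<bar> = 1"
proof (cases "u = 2 * of_int r + 1")
  case True
  define k where "k = \<lfloor>(u + 1) / 4\<rfloor>"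
  have "of_int k \<le> (u + 1) / 4" "(u + 1) / 4 < of_int k + 1"
    unfolding k_def by linarith+
  then have "of_int (2 * k) \<le> (of_int (r + 1) :: real)" "(of_int (r + 1) :: real) < of_int (2 * k + 2)"
    using True by simp_all
  then have "2 * k \<le> r + 1" "r + 1 < 2 * k + 2"
    by (simp_all only: of_int_le_iff of_int_less_iff)
  then have "r + 1 = 2 * k \<or> r = 2 * k" by linarith
  then have "u - 4 * of_int k = -1 \<or> u - 4 * of_int k = 1"
    using True by auto
  then show ?thesis
    unfolding fold_coord_def Let_def k_def[symmetric] by auto
next
  case False
  then have "\<lfloor>(u + 1) / 2\<rfloor> = r"
    using assms by (auto simp: floor_eq_iff abs_le_iff field_simps)
  then show ?thesis by simp
qed

lemma bilipschitz_boundary: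
  assumes "bilipschitz_homeomorphism unit_square upper_hemisphere h"
    and p: "p \<in> unit_square" "\<bar>p$1\<bar> = 1 \<or> \<bar>p$2\<bar> = 1"
  shows "h p $ 3 = 0"
proof (rule ccontr)
  assume nz: "h p $ 3 \<noteq> 0"
  obtain g where hom: "homeomorphism unit_square upper_hemisphere h g"
    using assms(1) unfolding bilipschitz_homeomorphism_def by blast
  \<comment> \<open>parametrize the open hemisphere by the open unit disc and apply invariance of domain\<close>
  define q :: "real^2 \<Rightarrow> real^3" where
    "q z = vector [z$1, z$2, sqrt (1 - (z$1)\<^sup>2 - (z$2)\<^sup>2)]" for z
  define B where "B = {z::real^2. (z$1)\<^sup>2 + (z$2)\<^sup>2 < 1}"
  have qU: "q z \<in> upper_hemisphere" if "z \<in> B" for z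
    using that by (simp add: q_def B_def upper_hemisphere_def)
  have contq: "continuous_on B q"
  proof -
    have "continuous_on B (\<lambda>z. \<chi> i::3. if i = 1 then z$1 else if i = 2 then z$2
            else sqrt (1 - (z$1)\<^sup>2 - (z$2)\<^sup>2))"
    proof (rule continuous_on_vec_lambda)
      show "continuous_on B (\<lambda>z. if i = 1 then z$1 else if i = 2 then z$2
            else sqrt (1 - (z$1)\<^sup>2 - (z$2)\<^sup>2))" for i :: 3
        by (cases "i = 1"; cases "i = 2") (auto intro!: continuous_intros)
    qed
    also have "(\<lambda>z. \<chi> i::3. if i = 1 then z$1 else if i = 2 then z$2
            else sqrt (1 - (z$1)\<^sup>2 - (z$2)\<^sup>2)) = q"
      by (simp add: fun_eq_iff vec_eq_iff forall_3 q_def)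
    finally show ?thesis .
  qed
  have openB: "open B"
    unfolding B_def by (intro open_Collect_less continuous_intros)
  have "continuous_on B (g \<circ> q)"
    by (rule continuous_on_compose[OF contq])
       (use hom qU in \<open>auto simp: homeomorphism_def intro: continuous_on_subset\<close>)
  moreover have "inj_on (g \<circ> q) B"
  proof (rule inj_onI)
    fix z w assume zw: "z \<in> B" "w \<in> B" and "(g \<circ> q) z = (g \<circ> q) w"
    then have "q z = q w" using hom qU by (metis comp_apply homeomorphism_def)
    then have "q z $ 1 = q w $ 1" "q z $ 2 = q w $ 2" by simp_all
    then show "z = w" by (simp add: q_def vec_eq_iff forall_2)
  qed
  ultimately have op: "open ((g \<circ> q) ` B)"
    using openB by (intro invariance_of_domain)
  have sub: "(g \<circ> q) ` B \<subseteq> unit_square"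
    using hom qU by (auto simp: homeomorphism_def)
  define y where "y = h p"
  have y: "(y$1)\<^sup>2 + (y$2)\<^sup>2 + (y$3)\<^sup>2 = 1" "y$3 > 0"
  proof -
    have "y \<in> upper_hemisphere"
      using hom p(1) unfolding y_def homeomorphism_def by blast
    then show "(y$1)\<^sup>2 + (y$2)\<^sup>2 + (y$3)\<^sup>2 = 1" "y$3 > 0"
      using nz by (simp_all add: y_def upper_hemisphere_def)
  qed
  define z where "z = (vector [y$1, y$2] :: real^2)"
  have zB: "z \<in> B"
  proof -
    have "(y$3)\<^sup>2 > 0" using y(2) by simp
    then have "(y$1)\<^sup>2 + (y$2)\<^sup>2 < 1" using y(1) by linarith
    then show ?thesis by (simp add: z_def B_def)
  qed
  have "1 - (y$1)\<^sup>2 - (y$2)\<^sup>2 = (y$3)\<^sup>2" using y by simp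
  then have "sqrt (1 - (y$1)\<^sup>2 - (y$2)\<^sup>2) = y$3"
    using y(2) by simp
  then have "q z = y" by (simp add: q_def z_def vec_eq_iff forall_3)
  then have "(g \<circ> q) z = p" using hom p(1) by (simp add: y_def homeomorphism_def)
  then have "p \<in> (g \<circ> q) ` B" using zB by blast
  then obtain e where e: "e > 0" "ball p e \<subseteq> unit_square"
    using op sub by (meson openE order_trans)
  define p' where "p' = (1 + e / (2 * (norm p + 1))) *\<^sub>R p"
  have "dist p p' = (e / 2) * (norm p / (norm p + 1))"
    using e by (simp add: p'_def dist_norm scaleR_left_distrib)
  also have "\<dots> \<le> (e / 2) * 1"
    using e by (intro mult_left_mono) (auto simp: divide_simps add_nonneg_pos)
  finally have "p' \<in> unit_square" using e by (auto simp: subset_iff)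
  moreover have "1 + e / (2 * (norm p + 1)) > 1"
    using e by (simp add: add_nonneg_pos)
  ultimately show False
    using p(2) by (auto simp: p'_def unit_square_def abs_mult)
qed

lemma zorich_beam:
  fixes r\<^sub>1 r\<^sub>2 :: int
  assumes h: "bilipschitz_homeomorphism unit_square upper_hemisphere h"
    and r: "\<bar>x$1 - 2 * of_int r\<^sub>1\<bar> \<le> 1" "\<bar>x$2 - 2 * of_int r\<^sub>2\<bar> \<le> 1"
    and y: "y = h (vector [fold_coord (x$1), fold_coord (x$2)])"
  shows "zorich h x = exp (x$3) *\<^sub>R vector [y$1, y$2, (-1) powi (r\<^sub>1 + r\<^sub>2) * y$3]"
proof (cases "r\<^sub>1 = \<lfloor>(x$1 + 1) / 2\<rfloor> \<and> r\<^sub>2 = \<lfloor>(x$2 + 1) / 2\<rfloor>")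
  case True
  then show ?thesis by (simp add: zorich_def y Let_def)
next
  case False
  then have "y$3 = 0"
    unfolding y using beam_index[OF r(1)] beam_index[OF r(2)]
    by (intro bilipschitz_boundary[OF h]) (auto simp: unit_square_def fold_coord_bound)
  then show ?thesis by (simp add: zorich_def y Let_def)
qed

end

theory Submission
  imports Defs
begin

text \<open>
  Above the plane \<open>x\<^sub>3 = M\<close> the inverse branches of \<open>f = f\<^sub>a\<close> contract by \<open>\<alpha>\<close> (the almost everywhere bounds on
  the derivative carry over by Fubini), below it \<open>f\<close> maps into the domain of contraction \<open>x\<^sub>3 \<le> m\<close>. Hence \<open>J\<close> is
  the set of points whose orbits stay above \<open>x\<^sub>3 = M\<close>. Points with the same itinerary through the beams are
  linearly ordered by the eventual order of the heights of their orbits, and the limit of \<open>A\<^sup>k\<close> applied to the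
  height of \<open>f\<^sup>k x\<close>, with \<open>A w = ln (w + a)\<close>, maps each such set homeomorphically onto some \<open>[t, \<infinity>)\<close>.

  A point above another one of its hair has an orbit whose horizontal part is eventually smaller than any power
  of its height. Few unit cells are compatible with this, so that the supremum of the \<open>s\<close>-contents over all cells
  is at most half of itself when \<open>s > 1\<close>. Conversely a unit box at height \<open>l\<close> has of the order of
  \<open>exp (3 l)\<close> unit boxes in its image, which for \<open>s < 3\<close> gives a lower bound for the \<open>s\<close>-content of \<open>J\<close>. If there
  were only countably many hairs, the set of endpoints would be countable.
\<close>

section \<open>Hausdorff content\<close>

text \<open>Derivative bounds that hold only almost everywhere say nothing about a given segment,
  which may lie inside the exceptional set. Almost every parallel translate is good, however, and
  continuity leads back to the original segment; this is why convex half-spaces are used. For an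
  inverse branch the exceptional set is an image under \<open>F\<close>, again null since
  \<open>F\<close> is locally Lipschitz. Two orbits in the same beams stay within horizontal
  distance 3. Since the inverse branches contract, distinct ones must separate vertically, and a gap
  of 4 suffices to make the upper orbit follow the one-dimensional model with total error at most
  1/2. Content takes the place of measure because it is uniformly bounded on unit cells, so that an
  estimate by half of itself forces zero. The dimension of the endpoint set is found indirectly:
  \<open>J\<close> has positive content for all exponents below 3, its part outside the endpoints is
  null for exponents above 1, and subadditivity leaves positive content to the endpoints.\<close>

lemma le_suminf_ennreal: "f i \<le> (\<Sum>i. f i)" for f :: "nat \<Rightarrow> ennreal"
  using sum_le_suminf[of f "{i}"] by simp

text \<open>The diameters of the covering sets are not restricted: a cover with a small sum consists of small
  sets anyway, so that for \<open>s > 0\<close> the content and the Hausdorff measure have the same null sets.\<close>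

definition hcontent :: "real \<Rightarrow> 'a::metric_space set \<Rightarrow> ennreal" where
  "hcontent s A = (INF U \<in> {U :: nat \<Rightarrow> 'a set. A \<subseteq> (\<Union>i. U i) \<and> (\<forall>i. bounded (U i))}.
     \<Sum>i. ennreal (diameter (U i) powr s))"

abbreviation cover_sum :: "real \<Rightarrow> (nat \<Rightarrow> 'a::metric_space set) \<Rightarrow> ennreal" where
  "cover_sum s U \<equiv> \<Sum>i. ennreal (diameter (U i) powr s)"

lemma hcontent_le:
  assumes "A \<subseteq> (\<Union>i. U i)" "\<And>i::nat. bounded (U i)"
  shows "hcontent s A \<le> cover_sum s U"
  unfolding hcontent_def using assms by (intro INF_lower) auto

lemma hcontent_approx:
  assumes "hcontent s A < c"
  shows "\<exists>U :: nat \<Rightarrow> 'a::metric_space set. A \<subseteq> (\<Union>i. U i) \<and> (\<forall>i. bounded (U i)) \<and>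
    cover_sum s U < c"
  using assms unfolding hcontent_def INF_less_iff by auto

lemma hcontent_mono: "A \<subseteq> B \<Longrightarrow> hcontent s A \<le> hcontent s B"
  unfolding hcontent_def by (intro INF_superset_mono) auto

lemma hcontent_0_subset: "A \<subseteq> B \<Longrightarrow> hcontent s B = 0 \<Longrightarrow> hcontent s A = 0"
  using hcontent_mono[of A B s] by simp

lemma diameter_le_of_cover_sum_less:
  assumes "cover_sum s U < ennreal (\<delta> powr s)" "s > 0" "\<delta> > 0"
  shows "diameter (U i) \<le> \<delta>"
proof (rule ccontr)
  assume "\<not> diameter (U i) \<le> \<delta>"
  then have "\<delta> powr s \<le> diameter (U i) powr s" using assms by (intro powr_mono2) auto
  then have "ennreal (\<delta> powr s) \<le> ennreal (diameter (U i) powr s)" by (rule ennreal_leI)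
  also have "\<dots> \<le> cover_sum s U" by (rule le_suminf_ennreal)
  finally show False using assms(1) by simp
qed

lemma hausdorff_measure_eq_0_iff:
  assumes "s > 0"
  shows "hausdorff_measure s A = 0 \<longleftrightarrow> hcontent s A = 0"
proof
  assume "hausdorff_measure s A = 0"
  moreover have "hcontent s A \<le> hausdorff_premeasure s 1 A"
    unfolding hcontent_def hausdorff_premeasure_def by (intro INF_superset_mono) auto
  moreover have "hausdorff_premeasure s 1 A \<le> hausdorff_measure s A"
    unfolding hausdorff_measure_def by (intro SUP_upper) auto
  ultimately show "hcontent s A = 0" by simp
next
  assume 0: "hcontent s A = 0"
  have "hausdorff_premeasure s \<delta> A \<le> 0" if \<delta>: "\<delta> > 0" for \<delta>
  proof (rule ennreal_le_epsilon)
    fix e :: real assume e: "e > 0"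
    have "hcontent s A < ennreal (min e (\<delta> powr s))" using 0 e \<delta> by simp
    from hcontent_approx[OF this] obtain U where U: "A \<subseteq> (\<Union>i. U i)" "\<And>i. bounded (U i)"
      "cover_sum s U < ennreal (min e (\<delta> powr s))"
      by auto
    from U(3) have "cover_sum s U < ennreal (\<delta> powr s)"
      by (rule order_less_le_trans) (simp add: ennreal_leI)
    then have "diameter (U i) \<le> \<delta>" for i using assms \<delta> by (rule diameter_le_of_cover_sum_less)
    then have "hausdorff_premeasure s \<delta> A \<le> cover_sum s U"
      unfolding hausdorff_premeasure_def using U by (intro INF_lower) auto
    also have "\<dots> \<le> ennreal e" using less_imp_le[OF U(3)] by (rule order_trans) (simp add: ennreal_leI)
    finally show "hausdorff_premeasure s \<delta> A \<le> 0 + ennreal e" by simp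
  qed
  then show "hausdorff_measure s A = 0"
    unfolding hausdorff_measure_def by (simp add: SUP_eq_iff SUP_constant bot_ennreal)
qed

lemma hcontent_bounded_le:
  assumes "bounded A" "s > 0" shows "hcontent s A \<le> ennreal (diameter A powr s)"
proof -
  have "hcontent s A \<le> (\<Sum>i::nat. ennreal (diameter (if i = 0 then A else {}) powr s))"
    by (rule hcontent_le) (use assms in \<open>auto split: if_splits\<close>)
  also have "\<dots> = (\<Sum>i\<in>{0::nat}. ennreal (diameter (if i = 0 then A else {}) powr s))"
    using assms by (intro suminf_finite) auto
  finally show ?thesis by simp
qed

lemma hcontent_empty [simp]: "s > 0 \<Longrightarrow> hcontent s {} = 0"
  using hcontent_bounded_le[of "{}" s] by simp

lemma hcontent_UN_le:
  fixes A :: "nat \<Rightarrow> 'a::metric_space set"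
  shows "hcontent s (\<Union>i. A i) \<le> (\<Sum>i. hcontent s (A i))"
proof (cases "(\<Sum>i. hcontent s (A i)) = \<infinity>")
  case False
  then have fin: "hcontent s (A i) < \<infinity>" for i
    using le_suminf_ennreal[of "\<lambda>i. hcontent s (A i)" i]
    by (auto simp: less_top[symmetric] top_unique)
  show ?thesis
  proof (rule ennreal_le_epsilon)
    fix e :: real assume e: "e > 0"
    have "\<exists>U. A i \<subseteq> (\<Union>j. U j) \<and> (\<forall>j::nat. bounded (U j)) \<and>
        cover_sum s U \<le> hcontent s (A i) + ennreal (e * (1/2) ^ Suc i)" for i
    proof -
      have "hcontent s (A i) < hcontent s (A i) + ennreal (e * (1/2) ^ Suc i)"
        using fin[of i] e ennreal_add_left_cancel_less[of "hcontent s (A i)" 0] by auto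
      from hcontent_approx[OF this] obtain U where "A i \<subseteq> (\<Union>i. U i)" "\<And>i. bounded (U i)"
        "cover_sum s U < hcontent s (A i) + ennreal (e * (1/2) ^ Suc i)"
        by auto
      then show ?thesis by (intro exI[of _ U]) auto
    qed
    then obtain U where U: "\<And>i. A i \<subseteq> (\<Union>j. U i j)" "\<And>i j. bounded (U i (j::nat))"
        "\<And>i. (\<Sum>j. ennreal (diameter (U i j) powr s)) \<le> hcontent s (A i) + ennreal (e * (1/2) ^ Suc i)"
      by metis
    define V where "V n = U (fst (prod_decode n)) (snd (prod_decode n))" for n
    have "hcontent s (\<Union>i. A i) \<le> (\<Sum>n. ennreal (diameter (V n) powr s))"
    proof (rule hcontent_le)
      show "(\<Union>i. A i) \<subseteq> (\<Union>n. V n)"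
      proof
        fix x assume "x \<in> (\<Union>i. A i)"
        then obtain i j where "x \<in> U i j" using U(1) by blast
        then have "x \<in> V (prod_encode (i, j))" by (simp add: V_def)
        then show "x \<in> (\<Union>n. V n)" by blast
      qed
    qed (simp add: V_def U(2))
    also have "\<dots> = (\<Sum>i. \<Sum>j. ennreal (diameter (U i j) powr s))"
      using suminf_ennreal_2dimen[of "\<lambda>i. \<Sum>j. ennreal (diameter (U i j) powr s)"
          "\<lambda>z. ennreal (diameter (U (fst z) (snd z)) powr s)"] unfolding V_def fst_conv snd_conv
      by blast
    also have "\<dots> \<le> (\<Sum>i. hcontent s (A i) + ennreal (e * (1/2) ^ Suc i))"
      using U(3) by (intro suminf_le) auto
    also have "\<dots> = (\<Sum>i. hcontent s (A i)) + (\<Sum>i. ennreal (e * (1/2) ^ Suc i))"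
      by (rule suminf_add[symmetric]) auto
    also have "(\<Sum>i. ennreal (e * (1/2) ^ Suc i)) = ennreal e"
      using sums_mult[OF power_half_series, of e] e by (intro suminf_ennreal_eq) auto
    finally show "hcontent s (\<Union>i. A i) \<le> (\<Sum>i. hcontent s (A i)) + ennreal e" .
  qed
qed simp

lemma hcontent_countable_UN_0:
  assumes "countable I" "\<And>i. i \<in> I \<Longrightarrow> hcontent s (A i) = 0" "s > 0"
  shows "hcontent s (\<Union>i\<in>I. A i) = 0"
proof (cases "I = {}")
  case False
  have "(\<Union>i\<in>I. A i) = (\<Union>n. A (from_nat_into I n))"
    using assms(1) False by (metis range_from_nat_into image_image)
  moreover have "hcontent s (A (from_nat_into I n)) = 0" for n
    using assms(2) False by (simp add: from_nat_into)
  ultimately show ?thesis using hcontent_UN_le[of s "\<lambda>n. A (from_nat_into I n)"] by simp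
qed (use assms in simp)

lemma hcontent_Un_le:
  assumes "s > 0" shows "hcontent s (A \<union> B) \<le> hcontent s A + hcontent s B"
proof -
  let ?C = "\<lambda>i::nat. if i = 0 then A else if i = 1 then B else {}"
  have "hcontent s (A \<union> B) \<le> hcontent s (\<Union>i. ?C i)"
    by (rule hcontent_mono) (auto split: if_splits intro: exI[of _ "0::nat"] exI[of _ "1::nat"])
  also have "\<dots> \<le> (\<Sum>i. hcontent s (?C i))" by (rule hcontent_UN_le)
  also have "\<dots> = (\<Sum>i\<in>{0,1}. hcontent s (?C i))"
    using assms by (intro suminf_finite) auto
  finally show ?thesis by simp
qed

lemma hcontent_finite_UN_le:
  assumes "finite I" "s > 0" shows "hcontent s (\<Union>i\<in>I. A i) \<le> (\<Sum>i\<in>I. hcontent s (A i))"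
  using assms(1)
proof induction
  case (insert x F)
  have "hcontent s (\<Union>i\<in>insert x F. A i) \<le> hcontent s (A x) + hcontent s (\<Union>i\<in>F. A i)"
    using hcontent_Un_le[OF assms(2)] by simp
  also have "\<dots> \<le> hcontent s (A x) + (\<Sum>i\<in>F. hcontent s (A i))"
    using insert by (intro add_left_mono) auto
  finally show ?case using insert by simp
qed (use assms in simp)

lemma diameter_lipschitz_image:
  fixes g :: "'a::metric_space \<Rightarrow> 'b::real_normed_vector"
  assumes "bounded U" "c \<ge> 0" "\<And>x y. x \<in> U \<Longrightarrow> y \<in> U \<Longrightarrow> dist (g x) (g y) \<le> c * dist x y"
  shows "bounded (g ` U)" "diameter (g ` U) \<le> c * diameter U"
proof -
  show b: "bounded (g ` U)"
  proof (cases "U = {}")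
    case False
    then obtain a where a: "a \<in> U" by blast
    have "dist (g a) (g y) \<le> c * diameter U" if "y \<in> U" for y
      using assms(3)[OF a that] diameter_bounded_bound[OF assms(1) a that] assms(2)
      by (meson mult_left_mono order_trans)
    then show ?thesis unfolding bounded_def by blast
  qed simp
  show "diameter (g ` U) \<le> c * diameter U"
  proof (rule diameter_le)
    show "g ` U \<noteq> {} \<or> 0 \<le> c * diameter U"
      using assms(1,2) by (simp add: diameter_ge_0)
  next
    fix x y assume "x \<in> g ` U" "y \<in> g ` U"
    then obtain x' y' where "x' \<in> U" "y' \<in> U" "x = g x'" "y = g y'" by blast
    then show "norm (x - y) \<le> c * diameter U" unfolding dist_norm[symmetric]
      using assms(3)[of x' y'] diameter_bounded_bound[OF assms(1), of x' y'] assms(2)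
      by (meson mult_left_mono order_trans)
  qed
qed

lemma hcontent_lipschitz_image:
  fixes g :: "'a::metric_space \<Rightarrow> 'b::real_normed_vector"
  assumes "s > 0" "c > 0" "\<And>x y. x \<in> A \<Longrightarrow> y \<in> A \<Longrightarrow> dist (g x) (g y) \<le> c * dist x y"
  shows "hcontent s (g ` A) \<le> ennreal (c powr s) * hcontent s A"
proof -
  have *: "hcontent s (g ` A) \<le> ennreal (c powr s) * cover_sum s U"
    if U: "A \<subseteq> (\<Union>i. U i)" "\<And>i. bounded (U i)" for U :: "nat \<Rightarrow> _"
  proof -
    have b: "bounded (U i \<inter> A)" for i using U(2) by (auto intro: bounded_subset)
    \<comment> \<open>The covering sets are cut down to \<open>A\<close>, where the Lipschitz bound
      on \<open>g\<close> is available.\<close>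
    have "hcontent s (g ` A) \<le> (\<Sum>i. ennreal (diameter (g ` (U i \<inter> A)) powr s))"
      proof (rule hcontent_le)
      show "g ` A \<subseteq> (\<Union>i. g ` (U i \<inter> A))" using U(1) by blast
    qed (use assms(2,3) b in \<open>auto intro!: diameter_lipschitz_image(1)[of _ c]\<close>)
    also have "\<dots> \<le> (\<Sum>i. ennreal (c powr s) * ennreal (diameter (U i) powr s))"
    proof (intro suminf_le allI)
      fix i
      have "diameter (g ` (U i \<inter> A)) \<le> c * diameter (U i \<inter> A)"
        using b assms by (intro diameter_lipschitz_image(2)) auto
      also have "\<dots> \<le> c * diameter (U i)"
        using U assms by (intro mult_left_mono diameter_subset) auto
      finally have "diameter (g ` (U i \<inter> A)) powr s \<le> (c * diameter (U i)) powr s"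
        using assms b by (intro powr_mono2) (auto intro!: diameter_ge_0 diameter_lipschitz_image(1)[of _ c])
      also have "\<dots> = c powr s * diameter (U i) powr s"
        using assms U by (simp add: powr_mult diameter_ge_0)
      finally show "ennreal (diameter (g ` (U i \<inter> A)) powr s) \<le> ennreal (c powr s) * ennreal (diameter (U i) powr s)"
        by (simp add: ennreal_mult[symmetric] ennreal_leI)
    qed auto
    also have "\<dots> = ennreal (c powr s) * cover_sum s U" by simp
    finally show ?thesis .
  qed
  have "hcontent s (g ` A) / ennreal (c powr s) \<le> hcontent s A"
    unfolding hcontent_def[of s A]
  proof (rule INF_greatest)
    fix U :: "nat \<Rightarrow> _" assume "U \<in> {U. A \<subseteq> (\<Union>i. U i) \<and> (\<forall>i. bounded (U i))}"
    then have "hcontent s (g ` A) \<le> cover_sum s U * ennreal (c powr s)"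
      using * by (simp add: mult.commute)
    then show "hcontent s (g ` A) / ennreal (c powr s) \<le> cover_sum s U"
      using assms(2) by (intro divide_le_posI_ennreal) (auto simp: mult.commute)
  qed
  then have "ennreal (c powr s) * (hcontent s (g ` A) / ennreal (c powr s)) \<le> ennreal (c powr s) * hcontent s A"
    by (intro mult_left_mono) auto
  moreover have "ennreal (c powr s) * (hcontent s (g ` A) / ennreal (c powr s)) = hcontent s (g ` A)"
    using assms(2) by (simp add: ennreal_times_divide ennreal_mult_divide_eq mult.commute[of "ennreal _"])
  ultimately show ?thesis by simp
qed

lemma hcontent_lipschitz_image_0:
  fixes g :: "'a::metric_space \<Rightarrow> 'b::real_normed_vector"
  assumes "hcontent s A = 0" "s > 0" "\<And>x y. x \<in> A \<Longrightarrow> y \<in> A \<Longrightarrow> dist (g x) (g y) \<le> c * dist x y"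
  shows "hcontent s (g ` A) = 0"
proof -
  have "dist (g x) (g y) \<le> max c 1 * dist x y" if "x \<in> A" "y \<in> A" for x y
    using assms(3)[OF that] by (meson max.cobounded1 mult_right_mono order_trans zero_le_dist)
  then have "hcontent s (g ` A) \<le> ennreal (max c 1 powr s) * hcontent s A"
    using assms by (intro hcontent_lipschitz_image) auto
  then show ?thesis using assms by simp
qed

lemma hcontent_0_mono_exponent:
  assumes "hcontent s A = 0" "0 < s" "s \<le> t"
  shows "hcontent t A = 0"
proof -
  have "hcontent t A \<le> 0"
  proof (rule ennreal_le_epsilon)
    fix e :: real assume e: "e > 0"
    have "hcontent s A < ennreal (min e 1)" using assms e by simp
    from hcontent_approx[OF this] obtain U where U: "A \<subseteq> (\<Union>i. U i)" "\<And>i. bounded (U i)"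
      "cover_sum s U < ennreal (min e 1)"
      by auto
    from U(3) have "cover_sum s U < ennreal (1 powr s)"
      by (rule order_less_le_trans) (simp add: ennreal_leI)
    then have d1: "diameter (U i) \<le> 1" for i using assms(2) by (rule diameter_le_of_cover_sum_less) simp
    have "hcontent t A \<le> (\<Sum>i. ennreal (diameter (U i) powr t))" using U by (intro hcontent_le) auto
    also have "\<dots> \<le> cover_sum s U"
      using d1 U(2) assms
      by (intro suminf_le) (auto intro!: ennreal_leI powr_mono' diameter_ge_0)
    also have "\<dots> \<le> ennreal e" using less_imp_le[OF U(3)] by (rule order_trans) (simp add: ennreal_leI)
    finally show "hcontent t A \<le> 0 + ennreal e" by simp
  qed
  then show ?thesis by simp
qed

lemma hcontent_countable: "countable A \<Longrightarrow> s > 0 \<Longrightarrow> hcontent s A = 0"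
  using hcontent_countable_UN_0[of A s "\<lambda>x. {x}"] hcontent_bounded_le[of "{_}" s] by force

lemma hausdorff_dim_le:
  assumes "\<And>s. s > d \<Longrightarrow> hcontent s A = 0" "d \<ge> 0"
  shows "hausdorff_dim A \<le> ennreal d"
proof (rule ennreal_le_epsilon)
  fix e :: real assume "e > 0"
  then have "hausdorff_dim A \<le> ennreal (d + e)"
    unfolding hausdorff_dim_def using assms
    by (intro INF_lower) (auto simp: hausdorff_measure_eq_0_iff)
  then show "hausdorff_dim A \<le> ennreal d + ennreal e" using \<open>e > 0\<close> assms(2) by simp
qed

lemma hausdorff_dim_ge:
  assumes "\<And>s. 0 < s \<Longrightarrow> s < d \<Longrightarrow> hcontent s A \<noteq> 0"
  shows "hausdorff_dim A \<ge> ennreal d"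
  unfolding hausdorff_dim_def
  by (intro INF_greatest ennreal_leI) (use assms in \<open>force simp: hausdorff_measure_eq_0_iff\<close>)

lemma hcontent_unit_interval: "d > 0 \<Longrightarrow> hcontent 1 {0..d::real} \<noteq> 0"
proof
  assume d: "d > 0" and "hcontent 1 {0..d} = 0"
  \<comment> \<open>A set of diameter r lies in an interval of length 2 r about any of its points,
    so this cover would have total length at most \<open>d / 2\<close>.\<close>
  then have "hcontent 1 {0..d} < ennreal (d / 4)" by simp
  from hcontent_approx[OF this] obtain U where U: "{0..d} \<subseteq> (\<Union>i. U i)" "\<And>i. bounded (U i)"
    "(\<Sum>i. ennreal (diameter (U i) powr 1)) < ennreal (d / 4)"
    by auto
  define c where "c i = (SOME x. x \<in> U i)" for i
  have sub: "U i \<subseteq> {c i - diameter (U i)..c i + diameter (U i)}" for i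
  proof
    fix x assume x: "x \<in> U i"
    then have "c i \<in> U i" unfolding c_def by (metis someI)
    then have "dist (c i) x \<le> diameter (U i)" using diameter_bounded_bound[OF U(2)] x by blast
    then show "x \<in> {c i - diameter (U i)..c i + diameter (U i)}" by (auto simp: dist_real_def)
  qed
  have "ennreal d = emeasure lborel {0..d}" using d by simp
  also have "\<dots> \<le> emeasure lborel (\<Union>i. {c i - diameter (U i)..c i + diameter (U i)})"
    using U(1) sub by (intro emeasure_mono) (blast, auto)
  also have "\<dots> \<le> (\<Sum>i. emeasure lborel {c i - diameter (U i)..c i + diameter (U i)})"
    by (intro emeasure_subadditive_countably) auto
  also have "\<dots> = (\<Sum>i. 2 * ennreal (diameter (U i)))"
  proof (intro suminf_cong)
    fix i
    have "emeasure lborel {c i - diameter (U i)..c i + diameter (U i)} = ennreal (2 * diameter (U i))"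
      using diameter_ge_0[OF U(2)[of i]] by simp
    then show "emeasure lborel {c i - diameter (U i)..c i + diameter (U i)} = 2 * ennreal (diameter (U i))"
      using diameter_ge_0[OF U(2)[of i]] by (simp add: ennreal_mult)
  qed
  also have "\<dots> = 2 * (\<Sum>i. ennreal (diameter (U i) powr 1))"
    using diameter_ge_0[OF U(2)] by simp
  also have "\<dots> \<le> 2 * ennreal (d / 4)" using U(3) by (intro mult_left_mono) auto
  also have "\<dots> = ennreal (d / 2)" using ennreal_mult[of 2 "d/4"] d by simp
  finally show False using d by (simp add: ennreal_le_iff)
qed

text \<open>The distance from \<open>x\<close> is 1-Lipschitz, and by connectedness it takes all
  values between 0 and \<open>dist x y\<close> on \<open>A\<close>; an interval has positive content
  of exponent 1.\<close>

lemma hcontent_connected: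
  fixes A :: "'a::metric_space set"
  assumes "connected A" "x \<in> A" "y \<in> A" "x \<noteq> y" "0 < s" "s \<le> 1"
  shows "hcontent s A \<noteq> 0"
proof
  assume "hcontent s A = 0"
  then have "hcontent 1 A = 0" using assms hcontent_0_mono_exponent by blast
  then have "hcontent 1 (dist x ` A) = 0"
    by (rule hcontent_lipschitz_image_0[where c = 1])
       (auto simp: dist_real_def abs_le_iff; metis add.commute dist_commute dist_triangle diff_le_eq)+
  moreover have "{0..dist x y} \<subseteq> dist x ` A"
  proof (rule connected_contains_Icc)
    show "connected (dist x ` A)"
      using assms by (intro connected_continuous_image continuous_intros)
  qed (use assms in \<open>force+\<close>)
  ultimately have "hcontent 1 {0..dist x y} = 0" by (rule hcontent_0_subset[rotated])
  then show False using hcontent_unit_interval assms by simp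
qed

text \<open>Closes the self-similarity arguments. Finiteness matters: \<open>\<infinity>\<close>
  satisfies the inequality for every positive \<open>c\<close>.\<close>

lemma ennreal_contraction_0:
  fixes x :: ennreal assumes "x \<le> ennreal c * x" "c < 1" "x < \<infinity>" shows "x = 0"
proof -
  obtain r where r: "x = ennreal r" "r \<ge> 0" using assms(3) by (cases x) auto
  show ?thesis
  proof (cases "c \<ge> 0")
    case True
    then have "r \<le> c * r" using assms(1) r by (simp add: ennreal_mult[symmetric] ennreal_le_iff)
    then have "r = 0" using assms(2) r(2) by (smt (verit) mult_le_cancel_right1)
    then show ?thesis using r by simp
  next
    case False then show ?thesis using assms(1) by (simp add: ennreal_neg)
  qed
qed

text \<open>In dimension n the unit cube is a union of \<open>2 ^ n\<close> copies of half size, so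
  its content is at most \<open>2 powr (n - s)\<close> times itself. Countably many enlarged copies
  exhaust the space.\<close>

lemma hcontent_euclidean_0:
  fixes A :: "'a::euclidean_space set" and s :: real
  assumes "s > DIM('a)" shows "hcontent s A = 0"
proof -
  let ?Q = "cbox 0 (One::'a)"
  have s: "s > 0" using assms of_nat_0_le_iff[of "DIM('a)", where 'a = real] by linarith
  \<comment> \<open>The lower corners of the subcubes of half size.\<close>
  define I where "I = (\<lambda>B. (1/2) *\<^sub>R \<Sum>B) ` Pow (Basis::'a set)"
  have sub: "?Q \<subseteq> (\<Union>c\<in>I. (\<lambda>x. (1/2) *\<^sub>R x + c) ` ?Q)"
  proof
    fix x :: 'a assume x: "x \<in> ?Q"
    define B where "B = {b\<in>Basis. x \<bullet> b > 1/2}"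
    have "(\<Sum>B) \<bullet> b = (if b \<in> B then 1 else 0)" if "b \<in> Basis" for b
    proof -
      have "(\<Sum>B) \<bullet> b = (\<Sum>c\<in>B. if c = b then 1 else 0)"
        unfolding inner_sum_left by (intro sum.cong) (auto simp: B_def inner_Basis that)
      also have "\<dots> = (if b \<in> B then 1 else 0)"
        by (subst sum.delta) (auto simp: B_def intro: finite_subset[OF _ finite_Basis])
      finally show ?thesis .
    qed
    then have "2 *\<^sub>R x - \<Sum>B \<in> ?Q"
      using x by (auto simp: mem_box inner_diff_left B_def)
    moreover have "x = (1/2) *\<^sub>R (2 *\<^sub>R x - \<Sum>B) + (1/2) *\<^sub>R \<Sum>B" by (simp add: scaleR_right_diff_distrib)
    moreover have "(1/2) *\<^sub>R \<Sum>B \<in> I" by (auto simp: I_def B_def)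
    ultimately show "x \<in> (\<Union>c\<in>I. (\<lambda>x. (1/2) *\<^sub>R x + c) ` ?Q)" by blast
  qed
  have finI: "finite I" by (auto simp: I_def)
  have cardI: "real (card I) \<le> 2 ^ DIM('a)"
    using card_image_le[of "Pow (Basis::'a set)" "\<lambda>B. (1/2) *\<^sub>R \<Sum>B"]
    by (simp add: I_def card_Pow)
  have "hcontent s ?Q \<le> (\<Sum>c\<in>I. hcontent s ((\<lambda>x. (1/2) *\<^sub>R x + c) ` ?Q))"
    by (rule order_trans[OF hcontent_mono[OF sub]]) (rule hcontent_finite_UN_le[OF finI s])
  also have "\<dots> \<le> (\<Sum>c\<in>I. ennreal ((1/2) powr s) * hcontent s ?Q)"
    using s by (intro sum_mono hcontent_lipschitz_image) (auto simp: dist_norm scaleR_diff_right[symmetric])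
  also have "\<dots> = of_nat (card I) * (ennreal ((1/2) powr s) * hcontent s ?Q)" by simp
  also have "\<dots> = ennreal (real (card I) * (1/2) powr s) * hcontent s ?Q"
    by (simp add: ennreal_mult mult.assoc ennreal_of_nat_eq_real_of_nat)
  finally have *: "hcontent s ?Q \<le> ennreal (real (card I) * (1/2) powr s) * hcontent s ?Q" .
  have "real (card I) * (1/2) powr s \<le> 2 ^ DIM('a) * (1/2) powr s"
    using cardI by (intro mult_right_mono) auto
  also have "\<dots> = 2 powr (DIM('a) - s)"
    by (simp add: powr_diff powr_realpow powr_divide)
  also have "\<dots> < 2 powr 0" using assms by (intro powr_less_mono) auto
  finally have lt: "real (card I) * (1/2) powr s < 1" by simp
  have "hcontent s ?Q < \<infinity>"
    using hcontent_bounded_le[of ?Q s] s by (auto intro: order_le_less_trans)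
  then have Q0: "hcontent s ?Q = 0" using ennreal_contraction_0[OF * lt] by simp
  \<comment> \<open>The map sends \<open>?Q\<close> to the cube of side \<open>2 * n\<close> centred
    at the origin.\<close>
  have "UNIV \<subseteq> (\<Union>n\<in>(UNIV::nat set). (\<lambda>x. real (2*n) *\<^sub>R (x - (1/2) *\<^sub>R One)) ` ?Q)"
  proof
    fix x :: 'a
    obtain n where n: "real n > norm x + 1" using reals_Archimedean2 by blast
    then have n0: "real n > 0" using norm_ge_zero[of x] by linarith
    have "(1 / real (2*n)) *\<^sub>R x + (1/2) *\<^sub>R One \<in> ?Q"
    proof -
      have "\<bar>x \<bullet> b\<bar> \<le> real n" if "b \<in> Basis" for b
        using Basis_le_norm[OF that, of x] n by linarith
      then show ?thesis using n0
        by (auto simp: mem_box inner_add_left field_simps abs_le_iff; smt (verit))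
    qed
    moreover have "x = real (2*n) *\<^sub>R (((1 / real (2*n)) *\<^sub>R x + (1/2) *\<^sub>R One) - (1/2) *\<^sub>R One)"
      using n0 by simp
    ultimately show "x \<in> (\<Union>n\<in>(UNIV::nat set). (\<lambda>x. real (2*n) *\<^sub>R (x - (1/2) *\<^sub>R One)) ` ?Q)" by blast
  qed
  moreover have "hcontent s (\<Union>n\<in>(UNIV::nat set). (\<lambda>x. real (2*n) *\<^sub>R (x - (1/2) *\<^sub>R One)) ` ?Q) = 0"
  proof (rule hcontent_countable_UN_0)
    fix n :: nat
    show "hcontent s ((\<lambda>x. real (2*n) *\<^sub>R (x - (1/2) *\<^sub>R One)) ` ?Q) = 0"
      by (rule hcontent_lipschitz_image_0[OF Q0 s, where c = "real (2*n)"])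
         (auto simp: dist_norm scaleR_diff_right[symmetric])
  qed (use s in auto)
  ultimately show ?thesis by (rule hcontent_0_subset[OF order_trans[OF subset_UNIV]])
qed

text \<open>Removing 0 leaves the half-line connected, removing any other point does not.\<close>

lemma homeomorphism_halfline_0:
  assumes "homeomorphism {0::real..} {0::real..} f g" shows "f 0 = 0"
proof (rule ccontr)
  assume "f 0 \<noteq> 0"
  moreover have f0: "f 0 \<in> {0..}" using assms by (auto simp: homeomorphism_def)
  ultimately have pos: "f 0 > 0" by auto
  have "connected (f ` {0<..})"
    using assms by (intro connected_continuous_image)
      (auto simp: homeomorphism_def intro: continuous_on_subset)
  moreover have im: "f ` {0<..} = {0..} - {f 0}"
  proof -
    have "inj_on f {0..}" using assms by (metis homeomorphism_def inj_on_inverseI)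
    then have "f ` ({0..} - {0}) = f ` {0..} - f ` {0}" by (intro inj_on_image_set_diff[of _ "{0..}"]) auto
    moreover have "{0..} - {0} = {0::real<..}" by auto
    moreover have "f ` {0..} = {0..}" using assms by (simp add: homeomorphism_def)
    ultimately show ?thesis by simp
  qed
  ultimately have "{0..f 0 + 1} \<subseteq> {0..} - {f 0}"
    using pos by (intro connected_contains_Icc) auto
  then have "f 0 \<in> {0..} - {f 0}" using pos by (meson atLeastAtMost_iff less_add_one less_imp_le subsetD)
  then show False by blast
qed

lemma hair_endpoint_unique:
  assumes "hair_endpoint H e" "hair_endpoint H e'" shows "e = e'"
proof -
  obtain \<gamma> \<gamma>i \<delta> \<delta>i where *: "homeomorphism {0::real..} H \<gamma> \<gamma>i" "homeomorphism {0::real..} H \<delta> \<delta>i" "\<gamma> 0 = e" "\<delta> 0 = e'"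
    using assms unfolding hair_endpoint_def by metis
  have "homeomorphism {0::real..} {0::real..} (\<delta>i \<circ> \<gamma>) (\<gamma>i \<circ> \<delta>)"
    using homeomorphism_compose[OF *(1) homeomorphism_symD[OF *(2)]] .
  then have "\<delta>i (\<gamma> 0) = 0" using homeomorphism_halfline_0 by fastforce
  then have "\<delta> (\<delta>i (\<gamma> 0)) = \<delta> 0" by simp
  moreover have "\<gamma> 0 \<in> H" using *(1) by (auto simp: homeomorphism_def)
  ultimately show ?thesis using * by (simp add: homeomorphism_def)
qed

section \<open>Almost everywhere local Lipschitz bounds\<close>

text \<open>The bound compares values with that at the fixed point \<open>x\<close> only, not at two
  points near \<open>x\<close>; this is exactly what differentiability at \<open>x\<close>
  provides.\<close>

definition lip_at :: "('a::real_normed_vector \<Rightarrow> 'b::real_normed_vector) \<Rightarrow> 'a set \<Rightarrow> real \<Rightarrow> 'a \<Rightarrow> bool" where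
  "lip_at g S c x \<longleftrightarrow> (\<exists>d>0. \<forall>y\<in>S. norm (y - x) < d \<longrightarrow> norm (g y - g x) \<le> c * norm (y - x))"

lemma lip_at_continuous:
  assumes "lip_at g S c x" shows "continuous (at x within S) g"
proof -
  obtain d where d: "d > 0" "\<And>y. y \<in> S \<Longrightarrow> norm (y - x) < d \<Longrightarrow> norm (g y - g x) \<le> c * norm (y - x)"
    using assms unfolding lip_at_def by blast
  have "eventually (\<lambda>y. norm (g y - g x) \<le> c * norm (y - x)) (at x within S)"
    using d unfolding eventually_at by (auto simp: dist_norm)
  moreover have "((\<lambda>y. c * norm (y - x)) \<longlongrightarrow> 0) (at x within S)" by (auto intro!: tendsto_eq_intros)
  ultimately have "((\<lambda>y. g y - g x) \<longlongrightarrow> 0) (at x within S)" by (rule Lim_null_comparison)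
  then show ?thesis by (simp add: continuous_within LIM_zero_cancel)
qed

text \<open>A tagged division that is fine for the local Lipschitz bounds and for the gauge integral of
  the indicator function of the exceptional set turns the pointwise bounds into a global one.\<close>

lemma increment_le_of_ae_lip_at:
  fixes \<phi> :: "real \<Rightarrow> 'b::real_normed_vector"
  assumes L: "L \<ge> 0" and N: "negligible N"
    and lip: "\<And>t. t \<in> {0..1} \<Longrightarrow> lip_at \<phi> {0..1} L t"
    and ae: "\<And>t e. t \<in> {0..1} \<Longrightarrow> t \<notin> N \<Longrightarrow> e > 0 \<Longrightarrow> lip_at \<phi> {0..1} (\<alpha> + e) t"
    and \<alpha>: "\<alpha> \<ge> 0"
  shows "norm (\<phi> 1 - \<phi> 0) \<le> \<alpha>"
proof (rule field_le_epsilon)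
  fix \<epsilon> :: real assume \<epsilon>: "\<epsilon> > 0"
  \<comment> \<open>The error consists of \<open>e\<close> from the tags outside \<open>N\<close>
    and \<open>L * e\<close> from those in \<open>N\<close>.\<close>
  define e where "e = \<epsilon> / (1 + L)"
  have e: "e > 0" using \<epsilon> L by (simp add: e_def)
  define c where "c t = (if t \<in> N then L else \<alpha> + e)" for t
  have c0: "c t \<ge> 0" for t using L \<alpha> e by (simp add: c_def)
  have "\<exists>d>0. t \<in> {0..1} \<longrightarrow> (\<forall>y\<in>{0..1}. norm (y - t) < d \<longrightarrow> norm (\<phi> y - \<phi> t) \<le> c t * norm (y - t))" for t
    using lip[of t] ae[of t e] e unfolding lip_at_def c_def by (cases "t \<in> {0..1}") (auto intro: exI[of _ 1])
  then obtain d where d: "\<And>t. d t > 0"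
    "\<And>t y. t \<in> {0..1} \<Longrightarrow> y \<in> {0..1} \<Longrightarrow> norm (y - t) < d t \<Longrightarrow> norm (\<phi> y - \<phi> t) \<le> c t * norm (y - t)"
    by metis
  have "((indicator N :: real \<Rightarrow> real) has_integral 0) {0..1}"
    using N unfolding negligible_def by (metis box_real(2))
  then obtain \<gamma> where \<gamma>: "gauge \<gamma>"
    "\<And>p. p tagged_division_of {0..1} \<Longrightarrow> \<gamma> fine p \<Longrightarrow>
       norm ((\<Sum>(x,k)\<in>p. measure lborel k *\<^sub>R (indicator N x :: real)) - 0) < e"
    using e unfolding has_integral_real by metis
  have "gauge (\<lambda>t. ball t (d t))" using d(1) by (simp add: gauge_def)
  then have "gauge (\<lambda>t. \<gamma> t \<inter> ball t (d t))" using \<gamma>(1) by (simp add: gauge_Int)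
  then obtain p where p: "p tagged_division_of {0..1}" "(\<lambda>t. \<gamma> t \<inter> ball t (d t)) fine p"
    by (rule fine_division_exists_real)
  then have "\<gamma> fine p" by (auto simp: fine_def)
  then have small: "norm (\<Sum>(x,k)\<in>p. measure lborel k *\<^sub>R (indicator N x :: real)) < e"
    using \<gamma>(2) p(1) by fastforce
  have "\<phi> 1 - \<phi> 0 = (\<Sum>(x,k)\<in>p. \<phi> (Sup k) - \<phi> (Inf k))"
    using additive_tagged_division_1[OF _ p(1), of \<phi>] by simp
  also have "norm \<dots> \<le> (\<Sum>(x,k)\<in>p. (\<alpha> + e) * measure lborel k + L * (measure lborel k *\<^sub>R (indicator N x :: real)))"
  proof (rule sum_norm_le, clarify)
    fix t k assume tk: "(t, k) \<in> p"
    obtain u v where k: "k = cbox u v" using tagged_division_ofD(4)[OF p(1) tk] by blast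
    have t: "t \<in> k" using tagged_division_ofD(2)[OF p(1) tk] .
    then have uv: "u \<le> t" "t \<le> v" by (auto simp: k)
    have k01: "k \<subseteq> {0..1}" using tagged_division_ofD(3)[OF p(1) tk] .
    have kb: "k \<subseteq> ball t (d t)" using p(2) tk by (auto simp: fine_def)
    have mem: "u \<in> k" "v \<in> k" using uv by (auto simp: k)
    have SI: "Sup k = v" "Inf k = u" using uv by (auto simp: k cSup_atLeastAtMost cInf_atLeastAtMost)
    have "norm (\<phi> w - \<phi> t) \<le> c t * norm (w - t)" if "w \<in> k" for w
    proof (rule d(2))
      have "w \<in> ball t (d t)" using kb that by blast
      then show "norm (w - t) < d t" by (simp add: dist_norm norm_minus_commute)
    qed (use t that k01 in auto)
    note this[OF mem(1)] this[OF mem(2)]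
    then have "norm (\<phi> v - \<phi> u) \<le> c t * (t - u) + c t * (v - t)"
      using uv norm_triangle_ineq4[of "\<phi> v - \<phi> t" "\<phi> u - \<phi> t"] by simp
    also have "\<dots> = c t * measure lborel k" using uv by (simp add: k algebra_simps)
    also have "\<dots> \<le> ((\<alpha> + e) + L * indicator N t) * measure lborel k"
      using \<alpha> e by (intro mult_right_mono) (auto simp: c_def)
    finally show "norm (\<phi> (Sup k) - \<phi> (Inf k)) \<le> (\<alpha> + e) * measure lborel k + L * (measure lborel k *\<^sub>R (indicator N t :: real))"
      by (simp add: SI algebra_simps)
  qed
  also have "\<dots> = (\<alpha> + e) * (\<Sum>(x,k)\<in>p. measure lborel k) + L * (\<Sum>(x,k)\<in>p. measure lborel k *\<^sub>R (indicator N x :: real))"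
    by (simp add: sum.distrib sum_distrib_left case_prod_unfold)
  also have "(\<Sum>(x,k)\<in>p. measure lborel k) = measure lborel {0..1::real}"
    using additive_content_tagged_division[of p 0 "1::real"] p(1) by simp
  also have "(\<alpha> + e) * measure lborel {0..1::real} + L * (\<Sum>(x,k)\<in>p. measure lborel k *\<^sub>R (indicator N x :: real))
      \<le> (\<alpha> + e) + L * e"
    using small L by (intro add_mono mult_left_mono) auto
  also have "\<dots> = \<alpha> + \<epsilon>" using L by (simp add: e_def field_simps add_nonneg_eq_0_iff)
  finally show "norm (\<phi> 1 - \<phi> 0) \<le> \<alpha> + \<epsilon>" .
qed

text \<open>For fixed \<open>t\<close> the offending \<open>z\<close> form a translate of
  \<open>N\<close>, hence a null set; Fubini exchanges the roles of \<open>z\<close> and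
  \<open>t\<close>.\<close>

lemma negligible_ae_line:
  fixes v x :: "'a::euclidean_space"
  assumes "negligible N"
  shows "AE z in lborel. negligible {t::real. x + z + t *\<^sub>R v \<in> N}"
proof -
  \<comment> \<open>A Borel null set containing \<open>N\<close> makes the integrand below jointly
    measurable.\<close>
  obtain N' where N': "N' \<in> null_sets lborel" "N \<subseteq> N'"
    using assms unfolding negligible_iff_null_sets null_sets_completion_iff2 by blast
  have [measurable]: "N' \<in> sets borel" using N'(1) by (auto simp: null_sets_def)
  define g :: "'a \<Rightarrow> real \<Rightarrow> ennreal" where "g z t = indicator N' (x + z + t *\<^sub>R v)" for z t
  have meas: "case_prod g \<in> borel_measurable (lborel \<Otimes>\<^sub>M lborel)"
    unfolding g_def case_prod_unfold by measurable
  have "(\<integral>\<^sup>+ z. (\<integral>\<^sup>+ t. g z t \<partial>lborel) \<partial>lborel) = (\<integral>\<^sup>+ t. (\<integral>\<^sup>+ z. g z t \<partial>lborel) \<partial>lborel)"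
    by (rule lborel_pair.Fubini'[OF meas, symmetric])
  also have "\<dots> = (\<integral>\<^sup>+ (t::real). 0 \<partial>lborel)"
  proof (rule nn_integral_cong)
    fix t :: real
    have "(\<integral>\<^sup>+ z. g z t \<partial>lborel) = (\<integral>\<^sup>+ z. indicator N' z \<partial>distr lborel borel (\<lambda>z. (x + t *\<^sub>R v) + z))"
      unfolding g_def by (subst nn_integral_distr) (auto simp: algebra_simps)
    also have "\<dots> = 0" unfolding lborel_distr_plus using N'(1) by (simp add: null_sets_def)
    finally show "(\<integral>\<^sup>+ z. g z t \<partial>lborel) = 0" .
  qed
  finally have 0: "(\<integral>\<^sup>+ z. (\<integral>\<^sup>+ t. g z t \<partial>lborel) \<partial>lborel) = 0" by simp
  have "AE z in lborel. (\<integral>\<^sup>+ t. g z t \<partial>lborel) = 0"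
    using 0 lborel.borel_measurable_nn_integral[OF meas] by (subst (asm) nn_integral_0_iff_AE) auto
  then show ?thesis
  proof (rule AE_mp, intro AE_I2 impI)
    fix z assume z: "(\<integral>\<^sup>+ t. g z t \<partial>lborel) = 0"
    have S: "{t. x + z + t *\<^sub>R v \<in> N'} \<in> sets lborel" by measurable
    have "(\<integral>\<^sup>+ t. g z t \<partial>lborel) = emeasure lborel {t. x + z + t *\<^sub>R v \<in> N'}"
      using nn_integral_indicator[OF S] by (simp add: g_def indicator_def)
    then have "{t. x + z + t *\<^sub>R v \<in> N'} \<in> null_sets lborel" using z S by (auto simp: null_sets_def)
    then have "negligible {t. x + z + t *\<^sub>R v \<in> N'}"
      by (simp add: negligible_iff_null_sets null_sets_completionI)
    then show "negligible {t. x + z + t *\<^sub>R v \<in> N}"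
      by (rule negligible_subset) (use N'(2) in auto)
  qed
qed

text \<open>The segment from \<open>x\<close> to \<open>y\<close> may lie in \<open>N\<close>, but
  arbitrarily small translates of it meet \<open>N\<close> in a null set of parameters. The
  increment bound holds along these, and \<open>g\<close> is continuous.\<close>

lemma ae_lip_at_imp_lipschitz:
  fixes g :: "'a::euclidean_space \<Rightarrow> 'b::real_normed_vector"
  assumes S: "open S" "convex S" and L: "L \<ge> 0" and N: "negligible N" and \<alpha>: "\<alpha> \<ge> 0"
    and lip: "\<And>x. x \<in> S \<Longrightarrow> lip_at g S L x"
    and ae: "\<And>x e. x \<in> S \<Longrightarrow> x \<notin> N \<Longrightarrow> e > 0 \<Longrightarrow> lip_at g S (\<alpha> + e) x"
    and xy: "x \<in> S" "y \<in> S"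
  shows "norm (g x - g y) \<le> \<alpha> * norm (x - y)"
proof -
  have cont: "continuous (at x) g" if "x \<in> S" for x
    using lip_at_continuous[OF lip[OF that]] unfolding at_within_open[OF that S(1)] .
  define v where "v = y - x"
  obtain r where r: "r > 0" "ball x r \<subseteq> S" "ball y r \<subseteq> S"
  proof -
    obtain r1 r2 where "r1 > 0" "ball x r1 \<subseteq> S" "r2 > 0" "ball y r2 \<subseteq> S"
      using S(1) xy by (meson openE)
    then show thesis by (intro that[of "min r1 r2"]) auto
  qed
  define good where "good = {z. negligible {t::real. x + z + t *\<^sub>R v \<in> N}}"
  have bound: "norm (g (y + z) - g (x + z)) \<le> \<alpha> * norm v" if z: "z \<in> good" "norm z < r" for z
  proof -
    define p where "p t = x + z + t *\<^sub>R v" for t :: real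
    have pS: "p t \<in> S" if "t \<in> {0..1}" for t
    proof -
      have "x + z \<in> S" "y + z \<in> S" using z(2) r by (auto simp: dist_norm)
      moreover have "p t = (1 - t) *\<^sub>R (x + z) + t *\<^sub>R (y + z)" by (simp add: p_def v_def algebra_simps)
      ultimately show ?thesis using S(2) that by (simp add: convexD_alt)
    qed
    have lp: "lip_at (g \<circ> p) {0..1} (c * norm v) t" if "lip_at g S c (p t)" "t \<in> {0..1}" for c t
    proof -
      obtain d where d: "d > 0" "\<And>y. y \<in> S \<Longrightarrow> norm (y - p t) < d \<Longrightarrow> norm (g y - g (p t)) \<le> c * norm (y - p t)"
        using \<open>lip_at g S c (p t)\<close> unfolding lip_at_def by blast
      have pp: "norm (p u - p t) = norm (u - t) * norm v" for u
        by (simp add: p_def scaleR_diff_left[symmetric])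
      show ?thesis unfolding lip_at_def
      proof (intro exI[of _ "d / (norm v + 1)"] conjI ballI impI)
        fix u assume u: "u \<in> {0..1::real}" "norm (u - t) < d / (norm v + 1)"
        have "norm (u - t) * norm v \<le> norm (u - t) * (norm v + 1)" by (intro mult_left_mono) auto
        also have "\<dots> < d" using u(2) by (simp add: pos_less_divide_eq add_nonneg_pos)
        finally show "norm ((g \<circ> p) u - (g \<circ> p) t) \<le> c * norm v * norm (u - t)"
          using d(2)[OF pS[OF u(1)]] by (simp add: pp mult_ac)
      qed (use d(1) in \<open>simp add: add_nonneg_pos\<close>)
    qed
    have "norm ((g \<circ> p) 1 - (g \<circ> p) 0) \<le> \<alpha> * norm v"
    proof (rule increment_le_of_ae_lip_at)
      show "negligible {t. p t \<in> N}" using z(1) by (simp add: good_def p_def)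
      show "lip_at (g \<circ> p) {0..1} (L * norm v) t" if "t \<in> {0..1}" for t
        using lp[OF lip[OF pS] that] that by blast
      fix t e :: real assume t: "t \<in> {0..1}" "t \<notin> {t. p t \<in> N}" "e > 0"
      \<comment> \<open>The summand 1 keeps the divisor positive when \<open>x = y\<close>.\<close>
      have "lip_at (g \<circ> p) {0..1} ((\<alpha> + e / (norm v + 1)) * norm v) t"
        using t by (intro lp ae pS) (auto simp: add_nonneg_pos)
      moreover have "(\<alpha> + e / (norm v + 1)) * norm v \<le> \<alpha> * norm v + e"
      proof -
        have "e / (norm v + 1) * norm v \<le> e / (norm v + 1) * (norm v + 1)"
          using t by (intro mult_left_mono) (auto intro: add_nonneg_nonneg)
        also have "\<dots> = e" by (simp add: add_nonneg_eq_0_iff)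
        finally show ?thesis by (simp add: algebra_simps)
      qed
      ultimately show "lip_at (g \<circ> p) {0..1} (\<alpha> * norm v + e) t"
        unfolding lip_at_def by (meson mult_right_mono norm_ge_zero order_trans)
    qed (use L \<alpha> in auto)
    then show ?thesis by (simp add: p_def v_def algebra_simps)
  qed
  have "\<exists>z\<in>good. norm z < e" if "e > 0" for e
  proof (rule ccontr)
    assume "\<not> ?thesis"
    then have "ball 0 e \<subseteq> - good" by auto
    moreover have "negligible (- good)"
    proof -
      obtain Z where "Z \<in> null_sets lebesgue" "\<And>z. z \<notin> Z \<Longrightarrow> z \<in> good"
        using AE_E3[OF AE_completion[OF negligible_ae_line[OF N, of x v]]] by (auto simp: good_def)
      then show ?thesis unfolding negligible_iff_null_sets[symmetric]
        by (meson ComplD negligible_subset subsetI)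
    qed
    ultimately have "negligible (ball (0::'a) e)" by (rule negligible_subset[rotated])
    then show False using that open_not_negligible[of "ball (0::'a) e"] by simp
  qed
  then have "\<exists>z\<in>good. norm z < min r (1 / Suc n)" for n :: nat
    using r(1) by (intro \<open>\<And>e. 0 < e \<Longrightarrow> \<exists>z\<in>good. norm z < e\<close>) auto
  then obtain z where z: "\<And>n. z n \<in> good" "\<And>n::nat. norm (z n) < min r (1 / Suc n)"
    by metis
  have z0: "z \<longlonglongrightarrow> 0"
    by (rule Lim_null_comparison[OF _ LIMSEQ_Suc[OF lim_1_over_n]])
       (use z(2) in \<open>auto intro!: always_eventually less_imp_le\<close>)
  have "(\<lambda>n. norm (g (y + z n) - g (x + z n))) \<longlonglongrightarrow> norm (g (y + 0) - g (x + 0))"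
    using cont xy by (intro tendsto_intros isCont_tendsto_compose[where g = g] z0) auto
  then have "norm (g y - g x) \<le> \<alpha> * norm v"
    using bound z by (intro tendsto_upperbound[where F = sequentially]) auto
  then show ?thesis by (simp add: v_def norm_minus_commute)
qed

section \<open>The Zorich map and its inverse branches\<close>

lemma norm_real3: "norm (x::real^3) = sqrt ((x$1)\<^sup>2 + (x$2)\<^sup>2 + (x$3)\<^sup>2)"
  by (simp add: norm_vec_def L2_set_def sum_3)

lemma norm_real2: "norm (x::real^2) = sqrt ((x$1)\<^sup>2 + (x$2)\<^sup>2)"
  by (simp add: norm_vec_def L2_set_def sum_2)

lemma norm_real3_le: "norm (x::real^3) \<le> \<bar>x$1\<bar> + \<bar>x$2\<bar> + \<bar>x$3\<bar>"
  using norm_le_l1_cart[of x] by (simp add: sum_3)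

section \<open>Beams and the folding of the horizontal coordinates\<close>

definition hor :: "real^3 \<Rightarrow> real^2" where "hor x = vector [x$1, x$2]"

lemma hor_nth [simp]: "hor x $ 1 = x $ 1" "hor x $ 2 = x $ 2"
  by (simp_all add: hor_def)

lemma hor_diff: "hor (x - y) = hor x - hor y"
  by (simp add: hor_def vec_eq_iff forall_2)

lemma norm_hor_le: "norm (hor x) \<le> norm x"
  by (simp add: norm_real2 norm_real3)

lemma norm_le_hor: "norm (x::real^3) \<le> norm (hor x) + \<bar>x$3\<bar>"
  unfolding norm_real2 norm_real3 hor_nth
  by (rule order_trans[OF sqrt_add_le_add_sqrt]) auto

definition psgn :: "int \<Rightarrow> real" where "psgn r = (if even r then 1 else -1)"

lemma psgn_simps [simp]: "psgn r * psgn r = 1" "psgn r * (psgn r * x) = x" "\<bar>psgn r\<bar> = 1" "(psgn r)\<^sup>2 = 1"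
  by (auto simp: psgn_def)

lemma powi_psgn: "(-1) powi r = psgn r"
  by (simp add: psgn_def power_int_minus_left)

text \<open>The beams are closed, so that a point on a side lies in several of them. Statements
  about \<open>F\<close> are made for each such \<open>r\<close>; \<open>beam_index\<close> selects
  one.\<close>

definition in_beam :: "int \<times> int \<Rightarrow> real^3 \<Rightarrow> bool" where
  "in_beam r x \<longleftrightarrow> \<bar>x$1 - 2 * of_int (fst r)\<bar> \<le> 1 \<and> \<bar>x$2 - 2 * of_int (snd r)\<bar> \<le> 1"

definition beam_index :: "real^3 \<Rightarrow> int \<times> int" where
  "beam_index x = (\<lfloor>(x$1 + 1) / 2\<rfloor>, \<lfloor>(x$2 + 1) / 2\<rfloor>)"

lemma fold_coord_eq:
  assumes "\<bar>u - 2 * of_int r\<bar> \<le> 1"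
  shows "fold_coord u = psgn r * (u - 2 * of_int r)"
proof (cases "even r")
  case True
  then obtain j where r: "r = 2 * j" by blast
  have "\<lfloor>(u + 1) / 4\<rfloor> = j" using assms by (auto simp: floor_eq_iff r abs_le_iff)
  then show ?thesis using assms by (auto simp: fold_coord_def r psgn_def Let_def)
next
  case False
  then obtain j where r: "r = 2 * j + 1" using oddE by blast
  show ?thesis
  proof (cases "u = 4 * of_int j + 3")
    case True
    have "\<lfloor>(u + 1) / 4\<rfloor> = j + 1" by (simp add: True floor_eq_iff)
    then show ?thesis by (simp add: fold_coord_def r psgn_def True)
  next
    case False
    have "\<lfloor>(u + 1) / 4\<rfloor> = j" using assms False by (auto simp: floor_eq_iff r abs_le_iff)
    then show ?thesis using assms by (auto simp: fold_coord_def r psgn_def Let_def)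
  qed
qed

lemma in_beam_index: "in_beam (beam_index x) x"
proof -
  have "\<bar>u - 2 * of_int \<lfloor>(u + 1) / 2\<rfloor>\<bar> \<le> 1" for u :: real
    using floor_correct[of "(u + 1) / 2"] by (simp add: abs_le_iff field_simps)
  then show ?thesis by (simp add: in_beam_def beam_index_def)
qed

text \<open>Where two closed intervals meet, the common end shares one of them with every nearby
  point on either side. This is what turns Lipschitz estimates on single beams into pointwise
  estimates at all points, including the sides.\<close>

lemma common_beam_coord:
  fixes u :: real
  shows "\<exists>d>0. \<forall>v. \<bar>v - u\<bar> < d \<longrightarrow> (\<exists>r::int. \<bar>u - 2 * of_int r\<bar> \<le> 1 \<and> \<bar>v - 2 * of_int r\<bar> \<le> 1)"
proof -
  define r where "r = \<lfloor>(u + 1) / 2\<rfloor>"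
  have r: "-1 \<le> u - 2 * of_int r" "u - 2 * of_int r < 1" unfolding r_def
    using floor_correct[of "(u + 1) / 2"] by (simp_all add: field_simps)
  show ?thesis
  proof (cases "u - 2 * of_int r = -1")
    case True
    show ?thesis
    proof (intro exI[of _ "1::real"] conjI allI impI)
      fix v assume "\<bar>v - u\<bar> < 1"
      then have "\<bar>u - 2 * of_int r\<bar> \<le> 1 \<and> \<bar>v - 2 * of_int r\<bar> \<le> 1 \<or>
         \<bar>u - 2 * of_int (r - 1)\<bar> \<le> 1 \<and> \<bar>v - 2 * of_int (r - 1)\<bar> \<le> 1"
        using True by auto
      then show "\<exists>r::int. \<bar>u - 2 * of_int r\<bar> \<le> 1 \<and> \<bar>v - 2 * of_int r\<bar> \<le> 1" by blast
    qed simp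
  next
    case False
    show ?thesis
    proof (intro exI[of _ "min (u - 2 * of_int r + 1) (1 - (u - 2 * of_int r))"] conjI allI impI)
      fix v assume "\<bar>v - u\<bar> < min (u - 2 * of_int r + 1) (1 - (u - 2 * of_int r))"
      then show "\<exists>r::int. \<bar>u - 2 * of_int r\<bar> \<le> 1 \<and> \<bar>v - 2 * of_int r\<bar> \<le> 1"
        using r by (intro exI[of _ r]) auto
    qed (use r False in auto)
  qed
qed

lemma common_beam:
  "\<exists>d>0. \<forall>y. norm (y - x) < d \<longrightarrow> (\<exists>r. in_beam r x \<and> in_beam r y)"
proof -
  obtain d1 where d1: "d1 > 0" "\<And>v. \<bar>v - x$1\<bar> < d1 \<Longrightarrow> \<exists>r::int. \<bar>x$1 - 2 * of_int r\<bar> \<le> 1 \<and> \<bar>v - 2 * of_int r\<bar> \<le> 1"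
    using common_beam_coord[of "x$1"] by auto
  obtain d2 where d2: "d2 > 0" "\<And>v. \<bar>v - x$2\<bar> < d2 \<Longrightarrow> \<exists>r::int. \<bar>x$2 - 2 * of_int r\<bar> \<le> 1 \<and> \<bar>v - 2 * of_int r\<bar> \<le> 1"
    using common_beam_coord[of "x$2"] by auto
  show ?thesis
  proof (intro exI[of _ "min d1 d2"] conjI allI impI)
    fix y assume "norm (y - x) < min d1 d2"
    then have "\<bar>y$1 - x$1\<bar> < d1" "\<bar>y$2 - x$2\<bar> < d2"
      using component_le_norm_cart[of "y - x" 1] component_le_norm_cart[of "y - x" 2] by auto
    then show "\<exists>r. in_beam r x \<and> in_beam r y" using d1(2) d2(2) unfolding in_beam_def by fastforce
  qed (use d1 d2 in auto)
qed

lemma abs_exp_diff_le: "u \<le> c \<Longrightarrow> v \<le> c \<Longrightarrow> \<bar>exp u - exp v\<bar> \<le> exp c * \<bar>u - v\<bar>" for u v c :: real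
proof (induction u v rule: linorder_wlog)
  case (le u v)
  have "exp v * (1 + (u - v)) \<le> exp v * exp (u - v)" by (intro mult_left_mono exp_ge_add_one_self) auto
  then have "exp v - exp u \<le> exp v * (v - u)" by (simp add: exp_diff algebra_simps)
  also have "\<dots> \<le> exp c * (v - u)" using le by (intro mult_right_mono) auto
  finally show ?case using le by simp
next
  case (sym u v) then show ?case by (simp add: abs_minus_commute)
qed

lemma abs_ln_diff_le: "\<bar>ln u - ln v\<bar> \<le> \<bar>u - v\<bar> / \<rho>" if "\<rho> > 0" "u \<ge> \<rho>" "v \<ge> \<rho>" for u v \<rho> :: real
  using that(2,3)
proof (induction u v rule: linorder_wlog)
  case (le u v)
  have "ln v - ln u \<le> (v - u) / u" using le that by (intro ln_diff_le) auto
  also have "\<dots> \<le> (v - u) / \<rho>" using le that by (intro divide_left_mono) auto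
  finally show ?case using le that by simp
next
  case (sym u v) then show ?case by (simp add: abs_minus_commute)
qed

lemma lip_at_of_has_derivative:
  assumes "(g has_derivative D) (at x)" "onorm D \<le> \<alpha>" "e > 0"
  shows "lip_at g S (\<alpha> + e) x"
proof -
  obtain d where d: "d > 0" "\<And>y. norm (y - x) < d \<Longrightarrow> norm (g y - g x - D (y - x)) \<le> e * norm (y - x)"
    using assms(1,3) unfolding has_derivative_at_alt by blast
  have "norm (g y - g x) \<le> (\<alpha> + e) * norm (y - x)" if "norm (y - x) < d" for y
  proof -
    have "norm (D (y - x)) \<le> onorm D * norm (y - x)"
      using assms(1) by (intro onorm has_derivative_bounded_linear)
    also have "\<dots> \<le> \<alpha> * norm (y - x)" using assms(2) by (intro mult_right_mono) auto
    finally show ?thesis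
      using norm_triangle_ineq[of "g y - g x - D (y - x)" "D (y - x)"] d(2)[OF that]
      by (simp add: algebra_simps)
  qed
  then show ?thesis unfolding lip_at_def using d(1) by blast
qed

lemma lower_norm_le:
  assumes "linear D" "lower_norm D \<ge> c" shows "c * norm v \<le> norm (D v)"
proof (cases "v = 0")
  case False
  have "c \<le> norm (D (v /\<^sub>R norm v))"
    using assms(2) unfolding lower_norm_def
    by (rule order_trans) (intro cINF_lower bdd_belowI2[where m = 0], use False in auto)
  also have "\<dots> = norm (D v) / norm v" by (simp add: linear_cmul[OF assms(1)] divide_inverse_commute)
  finally show ?thesis using False by (simp add: pos_le_divide_eq)
qed (use assms(1) in \<open>simp add: linear_0\<close>)

lemma normalize_diff:
  fixes y z :: "'v::real_normed_vector"
  assumes "norm y \<ge> \<rho>" "\<rho> > 0" "z \<noteq> 0"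
  shows "norm (y /\<^sub>R norm y - z /\<^sub>R norm z) \<le> 2 / \<rho> * norm (y - z)"
proof -
  have y: "norm y > 0" using assms by linarith
  have "y /\<^sub>R norm y - z /\<^sub>R norm z = (y - z) /\<^sub>R norm y + (1 / norm y - 1 / norm z) *\<^sub>R z"
    by (simp add: algebra_simps divide_inverse)
  also have "norm \<dots> \<le> norm (y - z) / norm y + \<bar>1 / norm y - 1 / norm z\<bar> * norm z"
    by (rule order_trans[OF norm_triangle_ineq]) (simp add: divide_inverse mult.commute)
  also have "\<bar>1 / norm y - 1 / norm z\<bar> * norm z = \<bar>norm z - norm y\<bar> / norm y"
  proof -
    have "1 / norm y - 1 / norm z = (norm z - norm y) / (norm y * norm z)"
      using y assms(3) by (simp add: field_simps)
    then show ?thesis using y assms(3) by (simp add: abs_mult abs_divide)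
  qed
  also have "\<dots> \<le> norm (y - z) / norm y"
    using norm_triangle_ineq3[of z y] y by (intro divide_right_mono) (auto simp: norm_minus_commute)
  also have "norm (y - z) / norm y + norm (y - z) / norm y = 2 * norm (y - z) / norm y" by simp
  also have "\<dots> \<le> 2 * norm (y - z) / \<rho>" using assms y by (intro divide_left_mono) auto
  finally show ?thesis by simp
qed

section \<open>Polar form of \<open>F\<close> and its inverse branches\<close>

locale zorich_base =
  fixes h :: "real^2 \<Rightarrow> real^3" and g :: "real^3 \<Rightarrow> real^2" and L :: real
  assumes hom: "homeomorphism unit_square upper_hemisphere h g"
    and lip_h: "L-lipschitz_on unit_square h" and lip_g: "L-lipschitz_on upper_hemisphere g"
begin

abbreviation "F \<equiv> zorich h"

lemma bilip: "bilipschitz_homeomorphism unit_square upper_hemisphere h"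
  unfolding bilipschitz_homeomorphism_def using hom lip_h lip_g by blast

lemma L0: "L \<ge> 0" using lip_h by (rule lipschitz_on_nonneg)

definition cell :: "real^3 \<Rightarrow> real^2" where
  "cell x = vector [fold_coord (x$1), fold_coord (x$2)]"

lemma cell_in: "cell x \<in> unit_square"
  by (simp add: cell_def unit_square_def fold_coord_bound)

lemma cell_eq: "in_beam r x \<Longrightarrow>
    cell x = vector [psgn (fst r) * (x$1 - 2 * of_int (fst r)), psgn (snd r) * (x$2 - 2 * of_int (snd r))]"
  unfolding cell_def in_beam_def using fold_coord_eq by metis

lemma h_in: "p \<in> unit_square \<Longrightarrow> h p \<in> upper_hemisphere"
  using hom by (auto simp: homeomorphism_def)

lemma g_in: "y \<in> upper_hemisphere \<Longrightarrow> g y \<in> unit_square"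
  using hom by (auto simp: homeomorphism_def)

lemma hg [simp]: "y \<in> upper_hemisphere \<Longrightarrow> h (g y) = y"
  and gh [simp]: "p \<in> unit_square \<Longrightarrow> g (h p) = p"
  using hom by (auto simp: homeomorphism_def)

lemma hemisphere_norm: "y \<in> upper_hemisphere \<longleftrightarrow> norm y = 1 \<and> y$3 \<ge> 0"
  by (simp add: upper_hemisphere_def norm_real3)

text \<open>The direction of \<open>F x\<close>, whose norm is \<open>exp (x $ 3)\<close>. The sign
  is taken from \<open>r\<close>, so that two points of one closed beam are compared with the same
  sign.\<close>

definition dir :: "int \<times> int \<Rightarrow> real^3 \<Rightarrow> real^3" where
  "dir r x = vector [h (cell x) $ 1, h (cell x) $ 2, psgn (fst r + snd r) * h (cell x) $ 3]"

lemma F_eq: "in_beam r x \<Longrightarrow> F x = exp (x$3) *\<^sub>R dir r x"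
  using zorich_beam[OF bilip, of x "fst r" "snd r" "h (cell x)"]
  by (simp add: in_beam_def dir_def cell_def powi_psgn)

lemma norm_dir: "norm (dir r x) = 1"
  using h_in[OF cell_in[of x]] by (simp add: dir_def norm_real3 upper_hemisphere_def power_mult_distrib)

lemma norm_F: "norm (F x) = exp (x$3)"
  by (simp add: F_eq[OF in_beam_index] norm_dir)

lemma cell_diff:
  assumes "in_beam r x" "in_beam r y" shows "norm (cell x - cell y) \<le> norm (x - y)"
proof -
  have "norm (cell x - cell y) = norm (hor (x - y))"
    by (simp add: cell_eq[OF assms(1)] cell_eq[OF assms(2)] norm_real2 right_diff_distrib[symmetric] power_mult_distrib)
  then show ?thesis using norm_hor_le[of "x - y"] by simp
qed

lemma dir_diff:
  assumes "in_beam r x" "in_beam r y" shows "norm (dir r x - dir r y) \<le> L * norm (x - y)"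
proof -
  have "norm (dir r x - dir r y) = norm (h (cell x) - h (cell y))"
    by (simp add: dir_def norm_real3 right_diff_distrib[symmetric] power_mult_distrib)
  also have "\<dots> \<le> L * norm (cell x - cell y)"
    using lipschitz_onD[OF lip_h cell_in cell_in] by (simp add: dist_norm)
  also have "\<dots> \<le> L * norm (x - y)" using cell_diff[OF assms] L0 by (intro mult_left_mono)
  finally show ?thesis .
qed

lemma F_lipschitz_beam:
  assumes "in_beam r x" "in_beam r y" "x$3 \<le> c" "y$3 \<le> c"
  shows "norm (F x - F y) \<le> exp c * (1 + L) * norm (x - y)"
proof -
  have "F x - F y = (exp (x$3) - exp (y$3)) *\<^sub>R dir r x + exp (y$3) *\<^sub>R (dir r x - dir r y)"
    by (simp add: F_eq[OF assms(1)] F_eq[OF assms(2)] algebra_simps)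
  also have "norm \<dots> \<le> \<bar>exp (x$3) - exp (y$3)\<bar> + exp (y$3) * norm (dir r x - dir r y)"
    by (rule order_trans[OF norm_triangle_ineq]) (simp add: norm_dir)
  also have "\<dots> \<le> exp c * norm (x - y) + exp c * (L * norm (x - y))"
  proof (intro add_mono mult_mono)
    have "\<bar>exp (x$3) - exp (y$3)\<bar> \<le> exp c * \<bar>x$3 - y$3\<bar>" using assms by (intro abs_exp_diff_le)
    also have "\<dots> \<le> exp c * norm (x - y)"
      using component_le_norm_cart[of "x - y" 3] by (intro mult_left_mono) auto
    finally show "\<bar>exp (x$3) - exp (y$3)\<bar> \<le> exp c * norm (x - y)" .
  qed (use assms dir_diff in auto)
  finally show ?thesis by (simp add: algebra_simps)
qed

lemma lip_at_F:
  assumes "x$3 < c" shows "lip_at F UNIV (exp c * (1 + L)) x"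
proof -
  obtain d where d: "d > 0" "\<And>y. norm (y - x) < d \<Longrightarrow> \<exists>r. in_beam r x \<and> in_beam r y"
    using common_beam[of x] by auto
  have "norm (F y - F x) \<le> exp c * (1 + L) * norm (y - x)" if "norm (y - x) < min d (c - x$3)" for y
  proof -
    have "\<exists>r. in_beam r x \<and> in_beam r y" using d(2)[rule_format, of y] that by simp
    then obtain r where r: "in_beam r x" "in_beam r y" by blast
    show ?thesis using component_le_norm_cart[of "y - x" 3] that assms
      by (intro F_lipschitz_beam[OF r(2,1)]) auto
  qed
  then show ?thesis unfolding lip_at_def using d(1) assms
    by (intro exI[of _ "min d (c - x$3)"]) auto
qed

lemma continuous_F: "continuous_on S F"
proof (intro continuous_at_imp_continuous_on ballI)
  show "isCont F x" for x using lip_at_continuous[OF lip_at_F[of x "x$3 + 1"]] by simp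
qed

text \<open>The inverse of \<open>F\<close> on the beam \<open>r\<close> in polar form: the norm
  yields the height, the direction yields the horizontal position by way of \<open>g\<close>, and
  \<open>psgn\<close> undoes the folding. It inverts \<open>F\<close> on the beams with even index
  sum, which \<open>F\<close> maps to the closed upper half-space.\<close>

definition branch :: "int \<times> int \<Rightarrow> real^3 \<Rightarrow> real^3" where
  "branch r y = (let q = g (y /\<^sub>R norm y) in
     vector [2 * of_int (fst r) + psgn (fst r) * q$1, 2 * of_int (snd r) + psgn (snd r) * q$2, ln (norm y)])"

lemma normalize_in: "y$3 \<ge> 0 \<Longrightarrow> y \<noteq> 0 \<Longrightarrow> y /\<^sub>R norm y \<in> upper_hemisphere"
  by (simp add: hemisphere_norm)

lemma branch_in_beam: "y$3 \<ge> 0 \<Longrightarrow> y \<noteq> 0 \<Longrightarrow> in_beam r (branch r y)"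
  using g_in[OF normalize_in, of y] by (simp add: in_beam_def branch_def Let_def abs_mult unit_square_def)

lemma branch_3: "branch r y $ 3 = ln (norm y)"
  by (simp add: branch_def Let_def)

lemma F_branch:
  assumes "y$3 \<ge> 0" "y \<noteq> 0" "even (fst r + snd r)" shows "F (branch r y) = y"
proof -
  have "cell (branch r y) = g (y /\<^sub>R norm y)"
    unfolding cell_eq[OF branch_in_beam[OF assms(1,2)]] by (simp add: branch_def Let_def vec_eq_iff forall_2)
  then have "h (cell (branch r y)) = y /\<^sub>R norm y" using hg[OF normalize_in] assms by metis
  then have "dir r (branch r y) = y /\<^sub>R norm y"
    using assms(3) by (simp add: dir_def psgn_def vec_eq_iff forall_3)
  then show ?thesis using assms by (simp add: F_eq[OF branch_in_beam] branch_3)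
qed

lemma branch_F:
  assumes "in_beam r x" "even (fst r + snd r)" shows "branch r (F x) = x"
proof -
  have "F x /\<^sub>R norm (F x) = dir r x" unfolding norm_F by (simp add: F_eq[OF assms(1)])
  also have "dir r x = h (cell x)" using assms(2) by (simp add: dir_def psgn_def vec_eq_iff forall_3)
  finally have "g (F x /\<^sub>R norm (F x)) = cell x" by (simp add: cell_in)
  then show ?thesis
    by (simp add: branch_def Let_def norm_F cell_eq[OF assms(1)] vec_eq_iff forall_3)
qed

text \<open>The sides of the beams are mapped into the plane where the third coordinate vanishes,
  and beams with odd index sum into the closed lower half-space.\<close>

lemma F_pos_open_beam:
  assumes "in_beam r x" "F x $ 3 > 0"
  shows "even (fst r + snd r)" "\<bar>x$1 - 2 * of_int (fst r)\<bar> < 1" "\<bar>x$2 - 2 * of_int (snd r)\<bar> < 1"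
proof -
  have pos: "psgn (fst r + snd r) * h (cell x) $ 3 > 0"
    using assms(2) by (simp add: F_eq[OF assms(1)] dir_def zero_less_mult_iff)
  have "h (cell x) $ 3 \<ge> 0" using h_in[OF cell_in[of x]] by (simp add: upper_hemisphere_def)
  then show "even (fst r + snd r)" using pos by (auto simp: psgn_def split: if_splits)
  have "\<not> (\<bar>cell x $ 1\<bar> = 1 \<or> \<bar>cell x $ 2\<bar> = 1)"
    using bilipschitz_boundary[OF bilip cell_in] pos by force
  then show "\<bar>x$1 - 2 * of_int (fst r)\<bar> < 1" "\<bar>x$2 - 2 * of_int (snd r)\<bar> < 1"
    using assms(1) by (auto simp: cell_eq[OF assms(1)] in_beam_def abs_mult)
qed

lemma F_pos_beam_index:
  assumes "in_beam r x" "F x $ 3 > 0" shows "beam_index x = r"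
  using F_pos_open_beam[OF assms]
  by (auto simp: beam_index_def prod_eq_iff floor_eq_iff)

text \<open>Normalization contributes \<open>2 / \<rho>\<close> and \<open>g\<close> the factor
  \<open>L\<close>; the logarithm of the norm contributes \<open>1 / \<rho>\<close>. The decay in
  \<open>\<rho>\<close> drives the upper dimension estimate.\<close>

lemma branch_lipschitz:
  assumes "\<rho> > 0" "norm y \<ge> \<rho>" "norm z \<ge> \<rho>" "y$3 \<ge> 0" "z$3 \<ge> 0"
  shows "norm (branch r y - branch r z) \<le> (2 * L + 1) / \<rho> * norm (y - z)"
proof -
  have nz: "y \<noteq> 0" "z \<noteq> 0" using assms by auto
  let ?p = "g (y /\<^sub>R norm y)" and ?q = "g (z /\<^sub>R norm z)"
  have "norm (branch r y - branch r z) \<le> norm (hor (branch r y - branch r z)) + \<bar>(branch r y - branch r z)$3\<bar>"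
    by (rule norm_le_hor)
  also have "norm (hor (branch r y - branch r z)) = norm (?p - ?q)"
    by (simp add: norm_real2 branch_def Let_def right_diff_distrib[symmetric] power_mult_distrib)
  also have "norm (?p - ?q) \<le> L * norm (y /\<^sub>R norm y - z /\<^sub>R norm z)"
    using lipschitz_onD[OF lip_g normalize_in normalize_in, of y z] nz assms by (simp add: dist_norm)
  also have "\<dots> \<le> L * (2 / \<rho> * norm (y - z))"
    using normalize_diff[OF assms(2,1) nz(2)] L0 by (intro mult_left_mono)
  also have "\<bar>(branch r y - branch r z)$3\<bar> \<le> \<bar>norm y - norm z\<bar> / \<rho>"
    using assms by (simp add: branch_3 abs_ln_diff_le)
  also have "\<dots> \<le> norm (y - z) / \<rho>"
    using norm_triangle_ineq3[of y z] assms by (intro divide_right_mono) auto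
  finally show ?thesis by (simp add: algebra_simps add_divide_distrib)
qed

end

section \<open>Contraction by \<open>f\<close> at low heights and by its inverse branches at large
  heights\<close>

locale zorich_system = zorich_base +
  fixes \<alpha> m M a :: real
  assumes \<alpha>: "0 < \<alpha>" "\<alpha> < 1"
    and mM: "m < M"
    and contracting: "AE x in lebesgue. x$3 \<le> m \<longrightarrow>
          (\<exists>D. (zorich h has_derivative D) (at x) \<and> onorm D \<le> \<alpha>)"
    and expanding: "AE x in lebesgue. x$3 \<ge> M \<longrightarrow>
          (\<exists>D. (zorich h has_derivative D) (at x) \<and> lower_norm D \<ge> 1 / \<alpha>)"
    and a: "a \<ge> exp M - m"
begin

abbreviation "f \<equiv> zorich_shift h a"

definition \<beta> where "\<beta> = M + a"

text \<open>One of the two uses of the hypothesis on \<open>a\<close>. The shift by \<open>a\<close>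
  raises the plane at height \<open>M\<close> to height \<open>\<beta>\<close>; points above that
  have norm larger than \<open>exp M\<close>, so their preimages under \<open>F\<close> lie above
  height \<open>M\<close>.\<close>

lemma \<beta>_gt: "\<beta> > exp M" using a mM by (simp add: \<beta>_def)

lemma \<beta>_pos: "\<beta> > 0" using \<beta>_gt exp_gt_zero[of M] by linarith

lemma a_pos: "a \<ge> 1" using a mM exp_ge_add_one_self[of M] by linarith

text \<open>Undoes the shift in \<open>f\<close>, so that the inverse branches of \<open>f\<close>
  are those of \<open>F\<close> applied after \<open>up\<close>.\<close>

definition up :: "real^3 \<Rightarrow> real^3" where "up y = y + vector [0, 0, a]"

lemma up_nth [simp]: "up y $ 1 = y$1" "up y $ 2 = y$2" "up y $ 3 = y$3 + a"
  by (simp_all add: up_def)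

lemma hor_up [simp]: "hor (up y) = hor y" by (simp add: hor_def)

lemma up_diff [simp]: "up y - up z = y - z" by (simp add: up_def)

lemma up_f [simp]: "up (f x) = F x" by (simp add: up_def zorich_shift_def)

lemma norm_up_ge: "norm (up y) \<ge> y$3 + a"
  using component_le_norm_cart[of "up y" 3] by simp

lemma F_lipschitz_low:
  assumes "x$3 < m" "y$3 < m" shows "norm (F x - F y) \<le> \<alpha> * norm (x - y)"
proof -
  obtain N where N: "N \<in> null_sets lebesgue"
    "\<And>x. x \<notin> N \<Longrightarrow> x$3 \<le> m \<Longrightarrow> \<exists>D. (F has_derivative D) (at x) \<and> onorm D \<le> \<alpha>"
    using AE_E3[OF contracting] by auto
  show ?thesis
  proof (rule ae_lip_at_imp_lipschitz)
    show "open {x::real^3. x$3 < m}" by (intro open_Collect_less continuous_intros)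
    show "convex {x::real^3. x$3 < m}"
    proof (rule convexI)
      fix x y :: "real^3" and u v :: real
      assume "x \<in> {x. x$3 < m}" "y \<in> {x. x$3 < m}" "0 \<le> u" "0 \<le> v" "u + v = 1"
      then show "u *\<^sub>R x + v *\<^sub>R y \<in> {x. x$3 < m}"
        using convex_bound_lt[of "x$3" m "y$3" u v] by simp
    qed
    show "negligible N" using N(1) by (simp add: negligible_iff_null_sets)
    show "lip_at F {x. x$3 < m} (exp m * (1 + L)) x" if "x \<in> {x. x$3 < m}" for x
      using lip_at_F[of x m] that unfolding lip_at_def by auto
    show "lip_at F {x. x$3 < m} (\<alpha> + e) x" if "x \<in> {x. x$3 < m}" "x \<notin> N" "e > 0" for x e
      using N(2)[of x] that lip_at_of_has_derivative by force
  qed (use assms \<alpha> L0 in auto)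
qed

text \<open>\<open>F_lipschitz_low\<close> covers the open half-space. Lowering both points by the
  same small amount leaves their difference unchanged, and continuity of \<open>F\<close> gives the
  closed half-space.\<close>

lemma f_lipschitz_low:
  assumes "x$3 \<le> m" "y$3 \<le> m" shows "norm (f x - f y) \<le> \<alpha> * norm (x - y)"
proof -
  define z where "z n x = x - vector [0, 0, 1 / Suc n]" for n and x :: "real^3"
  have "(\<lambda>n. vector [0, 0, 1 / Suc n] :: real^3) \<longlonglongrightarrow> 0"
  proof (rule Lim_null_comparison[OF _ LIMSEQ_Suc[OF lim_1_over_n]])
    show "\<forall>\<^sub>F n in sequentially. norm (vector [0, 0, 1 / Suc n] :: real^3) \<le> 1 / of_nat (Suc n)"
      by (intro always_eventually allI) (simp add: norm_real3)
  qed
  then have lim: "(\<lambda>n. z n x) \<longlonglongrightarrow> x" for x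
    unfolding z_def by (auto intro!: tendsto_eq_intros)
  have "(\<lambda>n. norm (F (z n x) - F (z n y))) \<longlonglongrightarrow> norm (F x - F y)"
    using continuous_F[of UNIV] by (intro tendsto_intros continuous_on_tendsto_compose[OF _ lim]) auto
  moreover have "norm (F (z n x) - F (z n y)) \<le> \<alpha> * norm (x - y)" for n
  proof -
    have "norm (F (z n x) - F (z n y)) \<le> \<alpha> * norm (z n x - z n y)"
      using assms by (intro F_lipschitz_low) (auto simp: z_def intro!: order_less_le_trans[OF diff_strict_left_mono[of 0]])
    then show ?thesis by (simp add: z_def)
  qed
  ultimately have "norm (F x - F y) \<le> \<alpha> * norm (x - y)"
    by (intro tendsto_upperbound[where F = sequentially]) auto
  then show ?thesis by (simp add: zorich_shift_def)
qed

definition \<Lambda> :: "int \<times> int \<Rightarrow> real^3 \<Rightarrow> real^3" where "\<Lambda> r y = branch r (up y)"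

text \<open>At the image of a point outside \<open>N\<close>, the bound on \<open>lower_norm\<close>
  yields the pointwise Lipschitz constant \<open>\<alpha> + e\<close> for the inverse. The image of
  \<open>N\<close> under \<open>F\<close> is null because \<open>F\<close> is locally Lipschitz, so
  the pointwise bounds combine on the convex set above \<open>\<beta>\<close>.\<close>

lemma branch_lipschitz_high:
  assumes r: "even (fst r + snd r)" and "y$3 > \<beta>" "z$3 > \<beta>"
  shows "norm (branch r y - branch r z) \<le> \<alpha> * norm (y - z)"
proof -
  obtain N where N: "N \<in> null_sets lebesgue"
    "\<And>x. x \<notin> N \<Longrightarrow> x$3 \<ge> M \<Longrightarrow> \<exists>D. (F has_derivative D) (at x) \<and> lower_norm D \<ge> 1 / \<alpha>"
    using AE_E3[OF expanding] by auto
  have N0: "negligible N" using N(1) by (simp add: negligible_iff_null_sets)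
  define S where "S = {x::real^3. \<beta> < x$3}"
  have big: "norm y \<ge> \<beta>" "y$3 \<ge> 0" "y \<noteq> 0" if "y \<in> S" for y
    using that \<beta>_pos component_le_norm_cart[of y 3] by (auto simp: S_def)
  define C where "C = (2 * L + 1) / \<beta>"
  have C: "C > 0" using L0 \<beta>_pos by (simp add: C_def)
  have lipS: "norm (branch r y - branch r z) \<le> C * norm (y - z)" if "y \<in> S" "z \<in> S" for y z
    unfolding C_def using big[OF that(1)] big[OF that(2)] \<beta>_pos by (intro branch_lipschitz)
  show ?thesis
  proof (rule ae_lip_at_imp_lipschitz)
    show "open S" unfolding S_def by (intro open_Collect_less continuous_intros)
    show "convex S"
    proof (rule convexI)
      fix x y :: "real^3" and u v :: real
      assume "x \<in> S" "y \<in> S" "0 \<le> u" "0 \<le> v" "u + v = 1"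
      then show "u *\<^sub>R x + v *\<^sub>R y \<in> S"
        using convex_bound_lt[of "-x$3" "-\<beta>" "-y$3" u v] by (simp add: S_def)
    qed
    show "negligible (F ` N)"
    proof (rule negligible_locally_Lipschitz_image[OF _ N0])
      fix x
      obtain d where "d > 0" "\<forall>y. norm (y - x) < d \<longrightarrow> norm (F y - F x) \<le> exp (x$3 + 1) * (1 + L) * norm (y - x)"
        using lip_at_F[of x "x$3 + 1"] unfolding lip_at_def by auto
      then show "\<exists>T B. open T \<and> x \<in> T \<and> (\<forall>y\<in>N \<inter> T. norm (F y - F x) \<le> B * norm (y - x))"
        by (intro exI[of _ "ball x d"] exI) (auto simp: dist_norm norm_minus_commute)
    qed simp
    show "lip_at (branch r) S C x" if "x \<in> S" for x
      unfolding lip_at_def using that lipS by (intro exI[of _ 1]) auto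
    fix y e assume y: "y \<in> S" "y \<notin> F ` N" and e: "(e::real) > 0"
    define x where "x = branch r y"
    have Fx: "F x = y" unfolding x_def using big[OF y(1)] r by (intro F_branch)
    have "x$3 \<ge> M"
      using big[OF y(1)] \<beta>_gt \<beta>_pos by (simp add: x_def branch_3 ln_ge_iff)
    then obtain D where D: "(F has_derivative D) (at x)" "lower_norm D \<ge> 1 / \<alpha>"
      using N(2) y(2) Fx by blast
    \<comment> \<open>Chosen so that \<open>1 / \<alpha> - \<eta>\<close> is the reciprocal of
      \<open>\<alpha> + e\<close>.\<close>
    define \<eta> where "\<eta> = e / (\<alpha> * (\<alpha> + e))"
    have \<eta>: "\<eta> > 0" using e \<alpha> by (simp add: \<eta>_def)
    have \<eta>2: "(\<alpha> + e) * (1 / \<alpha> - \<eta>) = 1"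
    proof -
      have "\<alpha> + e \<noteq> 0" "\<alpha> \<noteq> 0" using e \<alpha> by auto
      then have "(\<alpha> + e) * \<eta> = e / \<alpha>" by (simp add: \<eta>_def)
      then show ?thesis using \<open>\<alpha> \<noteq> 0\<close> by (simp add: right_diff_distrib add_divide_distrib)
    qed
    obtain d where d: "d > 0" "\<And>z. norm (z - x) < d \<Longrightarrow> norm (F z - F x - D (z - x)) \<le> \<eta> * norm (z - x)"
      using D(1) \<eta> unfolding has_derivative_at_alt by blast
    show "lip_at (branch r) S (\<alpha> + e) y"
      unfolding lip_at_def
    \<comment> \<open>The crude constant \<open>C\<close> keeps the preimage of \<open>z\<close>
      within distance \<open>d\<close> of \<open>x\<close>, where the linear approximation
      applies.\<close>
    proof (intro exI[of _ "d / C"] conjI ballI impI)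
      fix z assume z: "z \<in> S" "norm (z - y) < d / C"
      define w where "w = branch r z"
      have Fw: "F w = z" unfolding w_def using big[OF z(1)] r by (intro F_branch)
      have "norm (w - x) \<le> C * norm (z - y)" using lipS[OF z(1) y(1)] by (simp add: w_def x_def)
      also have "\<dots> < d" using z(2) C by (simp add: field_simps)
      finally have "norm (z - y - D (w - x)) \<le> \<eta> * norm (w - x)" using d(2) Fw Fx by blast
      moreover have "1 / \<alpha> * norm (w - x) \<le> norm (D (w - x))"
        using D by (intro lower_norm_le) (auto dest: has_derivative_linear)
      moreover have "norm (D (w - x)) \<le> norm (z - y) + norm (z - y - D (w - x))"
        using norm_triangle_ineq4[of "z - y" "z - y - D (w - x)"] by simp
      ultimately have "(1 / \<alpha> - \<eta>) * norm (w - x) \<le> norm (z - y)" by (simp add: algebra_simps)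
      then have "(\<alpha> + e) * ((1 / \<alpha> - \<eta>) * norm (w - x)) \<le> (\<alpha> + e) * norm (z - y)"
        using \<alpha> e by (intro mult_left_mono) auto
      then show "norm (branch r z - branch r y) \<le> (\<alpha> + e) * norm (z - y)"
        unfolding mult.assoc[symmetric] \<eta>2 by (simp add: w_def x_def)
    qed (use d C in auto)
  qed (use assms \<alpha> C in \<open>auto simp: S_def\<close>)
qed

lemma \<Lambda>_lipschitz:
  assumes "even (fst r + snd r)" "y$3 > M" "z$3 > M"
  shows "norm (\<Lambda> r y - \<Lambda> r z) \<le> \<alpha> * norm (y - z)"
  using branch_lipschitz_high[OF assms(1), of "up y" "up z"] assms(2,3) by (simp add: \<Lambda>_def \<beta>_def)

lemma up_pos: "y$3 > M \<Longrightarrow> up y $ 3 > 0" "y$3 > M \<Longrightarrow> up y \<noteq> 0" "y$3 > M \<Longrightarrow> norm (up y) > \<beta>"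
proof -
  assume "y$3 > M"
  then have *: "up y $ 3 > \<beta>" by (simp add: \<beta>_def)
  then show "up y $ 3 > 0" using \<beta>_pos by linarith
  then show "up y \<noteq> 0" by (metis less_irrefl zero_index)
  show "norm (up y) > \<beta>" using component_le_norm_cart[of "up y" 3] * by linarith
qed

lemma f_\<Lambda>:
  assumes "even (fst r + snd r)" "y$3 > M" shows "f (\<Lambda> r y) = y"
  using F_branch[of "up y" r] up_pos[OF assms(2)] assms(1)
  by (simp add: \<Lambda>_def zorich_shift_def up_def less_imp_le)

lemma \<Lambda>_3: "\<Lambda> r y $ 3 = ln (norm (up y))"
  by (simp add: \<Lambda>_def branch_3)

lemma \<Lambda>_3_gt: "y$3 > M \<Longrightarrow> \<Lambda> r y $ 3 > M"
  using up_pos[of y] \<beta>_gt \<beta>_pos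
  by (simp add: \<Lambda>_3) (metis exp_gt_zero exp_less_cancel_iff exp_ln order_less_trans)

lemma \<Lambda>_beam: "y$3 > M \<Longrightarrow> in_beam r (\<Lambda> r y)"
  unfolding \<Lambda>_def using up_pos[of y] by (intro branch_in_beam) auto

lemma \<Lambda>_f:
  assumes "in_beam r x" "f x $ 3 > M"
  shows "\<Lambda> r (f x) = x" "even (fst r + snd r)" "beam_index x = r"
proof -
  have "F x $ 3 > 0" using up_pos(1)[OF assms(2)] by simp
  then show "even (fst r + snd r)" "beam_index x = r"
    using F_pos_open_beam(1) F_pos_beam_index assms(1) by blast+
  then show "\<Lambda> r (f x) = x" unfolding \<Lambda>_def up_f using branch_F assms(1) by blast
qed

lemma f_3: "x$3 = ln (norm (up (f x)))"
  by (simp add: norm_F)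

text \<open>The other use of the hypothesis on \<open>a\<close>:
  \<open>exp M - a \<le> m\<close>.\<close>

lemma f_low: "x$3 \<le> M \<Longrightarrow> f x $ 3 \<le> m"
proof -
  assume "x$3 \<le> M"
  then have "norm (F x) \<le> exp M" by (simp add: norm_F)
  then show ?thesis using component_le_norm_cart[of "F x" 3] a by (auto simp: zorich_shift_def)
qed

lemma continuous_f: "continuous_on S f"
  unfolding zorich_shift_def by (intro continuous_intros continuous_F)

lemma continuous_fn: "continuous_on S (f ^^ k)"
  by (induction k) (auto simp: comp_def intro: continuous_on_compose2[OF continuous_f[of UNIV]])

lemma fixed_point: "\<exists>!\<xi>. f \<xi> = \<xi> \<and> \<xi>$3 \<le> m"
proof -
  have "\<exists>!x\<in>{x::real^3. x$3 \<le> m}. f x = x"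
  proof (rule Banach_fix)
    show "complete {x::real^3. x$3 \<le> m}"
      by (unfold complete_eq_closed, intro closed_Collect_le continuous_intros)
    show "{x::real^3. x$3 \<le> m} \<noteq> {}"
    proof -
      have "vector [0, 0, m] \<in> {x::real^3. x$3 \<le> m}" by simp
      then show ?thesis by blast
    qed
  qed (use \<alpha> f_low mM f_lipschitz_low in \<open>auto simp: dist_norm\<close>)
  then show ?thesis by (auto simp: conj_commute)
qed

definition J :: "(real^3) set" where "J = {x. \<forall>k. (f ^^ k) x $ 3 > M}"

lemma J_eq:
  assumes "f \<xi> = \<xi>" "\<xi>$3 \<le> m" shows "non_convergence_set f \<xi> = J"
proof -
  have "(\<lambda>k. (f ^^ k) x) \<longlonglongrightarrow> \<xi>" if "(f ^^ k) x $ 3 \<le> M" for x k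
  proof -
    define y where "y = f ((f ^^ k) x)"
    have y: "y$3 \<le> m" using f_low[OF that] by (simp add: y_def)
    have "(f ^^ n) y $ 3 \<le> m \<and> norm ((f ^^ n) y - \<xi>) \<le> \<alpha> ^ n * norm (y - \<xi>)" for n
    proof (induction n)
      case (Suc n)
      have "norm (f ((f ^^ n) y) - f \<xi>) \<le> \<alpha> * norm ((f ^^ n) y - \<xi>)"
        using Suc assms by (intro f_lipschitz_low) auto
      also have "\<dots> \<le> \<alpha> * (\<alpha> ^ n * norm (y - \<xi>))" using Suc \<alpha> by (intro mult_left_mono) auto
      finally show ?case using f_low[of "(f ^^ n) y"] Suc mM assms by (simp add: mult.assoc)
    qed (use y in simp)
    then have "\<forall>\<^sub>F n in sequentially. norm ((f ^^ n) y - \<xi>) \<le> \<alpha> ^ n * norm (y - \<xi>)"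
      by simp
    moreover have "(\<lambda>n. \<alpha> ^ n * norm (y - \<xi>)) \<longlonglongrightarrow> 0"
      using \<alpha> by (intro tendsto_mult_left_zero LIMSEQ_power_zero) simp
    ultimately have "(\<lambda>n. (f ^^ n) y - \<xi>) \<longlonglongrightarrow> 0" by (rule Lim_null_comparison)
    then have "(\<lambda>n. (f ^^ n) y) \<longlonglongrightarrow> \<xi>" by (rule LIM_zero_cancel)
    moreover have "(f ^^ n) y = (f ^^ (n + Suc k)) x" for n by (simp add: y_def funpow_add del: add_Suc_right)
    ultimately have "(\<lambda>n. (f ^^ (n + Suc k)) x) \<longlonglongrightarrow> \<xi>" by simp
    then show ?thesis by (rule LIMSEQ_offset)
  qed
  then have "x \<in> J" if "x \<in> non_convergence_set f \<xi>" for x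
    using that unfolding non_convergence_set_def J_def mem_Collect_eq by (meson not_le)
  moreover have "\<not> (\<lambda>k. (f ^^ k) x) \<longlonglongrightarrow> \<xi>" if "x \<in> J" for x
  proof
    assume "(\<lambda>k. (f ^^ k) x) \<longlonglongrightarrow> \<xi>"
    then have "(\<lambda>k. (f ^^ k) x $ 3) \<longlonglongrightarrow> \<xi>$3" by (rule tendsto_vec_nth)
    then have "M \<le> \<xi>$3" using that by (intro tendsto_lowerbound[of _ _ sequentially M]) (auto simp: J_def less_imp_le)
    then show False using assms mM by simp
  qed
  ultimately show ?thesis unfolding non_convergence_set_def by blast
qed

end

section \<open>Hairs\<close>

text \<open>The sublevel sets of \<open>v\<close> are compact, so \<open>v\<close> has a continuous
  inverse on each of them, and these inverses fit together. The inverse tends to infinity because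
  \<open>v\<close> is bounded on bounded parts of the closed set \<open>S\<close>.\<close>

lemma hair_endpoint_of_parameter:
  fixes S :: "'a::euclidean_space set" and v :: "'a \<Rightarrow> real"
  assumes S: "closed S" and v: "continuous_on S v" "inj_on v S" "v ` S = {t0..}"
    and bdd: "\<And>T. bounded {x\<in>S. v x \<le> T}" and e: "e \<in> S" "v e = t0"
  shows "hair_endpoint S e"
proof -
  define i where "i = inv_into S v"
  have vi: "v (i t) = t" "i t \<in> S" if "t \<ge> t0" for t
    using that v(3) unfolding i_def by (metis atLeast_iff f_inv_into_f, metis atLeast_iff inv_into_into)
  have iv: "i (v x) = x" if "x \<in> S" for x
    using that v(2) unfolding i_def by simp
  have vS: "v x \<ge> t0" if "x \<in> S" for x using that v(3) by auto
  have comp: "compact {x\<in>S. v x \<le> T}" for T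
    unfolding compact_eq_bounded_closed
    using bdd continuous_closed_preimage[OF v(1) S closed_atMost[of T]] by (auto simp: vimage_def Int_def)
  have cont: "continuous_on {t0..T} i" for T
  proof -
    have "v ` {x\<in>S. v x \<le> T} = {t0..T}" using v(3) vi vS by (auto simp: image_iff) (metis order_trans)
    moreover have "continuous_on (v ` {x\<in>S. v x \<le> T}) i"
      by (rule continuous_on_inv[OF _ comp]) (use v(1) iv in \<open>auto intro: continuous_on_subset\<close>)
    ultimately show ?thesis by simp
  qed
  have conti: "continuous_on {t0..} i"
  proof (unfold continuous_on_eq_continuous_within, intro ballI)
    fix t assume t: "t \<in> {t0..}"
    have "continuous (at t within {t0..t+1}) i"
      using cont[of "t+1"] t by (auto simp: continuous_on_eq_continuous_within)
    moreover have "at t within {t0..t+1} = at t within {t0..}"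
      by (rule at_within_nhd[where S = "{t-1<..<t+1}"]) auto
    ultimately show "continuous (at t within {t0..}) i" by simp
  qed
  define \<gamma> where "\<gamma> t = i (t0 + t)" for t
  have "homeomorphism {0..} S \<gamma> (\<lambda>x. v x - t0)"
  proof (rule homeomorphismI)
    show "continuous_on {0..} \<gamma>" unfolding \<gamma>_def
      by (rule continuous_on_compose2[OF conti]) (auto intro!: continuous_intros)
  qed (use v vS vi iv in \<open>auto simp: \<gamma>_def intro!: continuous_intros\<close>)
  moreover have "filterlim \<gamma> at_infinity at_top"
    unfolding filterlim_at_infinity[OF order_refl]
  proof (intro allI impI)
    fix R :: real
    have "compact (S \<inter> cball 0 R)" using S by (simp add: closed_Int_compact)
    then have "bounded (v ` (S \<inter> cball 0 R))"
      using v(1) by (intro compact_imp_bounded compact_continuous_image) (auto intro: continuous_on_subset)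
    then obtain B where "\<forall>x\<in>S \<inter> cball 0 R. norm (v x) \<le> B" unfolding bounded_iff by auto
    then have B: "norm (v x) \<le> B" if "x \<in> S" "norm x \<le> R" for x using that by simp
    show "\<forall>\<^sub>F t in at_top. R \<le> norm (\<gamma> t)"
      using eventually_ge_at_top[of "max 0 (B + 1 - t0)"]
    proof eventually_elim
      case (elim t)
      show ?case
      proof (rule ccontr)
        assume "\<not> R \<le> norm (\<gamma> t)"
        then have "norm (v (\<gamma> t)) \<le> B" using vi(2)[of "t0 + t"] elim by (intro B) (auto simp: \<gamma>_def)
        then show False using vi(1)[of "t0 + t"] elim by (auto simp: \<gamma>_def)
      qed
    qed
  qed
  moreover have "\<gamma> 0 = e" using iv[OF e(1)] e(2) by (simp add: \<gamma>_def)
  ultimately show ?thesis unfolding hair_endpoint_def by blast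
qed

text \<open>The cross-section is a square of side 2, whose diameter \<open>2 * sqrt 2\<close> is
  rounded up to 3.\<close>

lemma in_beam_hor:
  assumes "in_beam r x" "in_beam r y" shows "norm (hor x - hor y) \<le> 3"
proof -
  have "\<bar>x$1 - y$1\<bar> \<le> 2" "\<bar>x$2 - y$2\<bar> \<le> 2" using assms by (auto simp: in_beam_def abs_le_iff)
  then have "(x$1 - y$1)\<^sup>2 \<le> 2\<^sup>2" "(x$2 - y$2)\<^sup>2 \<le> 2\<^sup>2" by (metis abs_le_square_iff abs_numeral)+
  then show ?thesis by (auto simp: norm_real2 intro!: real_le_lsqrt)
qed

lemma ln_ge_one_minus_inverse: "x > 0 \<Longrightarrow> ln x \<ge> 1 - 1 / x" for x :: real
  using ln_le_minus_one[of "1 / x"] by (simp add: ln_div)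

text \<open>Fixes the gap 4 used for comparing orbits: \<open>16 * exp (- d)\<close> is the total
  error in \<open>growth_chain\<close> for a gap \<open>d\<close>.\<close>

lemma exp_minus_4: "16 * exp (-4::real) \<le> 1/2"
proof -
  have "exp (1::real) \<ge> 1 + 1 + 1\<^sup>2/2" by (rule exp_lower_Taylor_quadratic) simp
  then have "exp (1::real) ^ 4 \<ge> (5/2) ^ 4" by (intro power_mono) auto
  moreover have "exp (4::real) = exp 1 ^ 4" using exp_of_nat_mult[of 4 "1::real"] by simp
  ultimately have "exp (4::real) \<ge> (5/2) ^ 4" by simp
  also have "(5/2) ^ 4 \<ge> (32::real)" by (simp add: power4_eq_xxxx)
  finally show ?thesis by (simp add: exp_minus field_simps)
qed

section \<open>The one-dimensional model for the growth of heights\<close>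

context zorich_system
begin

text \<open>The height that every inverse branch assigns to the point (0, 0, w) if
  \<open>w + a\<close> is positive.\<close>

definition A :: "real \<Rightarrow> real" where "A w = ln (w + a)"
definition B :: "real \<Rightarrow> real" where "B t = exp t - a"

lemma A_B [simp]: "A (B t) = t" by (simp add: A_def B_def)

lemma A_gt: "w \<ge> M \<Longrightarrow> A w > M"
proof -
  assume "w \<ge> M"
  then have "exp M < w + a" using \<beta>_gt by (simp add: \<beta>_def)
  then have "ln (exp M) < ln (w + a)" by (subst ln_less_cancel_iff) (auto intro: less_trans[OF exp_gt_zero])
  then show ?thesis by (simp add: A_def)
qed

lemma A_le_iff: "u > M \<Longrightarrow> w > M \<Longrightarrow> A u \<le> A w \<longleftrightarrow> u \<le> w"
  using \<beta>_pos by (simp add: A_def \<beta>_def)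

text \<open>A branch restricted to the vertical axis has \<open>A\<close> as its third coordinate
  and inherits the contraction factor.\<close>

lemma A_lipschitz:
  assumes "u > M" "w > M" shows "\<bar>A u - A w\<bar> \<le> \<alpha> * \<bar>u - w\<bar>"
proof -
  let ?p = "\<lambda>u. vector [0, 0, u + a] :: real^3"
  have n: "norm (?p u) = u + a" if "u > M" for u
    using that \<beta>_pos by (simp add: norm_real3 \<beta>_def)
  have "norm (branch (0,0) (?p u) - branch (0,0) (?p w)) \<le> \<alpha> * norm (?p u - ?p w)"
    using assms by (intro branch_lipschitz_high) (auto simp: \<beta>_def)
  moreover have "norm (?p u - ?p w) = \<bar>u - w\<bar>" by (simp add: norm_real3)
  moreover have "\<bar>A u - A w\<bar> \<le> norm (branch (0,0) (?p u) - branch (0,0) (?p w))"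
    using component_le_norm_cart[of "branch (0,0) (?p u) - branch (0,0) (?p w)" 3] n assms
    by (simp add: branch_3 A_def)
  ultimately show ?thesis by simp
qed

text \<open>As \<open>M\<close> may be negative, \<open>\<beta> > exp M\<close> is too weak. The
  slope of \<open>A\<close> just above \<open>M\<close> is about \<open>1 / \<beta>\<close>, and
  \<open>A\<close> contracts; the points \<open>M + e / 2\<close> and \<open>M + e\<close> make this
  precise.\<close>

lemma \<beta>_ge_1: "\<beta> \<ge> 1"
proof (rule field_le_epsilon)
  fix e :: real assume e: "e > 0"
  let ?s = "e / 2"
  have "\<bar>A (M + e) - A (M + ?s)\<bar> \<le> \<alpha> * \<bar>?s\<bar>"
    using A_lipschitz[of "M + e" "M + ?s"] e by simp
  also have "\<dots> \<le> ?s" using \<alpha> e by simp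
  finally have "ln ((\<beta> + e) / (\<beta> + ?s)) \<le> ?s"
    using \<beta>_pos e by (simp add: A_def \<beta>_def ln_div algebra_simps)
  moreover have "1 - 1 / ((\<beta> + e) / (\<beta> + ?s)) \<le> ln ((\<beta> + e) / (\<beta> + ?s))"
    using \<beta>_pos e by (intro ln_ge_one_minus_inverse) simp
  moreover have "1 - 1 / ((\<beta> + e) / (\<beta> + ?s)) = ?s / (\<beta> + e)"
    using \<beta>_pos e by (simp add: field_simps)
  ultimately have "?s / (\<beta> + e) \<le> ?s" by linarith
  then have "?s \<le> ?s * (\<beta> + e)" using e \<beta>_pos by (simp add: pos_divide_le_eq)
  then show "1 \<le> \<beta> + e" using e by simp
qed

lemma An_gt: "w > M \<Longrightarrow> (A ^^ k) w > M"
  by (induction k) (auto intro: A_gt)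

lemma An_le_iff: "u > M \<Longrightarrow> w > M \<Longrightarrow> (A ^^ k) u \<le> (A ^^ k) w \<longleftrightarrow> u \<le> w"
  by (induction k) (auto simp: A_le_iff An_gt)

lemma An_less_iff: "u > M \<Longrightarrow> w > M \<Longrightarrow> (A ^^ k) u < (A ^^ k) w \<longleftrightarrow> u < w"
  by (simp add: not_le[symmetric] An_le_iff)

lemma An_lipschitz: "u > M \<Longrightarrow> w > M \<Longrightarrow> \<bar>(A ^^ k) u - (A ^^ k) w\<bar> \<le> \<alpha> ^ k * \<bar>u - w\<bar>"
proof (induction k)
  case (Suc k)
  have "\<bar>A ((A ^^ k) u) - A ((A ^^ k) w)\<bar> \<le> \<alpha> * \<bar>(A ^^ k) u - (A ^^ k) w\<bar>"
    using Suc.prems by (intro A_lipschitz An_gt)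
  also have "\<dots> \<le> \<alpha> * (\<alpha> ^ k * \<bar>u - w\<bar>)" using Suc \<alpha> by (intro mult_left_mono) auto
  finally show ?case by (simp add: mult.assoc)
qed simp

lemma A_f_le: "f x $ 3 > M \<Longrightarrow> A (f x $ 3) \<le> x $ 3"
proof -
  assume "f x $ 3 > M"
  then have "A (f x $ 3) \<le> ln (norm (up (f x)))"
    unfolding A_def using norm_up_ge[of "f x"] \<beta>_pos by (intro ln_mono) (auto simp: \<beta>_def simp del: up_f)
  then show ?thesis by (simp only: f_3[of x, symmetric])
qed

lemma exp_3: "exp (x $ 3) = norm (up (f x))"
  by (simp add: norm_F)

text \<open>A vertical gap of at least 4 between two orbits in the same beams makes the upper orbit follow
  the one-dimensional map \<open>B\<close> almost exactly, since the horizontal components are dominated by the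
  lower orbit.\<close>

lemma growth_step:
  assumes gt: "f P $ 3 > M" "f Q $ 3 > M" and hor: "norm (hor (f P) - hor (f Q)) \<le> 3"
    and d: "P $ 3 + d \<le> Q $ 3" "d \<ge> 0"
  shows "f Q $ 3 + a \<ge> exp (Q $ 3) * (1 - 4 * exp (- d))"
proof -
  let ?nP = "norm (up (f P))" and ?nQ = "norm (up (f Q))"
  have nP: "?nP \<ge> 1" using up_pos(3)[OF gt(1)] \<beta>_ge_1 by linarith
  have "?nP = exp (P $ 3)" "?nQ = exp (Q $ 3)" by (simp_all only: exp_3)
  moreover have "exp (P $ 3) \<le> exp (Q $ 3 - d)" using d by simp
  ultimately have le: "?nP \<le> ?nQ * exp (- d)" by (simp only: exp_diff exp_minus divide_inverse)
  have "?nQ \<le> norm (hor (f Q)) + (f Q $ 3 + a)"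
    using norm_le_hor[of "up (f Q)"] gt(2) \<beta>_pos by (simp del: up_f add: \<beta>_def)
  also have "norm (hor (f Q)) \<le> norm (hor (f P)) + 3"
    using hor norm_triangle_ineq2[of "hor (f Q)" "hor (f P)"] by (simp add: norm_minus_commute)
  also have "norm (hor (f P)) \<le> ?nP" using norm_hor_le[of "up (f P)"] by (simp del: up_f)
  \<comment> \<open>The horizontal part of \<open>f Q\<close> is at most \<open>?nP + 3\<close>,
    hence at most \<open>4 * ?nP\<close>.\<close>
  finally have "f Q $ 3 + a \<ge> ?nQ - 4 * ?nP" using nP by linarith
  then have "f Q $ 3 + a \<ge> ?nQ - 4 * (?nQ * exp (- d))" using le by linarith
  then show ?thesis unfolding exp_3 by (simp add: algebra_simps del: up_f)
qed

lemma exp_minus_d: "d \<ge> 4 \<Longrightarrow> 16 * exp (- d) \<le> (1/2 :: real)"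
  using exp_minus_4 by (smt (verit) exp_le_cancel_iff)

text \<open>The form suited to iteration: since the gap grows by 1 per step, the losses
  \<open>8 * exp (- d)\<close> of successive steps decrease geometrically.\<close>

lemma growth_step_4:
  assumes gt: "f P $ 3 > M" "f Q $ 3 > M" and hor: "norm (hor (f P) - hor (f Q)) \<le> 3"
    and d: "P $ 3 + d \<le> Q $ 3" "d \<ge> 4"
  shows "f P $ 3 + (d + 1) \<le> f Q $ 3" "A (f Q $ 3) \<ge> Q $ 3 - 8 * exp (- d)"
proof -
  let ?q = "exp (Q $ 3)"
  have small: "16 * exp (- d) \<le> 1/2" using exp_minus_d[OF d(2)] .
  have 1: "f Q $ 3 + a \<ge> ?q * (1 - 4 * exp (- d))"
    using growth_step[OF gt hor d(1)] d(2) by simp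
  have "f P $ 3 + a \<le> exp (P $ 3)" unfolding exp_3 by (rule norm_up_ge)
  also have "\<dots> \<le> exp (Q $ 3 - d)" using d by simp
  finally have P: "f P $ 3 + a \<le> ?q * exp (- d)" by (simp only: exp_diff exp_minus divide_inverse)
  have q: "?q \<ge> exp d"
  proof -
    have "exp (P $ 3) \<ge> 1" unfolding exp_3 using up_pos(3)[OF gt(1)] \<beta>_ge_1 by linarith
    then have "P $ 3 \<ge> 0" by simp
    then show ?thesis using d by simp
  qed
  \<comment> \<open>The 5 is the 4 of the growth estimate plus 1 for the height of
    \<open>f P\<close>. The quadratic Taylor bound \<open>exp d \<ge> 1 + d + 8\<close> leaves room
    for it.\<close>
  have "exp d - 5 = exp d * (1 - 5 * exp (- d))" by (simp add: right_diff_distrib exp_minus)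
  also have "\<dots> \<le> ?q * (1 - 5 * exp (- d))" using q small by (intro mult_right_mono) auto
  also have "\<dots> \<le> f Q $ 3 - f P $ 3" using 1 P by (simp add: algebra_simps)
  finally have "exp d - 5 \<le> f Q $ 3 - f P $ 3" .
  moreover have "1 + d + d\<^sup>2 / 2 \<le> exp d" using d by (intro exp_lower_Taylor_quadratic) auto
  moreover have "d\<^sup>2 \<ge> 4\<^sup>2" using d by (intro power_mono) auto
  ultimately show "f P $ 3 + (d + 1) \<le> f Q $ 3" by simp
  let ?u = "1 - 4 * exp (- d)"
  have u: "?u \<ge> 1/2" using small by linarith
  have "1 - 1 / ?u \<ge> - (8 * exp (- d))"
  proof -
    have "1 / ?u \<le> 1 + 2 * (1 - ?u)" using u mult_nonneg_nonneg[of "1 - ?u" "2 * ?u - 1"]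
      by (simp add: field_simps)
    then show ?thesis by simp
  qed
  then have "Q $ 3 - 8 * exp (- d) \<le> Q $ 3 + ln ?u"
    using ln_ge_one_minus_inverse[of ?u] u by linarith
  also have "\<dots> = ln (?q * ?u)" using u by (subst ln_mult) auto
  also have "\<dots> \<le> A (f Q $ 3)" unfolding A_def using 1 u by (subst ln_le_cancel_iff) (auto intro: order_less_le_trans[OF _ 1])
  finally show "A (f Q $ 3) \<ge> Q $ 3 - 8 * exp (- d)" .
qed

text \<open>A loss at a later time is not amplified on the way back, because \<open>A\<close>
  contracts. The losses add up to \<open>16 * exp (- d)\<close>: the first one is
  \<open>8 * exp (- d)\<close>, and \<open>16 * exp (- (d + 1))\<close> for the rest is no larger,
  as \<open>exp 1 \<ge> 2\<close>.\<close>

lemma growth_chain: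
  assumes "\<And>k. k \<le> n \<Longrightarrow> (f ^^ k) P $ 3 > M" "\<And>k. k \<le> n \<Longrightarrow> (f ^^ k) Q $ 3 > M"
    "\<And>k. k \<le> n \<Longrightarrow> norm (hor ((f ^^ k) P) - hor ((f ^^ k) Q)) \<le> 3"
    and "P $ 3 + d \<le> Q $ 3" "d \<ge> 4"
  shows "(f ^^ n) P $ 3 + (d + n) \<le> (f ^^ n) Q $ 3 \<and> (A ^^ n) ((f ^^ n) Q $ 3) \<ge> Q $ 3 - 16 * exp (- d)"
  using assms
proof (induction n arbitrary: P Q d)
  case (Suc n)
  have s: "(f ^^ k) (f x) = (f ^^ Suc k) x" for k x by (simp add: funpow_swap1)
  have fP: "f P $ 3 > M" and fQ: "f Q $ 3 > M" and h: "norm (hor (f P) - hor (f Q)) \<le> 3"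
    using Suc.prems(1)[of 1] Suc.prems(2)[of 1] Suc.prems(3)[of 1] by auto
  note st = growth_step_4[OF fP fQ h Suc.prems(4,5)]
  have IH: "(f ^^ n) (f P) $ 3 + ((d + 1) + n) \<le> (f ^^ n) (f Q) $ 3 \<and>
      (A ^^ n) ((f ^^ n) (f Q) $ 3) \<ge> f Q $ 3 - 16 * exp (- (d + 1))"
  proof (rule Suc.IH)
    show "(f ^^ k) (f P) $ 3 > M" "(f ^^ k) (f Q) $ 3 > M"
      "norm (hor ((f ^^ k) (f P)) - hor ((f ^^ k) (f Q))) \<le> 3" if "k \<le> n" for k
      unfolding s using Suc.prems(1-3) that by blast+
  qed (use st(1) Suc.prems(5) in auto)
  have small: "16 * exp (- (d + 1)) \<le> 8 * exp (- d)"
  proof -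
    have "(2::real) \<le> exp 1" using exp_ge_add_one_self[of 1] by simp
    then have "16 * exp (- d) \<le> 8 * (exp (- d) * exp 1)" by simp
    moreover have "exp (- d) = exp (- (d + 1)) * exp 1" by (simp add: exp_add[symmetric])
    ultimately have "16 * (exp (- (d + 1)) * exp 1) \<le> 8 * exp (- d) * exp 1" by simp
    then show ?thesis by simp
  qed
  have s12: "16 * exp (- (d + 1)) \<le> 1/2" using exp_minus_d[of "d+1"] Suc.prems by simp
  \<comment> \<open>The gap to \<open>f P\<close> keeps the reduced height in the range where
    \<open>A\<close> is known to be monotone and contracting.\<close>
  have low: "f Q $ 3 - 16 * exp (- (d + 1)) > M" using s12 st(1) Suc.prems(5) fP by linarith
  have "Q $ 3 - 16 * exp (- d) \<le> A (f Q $ 3) - 16 * exp (- (d + 1))" using st(2) small by linarith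
  also have "\<dots> \<le> A (f Q $ 3 - 16 * exp (- (d + 1)))"
  proof -
    have "\<bar>A (f Q $ 3) - A (f Q $ 3 - 16 * exp (- (d + 1)))\<bar> \<le> \<alpha> * \<bar>16 * exp (- (d + 1))\<bar>"
      using A_lipschitz[OF fQ low] by simp
    also have "\<dots> \<le> 16 * exp (- (d + 1))" using \<alpha> by simp
    finally show ?thesis by linarith
  qed
  also have "\<dots> \<le> A ((A ^^ n) ((f ^^ n) (f Q) $ 3))"
    using IH low by (subst A_le_iff) (auto intro!: An_gt simp: s Suc.prems(2)[of "Suc n", simplified])
  finally show ?case using IH by (simp add: s algebra_simps)
qed simp

section \<open>Orbits with a common itinerary\<close>

definition itin :: "real^3 \<Rightarrow> nat \<Rightarrow> int \<times> int" where "itin x k = beam_index ((f ^^ k) x)"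

definition track :: "(nat \<Rightarrow> int \<times> int) \<Rightarrow> (real^3) set" where "track s = {x \<in> J. itin x = s}"

lemma J_gt: "x \<in> J \<Longrightarrow> (f ^^ k) x $ 3 > M" by (simp add: J_def)

lemma J_fn: "x \<in> J \<Longrightarrow> (f ^^ k) x \<in> J"
  by (simp add: J_def funpow_add[symmetric, THEN fun_cong, unfolded comp_def])

lemma track_J: "x \<in> track s \<Longrightarrow> x \<in> J" by (simp add: track_def)

lemma track_beam: "x \<in> track s \<Longrightarrow> in_beam (s k) ((f ^^ k) x)"
  by (auto simp: track_def itin_def in_beam_index)

lemma track_even: "x \<in> track s \<Longrightarrow> even (fst (s k) + snd (s k))"
  using \<Lambda>_f(2)[OF track_beam[of x s k]] J_gt[of x "Suc k"] by (simp add: track_J)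

lemma track_hor: "x \<in> track s \<Longrightarrow> y \<in> track s \<Longrightarrow> norm (hor ((f ^^ k) x) - hor ((f ^^ k) y)) \<le> 3"
  by (rule in_beam_hor[OF track_beam track_beam])

lemma track_\<Lambda>: "x \<in> track s \<Longrightarrow> \<Lambda> (s k) ((f ^^ Suc k) x) = (f ^^ k) x"
  using \<Lambda>_f(1)[OF track_beam[of x s k]] J_gt[of x "Suc k"] by (simp add: track_J)

lemma track_shift: "x \<in> track s \<Longrightarrow> (f ^^ k) x \<in> track (\<lambda>n. s (n + k))"
  unfolding track_def itin_def fun_eq_iff using J_fn by (auto; metis comp_apply funpow_add)

text \<open>Both orbits are carried back by the same branches, each of which contracts by
  \<open>\<alpha>\<close>.\<close>

lemma track_contract:
  assumes "x \<in> track s" "y \<in> track s"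
  shows "norm (x - y) \<le> \<alpha> ^ k * norm ((f ^^ k) x - (f ^^ k) y)"
proof (induction k)
  case (Suc k)
  have "norm ((f ^^ k) x - (f ^^ k) y) \<le> \<alpha> * norm ((f ^^ Suc k) x - (f ^^ Suc k) y)"
    using \<Lambda>_lipschitz[OF track_even[OF assms(1), of k] J_gt[OF track_J[OF assms(1)], of "Suc k"]
        J_gt[OF track_J[OF assms(2)], of "Suc k"]]
    by (simp only: track_\<Lambda>[OF assms(1)] track_\<Lambda>[OF assms(2)])
  then have "\<alpha> ^ k * norm ((f ^^ k) x - (f ^^ k) y) \<le> \<alpha> ^ k * (\<alpha> * norm ((f ^^ Suc k) x - (f ^^ Suc k) y))"
    using \<alpha> by (intro mult_left_mono) auto
  then show ?case using Suc by (simp only: power_Suc mult_ac)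
qed simp

text \<open>An orbit point at height exactly \<open>M\<close> would have its image at height at most
  \<open>m < M\<close>. Thus the strict inequalities defining \<open>J\<close> can be replaced by
  closed ones.\<close>

lemma ge_M_in_J:
  assumes "\<And>k. (f ^^ k) x $ 3 \<ge> M" shows "x \<in> J"
  unfolding J_def
proof (intro CollectI allI)
  fix k
  show "(f ^^ k) x $ 3 > M"
  proof (rule ccontr)
    assume "\<not> ?thesis"
    then have "f ((f ^^ k) x) $ 3 \<le> m" by (intro f_low) simp
    then show False using assms[of "Suc k"] mM by simp
  qed
qed

text \<open>All premises are closed conditions, so limits of points following an itinerary stay in
  the track. A point of a closed beam whose image lies above \<open>M\<close> has that beam as its
  index.\<close>

lemma in_trackI:
  assumes "\<And>k. (f ^^ k) x $ 3 \<ge> M" "\<And>k. in_beam (s k) ((f ^^ k) x)"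
  shows "x \<in> track s"
proof -
  have J: "x \<in> J" by (rule ge_M_in_J) (rule assms)
  have "beam_index ((f ^^ k) x) = s k" for k
    using \<Lambda>_f(3)[OF assms(2)[of k]] J_gt[OF J, of "Suc k"] by simp
  then show ?thesis using J by (simp add: track_def itin_def fun_eq_iff)
qed

lemma closed_in_beam: "closed {x. in_beam r x}"
  unfolding in_beam_def by (intro closed_Collect_conj closed_Collect_le continuous_intros)

lemma closed_track: "closed (track s)"
proof -
  have "track s = (\<Inter>k. {x. (f ^^ k) x $ 3 \<ge> M} \<inter> {x. in_beam (s k) ((f ^^ k) x)})"
  proof (intro equalityI subsetI)
    fix x assume "x \<in> track s"
    then show "x \<in> (\<Inter>k. {x. (f ^^ k) x $ 3 \<ge> M} \<inter> {x. in_beam (s k) ((f ^^ k) x)})"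
      using track_beam[of x s] J_gt[OF track_J, of x s] by (simp add: less_imp_le)
  qed (auto intro!: in_trackI)
  also have "closed \<dots>"
  proof (intro closed_INT ballI closed_Int)
    fix k
    show "closed {x. (f ^^ k) x $ 3 \<ge> M}"
      by (intro closed_Collect_le continuous_intros continuous_fn)
    show "closed {x. in_beam (s k) ((f ^^ k) x)}"
      using closed_vimage[OF closed_in_beam continuous_fn] by (simp add: vimage_def)
  qed
  finally show ?thesis .
qed

text \<open>The speed of escape, measured by the one-dimensional model \<open>B\<close>. It parametrizes the hairs: it is
  injective on each track because two orbits in the same beams separate vertically and then keep their order.\<close>

definition height :: "real^3 \<Rightarrow> real" where "height x = lim (\<lambda>k. (A ^^ k) ((f ^^ k) x $ 3))"

text \<open>One step loses height in the model, since \<open>exp (x $ 3)\<close> is the norm of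
  \<open>up (f x)\<close> and dominates its third coordinate.\<close>

lemma height_decseq:
  assumes x: "x \<in> J" shows "decseq (\<lambda>k. (A ^^ k) ((f ^^ k) x $ 3))"
  unfolding decseq_Suc_iff
proof
  fix k
  have "A ((f ^^ Suc k) x $ 3) \<le> (f ^^ k) x $ 3" using A_f_le[of "(f ^^ k) x"] J_gt[OF x, of "Suc k"] by simp
  then have "(A ^^ k) (A ((f ^^ Suc k) x $ 3)) \<le> (A ^^ k) ((f ^^ k) x $ 3)"
    using J_gt[OF x] by (subst An_le_iff) (auto intro!: A_gt less_imp_le simp del: funpow.simps)
  then show "(A ^^ Suc k) ((f ^^ Suc k) x $ 3) \<le> (A ^^ k) ((f ^^ k) x $ 3)"
    by (simp add: funpow_swap1)
qed

lemma height_lim: "x \<in> J \<Longrightarrow> (\<lambda>k. (A ^^ k) ((f ^^ k) x $ 3)) \<longlonglongrightarrow> height x"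
proof -
  assume x: "x \<in> J"
  have "convergent (\<lambda>k. (A ^^ k) ((f ^^ k) x $ 3))"
  proof (rule Bseq_monoseq_convergent)
    show "Bseq (\<lambda>k. (A ^^ k) ((f ^^ k) x $ 3))"
      using decseq_bounded[OF height_decseq[OF x], of M] An_gt[OF J_gt[OF x]] less_imp_le by blast
    show "monoseq (\<lambda>k. (A ^^ k) ((f ^^ k) x $ 3))" using height_decseq[OF x] by (rule decseq_imp_monoseq)
  qed
  then show ?thesis by (simp add: height_def convergent_LIMSEQ_iff)
qed

lemma height_le: "x \<in> J \<Longrightarrow> height x \<le> (A ^^ k) ((f ^^ k) x $ 3)"
  using decseq_ge[OF height_decseq height_lim] .

text \<open>To keep the inequality strict in the limit, the terms from index 1 on are bounded below
  by \<open>A M\<close>, which exceeds \<open>M\<close>.\<close>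

lemma height_gt: "x \<in> J \<Longrightarrow> height x > M"
proof -
  assume x: "x \<in> J"
  have "A M \<le> (A ^^ Suc k) ((f ^^ Suc k) x $ 3)" for k
    using An_gt[OF J_gt[OF x], of k "Suc k"] \<beta>_pos by (simp add: A_def \<beta>_def)
  then have "A M \<le> height x"
    by (intro tendsto_lowerbound[OF LIMSEQ_Suc[OF height_lim[OF x]]]) auto
  then show ?thesis using A_gt[of M] by simp
qed

lemma height_f: "x \<in> J \<Longrightarrow> A (height (f x)) = height x"
proof -
  assume x: "x \<in> J"
  then have fx: "f x \<in> J" using J_fn[of x 1] by simp
  have "isCont A (height (f x))"
    unfolding A_def using height_gt[OF fx] \<beta>_pos by (intro continuous_intros) (auto simp: \<beta>_def)
  then have "(\<lambda>k. A ((A ^^ k) ((f ^^ k) (f x) $ 3))) \<longlonglongrightarrow> A (height (f x))"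
    by (rule isCont_tendsto_compose) (rule height_lim[OF fx])
  moreover have "(\<lambda>k. A ((A ^^ k) ((f ^^ k) (f x) $ 3))) \<longlonglongrightarrow> height x"
    using LIMSEQ_Suc[OF height_lim[OF x]] by (simp add: funpow_swap1)
  ultimately show ?thesis by (rule LIMSEQ_unique)
qed

lemma height_fn: "x \<in> J \<Longrightarrow> (A ^^ k) (height ((f ^^ k) x)) = height x"
proof (induction k)
  case (Suc k)
  have "(A ^^ Suc k) (height ((f ^^ Suc k) x)) = (A ^^ k) (A (height (f ((f ^^ k) x))))"
    by (simp add: funpow_swap1)
  then show ?case using Suc height_f[OF J_fn] by simp
qed simp

lemma height_fn_less_iff:
  "x \<in> J \<Longrightarrow> y \<in> J \<Longrightarrow> height ((f ^^ k) x) < height ((f ^^ k) y) \<longleftrightarrow> height x < height y"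
  using An_less_iff[OF height_gt[OF J_fn[of x k]] height_gt[OF J_fn[of y k]], of k] by (simp add: height_fn)

lemma height_close:
  assumes "x \<in> track s" "y \<in> track s" "x $ 3 + 4 \<le> y $ 3"
  shows "y $ 3 - 1/2 \<le> height y"
proof (rule tendsto_lowerbound[OF height_lim])
  have "(A ^^ n) ((f ^^ n) y $ 3) \<ge> y $ 3 - 16 * exp (- 4)" for n
    using growth_chain[of n x y 4] assms track_hor[OF assms(1,2)] J_gt track_J by auto
  then show "\<forall>\<^sub>F n in sequentially. y $ 3 - 1/2 \<le> (A ^^ n) ((f ^^ n) y $ 3)"
    using exp_minus_4 by (intro always_eventually allI) (smt (verit))
qed (use assms track_J in auto)

lemma height_less:
  assumes "x \<in> track s" "y \<in> track s" "(f ^^ k) x $ 3 + 4 \<le> (f ^^ k) y $ 3"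
  shows "height x < height y"
proof -
  have "(f ^^ k) y $ 3 - 1/2 \<le> height ((f ^^ k) y)"
    using height_close track_shift assms by blast
  moreover have "height ((f ^^ k) x) \<le> (f ^^ k) x $ 3"
    using height_le[OF J_fn[OF track_J[OF assms(1)]], of k 0] by simp
  ultimately have "height ((f ^^ k) x) < height ((f ^^ k) y)" using assms(3) by linarith
  then show ?thesis using height_fn_less_iff assms track_J by blast
qed

text \<open>Contraction backwards makes the distance of the orbits tend to infinity, while its
  horizontal part stays at most 3.\<close>

lemma eventually_separated:
  assumes "x \<in> track s" "y \<in> track s" "x \<noteq> y"
  shows "\<forall>\<^sub>F k in sequentially. \<bar>(f ^^ k) x $ 3 - (f ^^ k) y $ 3\<bar> \<ge> D"
proof -
  have "(\<lambda>k. \<alpha> ^ k * (\<bar>D\<bar> + 3)) \<longlonglongrightarrow> 0"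
    using \<alpha> by (intro tendsto_mult_left_zero LIMSEQ_power_zero) simp
  then have "\<forall>\<^sub>F k in sequentially. \<alpha> ^ k * (\<bar>D\<bar> + 3) < norm (x - y)"
    by (rule order_tendstoD(2)) (use assms(3) in simp)
  then show ?thesis
  proof eventually_elim
    case (elim k)
    have "\<alpha> ^ k * (\<bar>D\<bar> + 3) < \<alpha> ^ k * norm ((f ^^ k) x - (f ^^ k) y)"
      using track_contract[OF assms(1,2), of k] elim by linarith
    then have "\<bar>D\<bar> + 3 < norm ((f ^^ k) x - (f ^^ k) y)" using \<alpha> by simp
    also have "\<dots> \<le> 3 + \<bar>(f ^^ k) x $ 3 - (f ^^ k) y $ 3\<bar>"
      using norm_le_hor[of "(f ^^ k) x - (f ^^ k) y"] track_hor[OF assms(1,2), of k] by (simp add: hor_diff)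
    finally show ?case by simp
  qed
qed

lemma height_gap:
  assumes "x \<in> track s" "y \<in> track s" "height x < height y"
  shows "\<forall>\<^sub>F k in sequentially. (f ^^ k) x $ 3 + D \<le> (f ^^ k) y $ 3"
proof -
  have "x \<noteq> y" using assms(3) by auto
  then have "\<forall>\<^sub>F k in sequentially. \<bar>(f ^^ k) x $ 3 - (f ^^ k) y $ 3\<bar> \<ge> max D 4"
    by (intro eventually_separated[OF assms(1,2)])
  then show ?thesis
  proof eventually_elim
    case (elim k)
    have "\<not> (f ^^ k) y $ 3 + 4 \<le> (f ^^ k) x $ 3"
      using height_less[OF assms(2,1), of k] assms(3) by auto
    then show ?case using elim by linarith
  qed
qed

lemma inj_height: "inj_on height (track s)"
proof (rule inj_onI, rule ccontr)
  fix x y assume xy: "x \<in> track s" "y \<in> track s" "height x = height y" "x \<noteq> y"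
  obtain k where "\<bar>(f ^^ k) x $ 3 - (f ^^ k) y $ 3\<bar> \<ge> 4"
    using eventually_happens[OF eventually_separated[OF xy(1,2,4), of 4]] by auto
  then have "(f ^^ k) x $ 3 + 4 \<le> (f ^^ k) y $ 3 \<or> (f ^^ k) y $ 3 + 4 \<le> (f ^^ k) x $ 3" by linarith
  then show False using height_less xy by (metis less_irrefl)
qed


section \<open>Continuity of the height on a track\<close>

lemma power_\<alpha>_less: assumes "e > 0" shows "\<exists>k\<ge>n. \<alpha> ^ k * c < e"
proof -
  have "(\<lambda>k. \<alpha> ^ k * c) \<longlonglongrightarrow> 0"
    using \<alpha> by (intro tendsto_mult_left_zero LIMSEQ_power_zero) simp
  then have "\<forall>\<^sub>F k in sequentially. \<alpha> ^ k * c < e"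
    by (rule order_tendstoD(2)) (rule assms)
  then have "\<forall>\<^sub>F k in sequentially. \<alpha> ^ k * c < e \<and> k \<ge> n"
    using eventually_ge_at_top[of n] by (rule eventually_conj)
  then show ?thesis using eventually_happens'[OF sequentially_bot] by blast
qed

lemma isCont_fn_3: "isCont (\<lambda>x. (f ^^ k) x $ 3) x"
  using continuous_fn[of UNIV k] by (auto simp: continuous_on_eq_continuous_at intro: continuous_intros)

text \<open>The height is the infimum of the continuous functions in its decreasing limit.\<close>

lemma height_upper_semicontinuous:
  assumes x: "x \<in> J" and e: "e > 0"
  shows "\<forall>\<^sub>F y in at x within J. height y < height x + e"
proof -
  have "\<forall>\<^sub>F k in sequentially. (A ^^ k) ((f ^^ k) x $ 3) < height x + e / 2"
    by (rule order_tendstoD(2)[OF height_lim[OF x]]) (use e in simp)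
  then obtain k where k: "(A ^^ k) ((f ^^ k) x $ 3) < height x + e / 2"
    using eventually_happens'[OF sequentially_bot] by blast
  have "((\<lambda>y. (f ^^ k) y $ 3) \<longlongrightarrow> (f ^^ k) x $ 3) (at x within J)"
    using isCont_fn_3 by (meson continuous_within continuous_at_imp_continuous_at_within)
  then have "\<forall>\<^sub>F y in at x within J. dist ((f ^^ k) y $ 3) ((f ^^ k) x $ 3) < e / 2"
    by (rule tendstoD) (use e in simp)
  moreover have "\<forall>\<^sub>F y in at x within J. y \<in> J"
    by (simp add: eventually_at_filter)
  ultimately show ?thesis
  proof eventually_elim
    case (elim y)
    have "height y \<le> (A ^^ k) ((f ^^ k) y $ 3)" using elim by (intro height_le)
    also have "\<dots> \<le> (A ^^ k) ((f ^^ k) x $ 3) + \<alpha> ^ k * \<bar>(f ^^ k) y $ 3 - (f ^^ k) x $ 3\<bar>"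
      using An_lipschitz[OF J_gt[OF elim(2)] J_gt[OF x], of k k k] by linarith
    also have "\<alpha> ^ k * \<bar>(f ^^ k) y $ 3 - (f ^^ k) x $ 3\<bar> \<le> 1 * \<bar>(f ^^ k) y $ 3 - (f ^^ k) x $ 3\<bar>"
      using \<alpha> by (intro mult_right_mono power_le_one) auto
    finally show ?case using elim(1) k by (simp add: dist_real_def)
  qed
qed

text \<open>A point \<open>z\<close> of smaller height eventually runs far below the orbit of
  \<open>x\<close>, hence also below the orbits of points near \<open>x\<close> at a late time
  \<open>k\<close>. Then \<open>height_close\<close> determines their heights at time
  \<open>k\<close> up to a bounded error, which \<open>A ^^ k\<close> shrinks below
  \<open>e\<close>. If there is no such \<open>z\<close>, the height is minimal at
  \<open>x\<close>.\<close>

lemma height_lower_semicontinuous: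
  assumes x: "x \<in> track s" and e: "e > 0"
  shows "\<forall>\<^sub>F y in at x within track s. height x - e < height y"
proof (cases "\<exists>z\<in>track s. height z < height x")
  case True
  then obtain z where z: "z \<in> track s" "height z < height x" by blast
  \<comment> \<open>The spare unit absorbs the deviation 1/2 of a nearby \<open>y\<close>, so that a
    gap of at least 4 to \<open>z\<close> remains.\<close>
  obtain K where K: "\<And>k. k \<ge> K \<Longrightarrow> (f ^^ k) z $ 3 + 5 \<le> (f ^^ k) x $ 3"
    using height_gap[OF z(1) x z(2), of 5] unfolding eventually_sequentially by blast
  obtain k where k: "k \<ge> K" "\<alpha> ^ k * 1 < e" using power_\<alpha>_less[OF e] by blast
  have "((\<lambda>y. (f ^^ k) y $ 3) \<longlongrightarrow> (f ^^ k) x $ 3) (at x within track s)"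
    using isCont_fn_3 by (meson continuous_within continuous_at_imp_continuous_at_within)
  then have "\<forall>\<^sub>F y in at x within track s. dist ((f ^^ k) y $ 3) ((f ^^ k) x $ 3) < 1/2"
    by (rule tendstoD) simp
  moreover have "\<forall>\<^sub>F y in at x within track s. y \<in> track s"
    by (simp add: eventually_at_filter)
  ultimately show ?thesis
  proof eventually_elim
    case (elim y)
    let ?u = "height ((f ^^ k) y)" and ?w = "height ((f ^^ k) x)"
    have d: "\<bar>(f ^^ k) y $ 3 - (f ^^ k) x $ 3\<bar> < 1/2" using elim(1) by (simp add: dist_real_def)
    have "(f ^^ k) z $ 3 + 4 \<le> (f ^^ k) y $ 3" using K[OF k(1)] d by linarith
    then have "(f ^^ k) y $ 3 - 1/2 \<le> ?u"
      using height_close[OF track_shift[OF z(1)] track_shift[OF elim(2)]] by blast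
    moreover have "?w \<le> (f ^^ k) x $ 3"
      using height_le[OF J_fn[OF track_J[OF x]], of k 0] by simp
    ultimately have uw: "?u > ?w - 1" using d by linarith
    have gt: "?u > M" "?w > M" using height_gt J_fn track_J x elim(2) by blast+
    have eq: "height y = (A ^^ k) ?u" "height x = (A ^^ k) ?w"
      using height_fn track_J x elim(2) by metis+
    show ?case
    proof (cases "?u \<ge> ?w")
      case True
      then have "(A ^^ k) ?w \<le> (A ^^ k) ?u" using gt by (simp add: An_le_iff)
      then show ?thesis using e unfolding eq by linarith
    next
      case False
      then have "\<bar>?u - ?w\<bar> \<le> 1" using uw by linarith
      then have "\<alpha> ^ k * \<bar>?u - ?w\<bar> \<le> \<alpha> ^ k * 1" using \<alpha> by (intro mult_left_mono) auto
      then show ?thesis using An_lipschitz[OF gt, of k] k(2) unfolding eq by linarith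
    qed
  qed
next
  case False
  then show ?thesis using e
    by (auto simp: eventually_at_filter not_less intro!: always_eventually intro: less_le_trans)
qed

lemma continuous_height: "continuous_on (track s) height"
  unfolding continuous_on_def
proof
  fix x assume x: "x \<in> track s"
  have "at x within track s \<le> at x within J" by (rule at_le) (auto simp: track_J)
  then have up: "\<forall>\<^sub>F y in at x within track s. height y < height x + e" if "e > 0" for e
    using height_upper_semicontinuous[OF track_J[OF x] that] by (metis filter_leD)
  show "(height \<longlongrightarrow> height x) (at x within track s)"
  proof (rule tendstoI)
    fix e :: real assume e: "e > 0"
    show "\<forall>\<^sub>F y in at x within track s. dist (height y) (height x) < e"
      using up[OF e] height_lower_semicontinuous[OF x e]
      by eventually_elim (simp add: dist_real_def abs_less_iff)
  qed
qed

section \<open>Points of prescribed height on a track\<close>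

primrec pull :: "(nat \<Rightarrow> int \<times> int) \<Rightarrow> nat \<Rightarrow> real^3 \<Rightarrow> real^3" where
  "pull s 0 q = q"
| "pull s (Suc k) q = pull s k (\<Lambda> (s k) q)"

lemma pull_lipschitz:
  assumes "\<forall>k. even (fst (s k) + snd (s k))" "p $ 3 > M" "q $ 3 > M"
  shows "norm (pull s k p - pull s k q) \<le> \<alpha> ^ k * norm (p - q)"
  using assms(2,3)
proof (induction k arbitrary: p q)
  case (Suc k)
  have "norm (pull s (Suc k) p - pull s (Suc k) q) \<le> \<alpha> ^ k * norm (\<Lambda> (s k) p - \<Lambda> (s k) q)"
    using Suc.IH[OF \<Lambda>_3_gt[OF Suc.prems(1)] \<Lambda>_3_gt[OF Suc.prems(2)]] by simp
  also have "\<dots> \<le> \<alpha> ^ k * (\<alpha> * norm (p - q))"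
    using \<alpha> \<Lambda>_lipschitz[OF assms(1)[rule_format] Suc.prems] by (intro mult_left_mono) auto
  finally show ?case by (simp only: power_Suc mult_ac)
qed simp

text \<open>\<open>pull\<close> applies the branch of index \<open>k - 1\<close> first and that of
  index 0 last, so that \<open>f\<close> undoes them in the order of the itinerary.\<close>

lemma f_pull:
  assumes "\<forall>k. even (fst (s k) + snd (s k))" "q $ 3 > M"
  shows "(f ^^ k) (pull s k q) = q"
  using assms(2)
proof (induction k arbitrary: q)
  case (Suc k)
  then show ?case using \<Lambda>_3_gt f_\<Lambda>[OF assms(1)[rule_format]] by simp
qed simp

lemma f_pull_beam:
  assumes "\<forall>k. even (fst (s k) + snd (s k))" "q $ 3 > M" "j < k"
  shows "in_beam (s j) ((f ^^ j) (pull s k q))"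
  using assms(2,3)
proof (induction k arbitrary: q)
  case (Suc k)
  have gt: "\<Lambda> (s k) q $ 3 > M" using \<Lambda>_3_gt[OF Suc.prems(1)] .
  show ?case
  proof (cases "j = k")
    case True
    then show ?thesis using f_pull[OF assms(1) gt] \<Lambda>_beam[OF Suc.prems(1)] by simp
  next
    case False
    then show ?thesis using Suc gt by simp
  qed
qed simp

lemma f_pull_gt:
  assumes "\<forall>k. even (fst (s k) + snd (s k))" "q $ 3 > M" "j \<le> k"
  shows "(f ^^ j) (pull s k q) $ 3 > M"
  using assms(2,3)
proof (induction k arbitrary: q)
  case (Suc k)
  have gt: "\<Lambda> (s k) q $ 3 > M" using \<Lambda>_3_gt[OF Suc.prems(1)] .
  show ?case
  proof (cases "j = Suc k")
    case True
    then show ?thesis using f_pull[OF assms(1) Suc.prems(1), of "Suc k"] Suc.prems by simp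
  next
    case False
    then show ?thesis using Suc gt by simp
  qed
qed simp

text \<open>A finite form of \<open>height_decseq\<close>, for pulled back points whose orbits are
  controlled only up to time \<open>n\<close>.\<close>

lemma A_height_below:
  assumes "\<And>i. i \<le> n \<Longrightarrow> (f ^^ i) y $ 3 > M" "j \<le> n"
  shows "(A ^^ n) ((f ^^ n) y $ 3) \<le> (A ^^ j) ((f ^^ j) y $ 3)"
  using assms(2)
proof (induction rule: dec_induct)
  case (step i)
  have gt: "(f ^^ Suc i) y $ 3 > M" "(f ^^ i) y $ 3 > M"
    using assms(1)[of "Suc i"] assms(1)[of i] step by (auto simp del: funpow.simps)
  have "(A ^^ Suc i) ((f ^^ Suc i) y $ 3) = (A ^^ i) (A ((f ^^ Suc i) y $ 3))"
    by (simp add: funpow_swap1)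
  also have "\<dots> \<le> (A ^^ i) ((f ^^ i) y $ 3)"
    using An_le_iff[OF A_gt[OF less_imp_le[OF gt(1)]] gt(2), of i] A_f_le[of "(f ^^ i) y"] gt(1) by simp
  finally show ?case using step by simp
qed simp

lemma A_funpow_B [simp]: "(A ^^ k) ((B ^^ k) t) = t"
proof (induction k)
  case (Suc k)
  have "(A ^^ Suc k) ((B ^^ Suc k) t) = (A ^^ k) (A (B ((B ^^ k) t)))"
    by (simp add: funpow_swap1[of A])
  then show ?case using Suc by simp
qed simp

text \<open>The model orbit of \<open>T\<close> prescribes heights \<open>\<tau> k\<close> above the
  orbit of \<open>x\<close>. The point at height \<open>\<tau> k\<close> vertically over or under
  the k-th orbit point is pulled back along the itinerary to \<open>y k\<close>. Comparison with the
  orbit of \<open>x\<close> shows that consecutive \<open>y k\<close> agree at time \<open>k\<close>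
  up to distance 4, hence differ by at most \<open>\<alpha> ^ k * 4\<close>; their limit has height
  \<open>T\<close>.\<close>

lemma track_surj:
  assumes x: "x \<in> track s" and T: "height x < T"
  shows "\<exists>y\<in>track s. height y = T"
proof -
  have ev: "\<forall>k. even (fst (s k) + snd (s k))" using track_even[OF x] by blast
  have xJ: "x \<in> J" by (rule track_J[OF x])
  define \<tau> where "\<tau> k = (B ^^ k) T" for k
  have \<tau>_gt: "\<tau> k > height ((f ^^ k) x)" for k
  proof (induction k)
    case (Suc k)
    have "A (height (f ((f ^^ k) x))) < A (\<tau> (Suc k))"
      using Suc height_f[OF J_fn[OF xJ]] by (simp add: \<tau>_def)
    moreover have "A w = ln (w + a)" for w by (simp add: A_def)
    moreover have "\<tau> (Suc k) + a > 0" by (simp add: \<tau>_def B_def)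
    moreover have "height (f ((f ^^ k) x)) + a > 0"
      using height_gt[OF J_fn[OF xJ, of "Suc k"]] \<beta>_pos by (simp add: \<beta>_def)
    ultimately show ?case by (simp add: ln_less_cancel_iff)
  qed (use T in \<open>simp add: \<tau>_def\<close>)
  have \<tau>_M: "\<tau> k > M" for k using \<tau>_gt[of k] height_gt[OF J_fn[OF xJ], of k] by linarith
  define q :: "nat \<Rightarrow> real^3" where "q k = vector [(f ^^ k) x $ 1, (f ^^ k) x $ 2, \<tau> k]" for k
  have q3: "q k $ 3 = \<tau> k" and qgt: "q k $ 3 > M" and qhor: "hor (q k) = hor ((f ^^ k) x)" for k
    using \<tau>_M by (simp_all add: q_def hor_def)
  define y where "y k = pull s k (q k)" for k
  have fy: "(f ^^ k) (y k) = q k" for k unfolding y_def by (rule f_pull[OF ev qgt])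
  have ygt: "(f ^^ j) (y k) $ 3 > M" if "j \<le> k" for j k unfolding y_def by (rule f_pull_gt[OF ev qgt that])
  have ybeam: "in_beam (s j) ((f ^^ j) (y k))" if "j < k" for j k
    unfolding y_def by (rule f_pull_beam[OF ev qgt that])
  have yhor: "norm (hor ((f ^^ j) x) - hor ((f ^^ j) (y k))) \<le> 3" if "j \<le> k" for j k
  proof (cases "j = k")
    case True then show ?thesis by (simp add: fy qhor)
  next
    case False then show ?thesis using that by (intro in_beam_hor[OF track_beam[OF x] ybeam]) simp
  qed
  have yT: "T \<le> (A ^^ j) ((f ^^ j) (y k) $ 3)" if "j \<le> k" for j k
    using A_height_below[of k "y k" j] ygt that by (auto simp: fy q3 \<tau>_def)
  \<comment> \<open>The midpoint leaves two margins: the model heights of \<open>x\<close> are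
    eventually below \<open>T'\<close>, and for late \<open>j\<close> a difference above
    \<open>T - T'\<close> after applying \<open>A ^^ j\<close> comes from a gap above 4.\<close>
  define T' where "T' = (T + height x) / 2"
  have T': "height x < T'" "T' < T" using T by (simp_all add: T'_def)
  have "\<forall>\<^sub>F j in sequentially. (A ^^ j) ((f ^^ j) x $ 3) < T'"
    by (rule order_tendstoD(2)[OF height_lim[OF xJ] T'(1)])
  moreover have "\<forall>\<^sub>F j in sequentially. \<alpha> ^ j * 4 < T - T'"
  proof (rule order_tendstoD(2))
    show "(\<lambda>j. \<alpha> ^ j * 4) \<longlonglongrightarrow> 0" using \<alpha> by (intro tendsto_mult_left_zero LIMSEQ_power_zero) simp
  qed (use T' in simp)
  ultimately have "\<forall>\<^sub>F j in sequentially. (A ^^ j) ((f ^^ j) x $ 3) < T' \<and> \<alpha> ^ j * 4 < T - T'"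
    by (rule eventually_conj)
  then obtain j0 where j0: "\<And>j. j \<ge> j0 \<Longrightarrow> (A ^^ j) ((f ^^ j) x $ 3) < T'" "\<And>j. j \<ge> j0 \<Longrightarrow> \<alpha> ^ j * 4 < T - T'"
    unfolding eventually_sequentially by blast
  have gap: "(f ^^ j) x $ 3 + 4 \<le> (f ^^ j) (y k) $ 3" if "j0 \<le> j" "j \<le> k" for j k
  proof -
    let ?u = "(f ^^ j) (y k) $ 3" and ?w = "(f ^^ j) x $ 3"
    have gt: "?u > M" "?w > M" using ygt[OF that(2)] J_gt[OF xJ] by blast+
    have lt: "T - T' < (A ^^ j) ?u - (A ^^ j) ?w" using yT[OF that(2)] j0(1)[OF that(1)] by linarith
    then have "(A ^^ j) ?w < (A ^^ j) ?u" using T' by linarith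
    then have pos: "?w < ?u" using gt by (simp add: An_less_iff)
    have "\<alpha> ^ j * 4 < \<alpha> ^ j * \<bar>?u - ?w\<bar>" using An_lipschitz[OF gt, of j] lt j0(2)[OF that(1)] by linarith
    then show ?thesis using \<alpha> pos by simp
  qed
  have step: "norm (y (Suc k) - y k) \<le> \<alpha> ^ k * 4" if k: "k \<ge> j0" for k
  proof -
    let ?Q = "(f ^^ k) (y (Suc k))"
    have Q: "?Q = \<Lambda> (s k) (q (Suc k))" unfolding y_def using f_pull[OF ev \<Lambda>_3_gt[OF qgt]] by simp
    have fQ: "f ?Q = q (Suc k)" using fy[of "Suc k"] by simp
    \<comment> \<open>The height of \<open>?Q\<close> lies between \<open>\<tau> k\<close> and
      \<open>\<tau> k + 1\<close>; with the horizontal distance 3 this gives the constant 4.\<close>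
    have "A (f ?Q $ 3) = \<tau> k" unfolding fQ q3 by (simp add: \<tau>_def)
    moreover have "A (f ?Q $ 3) \<ge> ?Q $ 3 - 8 * exp (- 4)"
      using growth_step_4(2)[of "(f ^^ k) x" ?Q 4] J_gt[OF xJ, of "Suc k"] ygt[of "Suc k" "Suc k"]
        yhor[of "Suc k" "Suc k"] gap[OF k, of "Suc k"] by simp
    moreover have "A (f ?Q $ 3) \<le> ?Q $ 3" by (rule A_f_le) (simp add: fQ qgt)
    moreover have "8 * exp (-4) \<le> (1::real)" using exp_minus_4 by linarith
    ultimately have "\<bar>?Q $ 3 - q k $ 3\<bar> \<le> 1" unfolding q3 by linarith
    then have "norm (?Q - q k) \<le> 4"
      using norm_le_hor[of "?Q - q k"] yhor[of k "Suc k"] by (simp add: hor_diff qhor norm_minus_commute)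
    moreover have "norm (y (Suc k) - y k) \<le> \<alpha> ^ k * norm (?Q - q k)"
      using pull_lipschitz[OF ev \<Lambda>_3_gt[OF qgt[of "Suc k"], of "s k"] qgt[of k], of k] unfolding Q by (simp add: y_def)
    ultimately show ?thesis using \<alpha> by (meson mult_left_mono order_trans zero_le_power less_imp_le)
  qed
  have "summable (\<lambda>k. y (k + Suc j0) - y (k + j0))"
  proof (rule summable_comparison_test')
    show "summable (\<lambda>k. \<alpha> ^ (k + j0) * 4)"
      unfolding power_add using \<alpha> by (intro summable_mult2 summable_geometric) auto
    show "norm (y (k + Suc j0) - y (k + j0)) \<le> \<alpha> ^ (k + j0) * 4" for k using step[of "k + j0"] by simp
  qed
  then have "summable (\<lambda>k. y (Suc k + j0) - y (k + j0))" by simp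
  then obtain S where "(\<lambda>n. \<Sum>k<n. y (Suc k + j0) - y (k + j0)) \<longlonglongrightarrow> S"
    unfolding summable_def sums_def by blast
  then have "(\<lambda>n. y (n + j0) - y j0) \<longlonglongrightarrow> S"
    unfolding sum_lessThan_telescope[of "\<lambda>k. y (k + j0)"] by simp
  then have "(\<lambda>n. (y (n + j0) - y j0) + y j0) \<longlonglongrightarrow> S + y j0" by (intro tendsto_intros)
  then obtain l where "(\<lambda>k. y (k + j0)) \<longlonglongrightarrow> l" by auto
  then have l: "y \<longlonglongrightarrow> l" by (rule LIMSEQ_offset)
  have fl: "(\<lambda>k. (f ^^ j) (y k)) \<longlonglongrightarrow> (f ^^ j) l" for j
    using continuous_fn[of UNIV j] by (intro continuous_on_tendsto_compose[OF _ l]) auto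
  then have fl3: "(\<lambda>k. (f ^^ j) (y k) $ 3) \<longlonglongrightarrow> (f ^^ j) l $ 3" for j by (rule tendsto_vec_nth)
  have lt: "l \<in> track s"
  proof (rule in_trackI)
    fix j
    have "\<forall>\<^sub>F k in sequentially. M \<le> (f ^^ j) (y k) $ 3"
      using eventually_ge_at_top[of j] by eventually_elim (simp add: ygt less_imp_le)
    then show "M \<le> (f ^^ j) l $ 3" by (intro tendsto_lowerbound[OF fl3]) auto
    have "\<forall>\<^sub>F k in sequentially. (f ^^ j) (y k) \<in> {x. in_beam (s j) x}"
      using eventually_gt_at_top[of j] by eventually_elim (simp add: ybeam)
    then have "(f ^^ j) l \<in> {x. in_beam (s j) x}"
      by (intro Lim_in_closed_set[OF closed_in_beam _ _ fl]) auto
    then show "in_beam (s j) ((f ^^ j) l)" by simp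
  qed
  have lJ: "l \<in> J" by (rule track_J[OF lt])
  have "T \<le> height l"
  proof (rule tendsto_lowerbound[OF height_lim[OF lJ]])
    have "T \<le> (A ^^ j) ((f ^^ j) l $ 3)" for j
    proof -
      have "\<tau> j \<le> (f ^^ j) (y k) $ 3" if "j \<le> k" for k
        using yT[OF that] An_le_iff[OF \<tau>_M[of j] ygt[OF that], of j] by (simp add: \<tau>_def)
      then have "\<forall>\<^sub>F k in sequentially. \<tau> j \<le> (f ^^ j) (y k) $ 3" by (rule eventually_sequentiallyI)
      then have "\<tau> j \<le> (f ^^ j) l $ 3" by (intro tendsto_lowerbound[OF fl3]) auto
      then have "(A ^^ j) (\<tau> j) \<le> (A ^^ j) ((f ^^ j) l $ 3)"
        using An_le_iff[OF \<tau>_M[of j] J_gt[OF lJ, of j], of j] by simp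
      then show ?thesis by (simp add: \<tau>_def)
    qed
    then show "\<forall>\<^sub>F j in sequentially. T \<le> (A ^^ j) ((f ^^ j) l $ 3)" by simp
  qed simp
  moreover have "height l \<le> T"
  proof (rule field_le_epsilon)
    fix e :: real assume "e > 0"
    then obtain j where j: "j \<ge> j0" "\<alpha> ^ j * 1 < e" using power_\<alpha>_less by blast
    have "(f ^^ j) (y k) $ 3 \<le> \<tau> j + 1" if k: "j \<le> k" for k
    proof -
      have split: "(f ^^ (k - j)) ((f ^^ j) z) = (f ^^ k) z" for z
        using k by (metis comp_apply funpow_add le_add_diff_inverse2)
      have eq: "(f ^^ i) ((f ^^ j) z) = (f ^^ (i + j)) z" for i z by (simp add: funpow_add)
      \<comment> \<open>The total error from time \<open>j\<close> to time \<open>k\<close> is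
        independent of \<open>k\<close>, so the bound at time \<open>j\<close> survives the limit;
        \<open>A ^^ j\<close> then reduces it by \<open>\<alpha> ^ j\<close>.\<close>
      have "(A ^^ (k - j)) ((f ^^ (k - j)) ((f ^^ j) (y k)) $ 3) \<ge> (f ^^ j) (y k) $ 3 - 16 * exp (- 4)"
      proof (rule growth_chain[THEN conjunct2])
        fix i assume "i \<le> k - j"
        then have "i + j \<le> k" using k by simp
        then show "(f ^^ i) ((f ^^ j) x) $ 3 > M" "(f ^^ i) ((f ^^ j) (y k)) $ 3 > M"
          "norm (hor ((f ^^ i) ((f ^^ j) x)) - hor ((f ^^ i) ((f ^^ j) (y k)))) \<le> 3"
          unfolding eq using J_gt[OF xJ] ygt yhor by blast+
      qed (use gap[OF j(1) k] in auto)
      moreover have "(A ^^ (k - j)) (q k $ 3) = \<tau> j"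
      proof -
        have "\<tau> k = (B ^^ (k - j)) (\<tau> j)" unfolding \<tau>_def using k
          by (metis comp_apply funpow_add le_add_diff_inverse2)
        then show ?thesis by (simp add: q3)
      qed
      ultimately show ?thesis using exp_minus_4 unfolding split fy by linarith
    qed
    then have "\<forall>\<^sub>F k in sequentially. (f ^^ j) (y k) $ 3 \<le> \<tau> j + 1" by (rule eventually_sequentiallyI)
    then have "(f ^^ j) l $ 3 \<le> \<tau> j + 1" by (intro tendsto_upperbound[OF fl3]) auto
    then have "(A ^^ j) ((f ^^ j) l $ 3) \<le> (A ^^ j) (\<tau> j + 1)"
      using \<tau>_M[of j] J_gt[OF lJ, of j] An_le_iff[of "(f ^^ j) l $ 3" "\<tau> j + 1" j] by simp
    also have "\<dots> \<le> (A ^^ j) (\<tau> j) + \<alpha> ^ j * 1"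
      using An_lipschitz[of "\<tau> j + 1" "\<tau> j" j] \<tau>_M[of j] by simp
    also have "(A ^^ j) (\<tau> j) = T" by (simp add: \<tau>_def)
    finally show "height l \<le> T + e" using height_le[OF lJ, of j] j(2) by linarith
  qed
  ultimately show ?thesis using lt by (intro bexI[of _ l]) auto
qed

section \<open>Compact sublevel sets and the endpoint of a track\<close>

lemma bounded_track_height: "bounded {x\<in>track s. height x \<le> T}"
proof (cases "track s = {}")
  case False
  then obtain x0 where x0: "x0 \<in> track s" by blast
  \<comment> \<open>Points lying 4 or more above \<open>x1\<close> would exceed its height, so
    \<open>x1\<close> bounds the third coordinate on the sublevel set.\<close>
  obtain x1 where x1: "x1 \<in> track s" "height x1 \<ge> T"
    using track_surj[OF x0, of "T"] x0 by (cases "height x0 < T") auto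
  have "norm x \<le> norm (hor x1) + 3 + (\<bar>M\<bar> + \<bar>x1 $ 3\<bar> + 4)" if "x \<in> track s" "height x \<le> T" for x
  proof -
    have "\<not> x1 $ 3 + 4 \<le> x $ 3" using height_less[OF x1(1) that(1), of 0] that(2) x1(2) by auto
    then have "\<bar>x $ 3\<bar> \<le> \<bar>M\<bar> + \<bar>x1 $ 3\<bar> + 4" using J_gt[OF track_J[OF that(1)], of 0] by auto
    moreover have "norm (hor x) \<le> norm (hor x1) + 3"
      using track_hor[OF that(1) x1(1), of 0] norm_triangle_ineq2[of "hor x" "hor x1"] by simp
    ultimately show ?thesis using norm_le_hor[of x] by linarith
  qed
  then show ?thesis unfolding bounded_iff by blast
qed simp

text \<open>The endpoint is the minimum point of the height, which exists on a compact sublevel set;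
  by \<open>track_surj\<close> the heights fill the half-line from there on.\<close>

lemma track_endpoint:
  assumes x0: "x0 \<in> track s"
  obtains e where "e \<in> track s" "hair_endpoint (track s) e" "\<And>y. y \<in> track s \<Longrightarrow> height e \<le> height y"
proof -
  let ?K = "{x\<in>track s. height x \<le> height x0}"
  have "compact ?K"
    unfolding compact_eq_bounded_closed
    using bounded_track_height continuous_closed_preimage[OF continuous_height closed_track closed_atMost[of "height x0"]]
    by (auto simp: vimage_def Int_def)
  moreover have "continuous_on ?K height" using continuous_height by (rule continuous_on_subset) auto
  ultimately have "\<exists>e\<in>?K. \<forall>y\<in>?K. height e \<le> height y"
    using x0 by (intro continuous_attains_inf) auto
  then obtain e where e: "e \<in> track s" "height e \<le> height x0"
    "\<And>y. y \<in> track s \<Longrightarrow> height y \<le> height x0 \<Longrightarrow> height e \<le> height y" by auto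
  then have min: "height e \<le> height y" if "y \<in> track s" for y
    using that by (cases "height y \<le> height x0") auto
  have "height ` track s = {height e..}"
  proof (intro equalityI subsetI)
    fix T assume "T \<in> {height e..}"
    then show "T \<in> height ` track s" using track_surj[OF e(1), of T] e(1) by (cases "height e = T") force+
  qed (use min in auto)
  then have "hair_endpoint (track s) e"
    by (intro hair_endpoint_of_parameter[OF closed_track continuous_height inj_height _ bounded_track_height e(1)]) auto
  then show thesis using that e(1) min by blast
qed


section \<open>Dimension of the hairs without endpoints\<close>

text \<open>Because \<open>exp (x $ 3)\<close> is the norm of \<open>up (f x)\<close>, the second
  condition bounds the horizontal part of each image by the \<open>\<epsilon>\<close>-th power of
  this norm. The bound \<open>R\<close> excludes the low cells, where the estimates are too
  weak.\<close>

definition slow :: "real \<Rightarrow> nat \<Rightarrow> (real^3) set" where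
  "slow \<epsilon> R = {x\<in>J. \<forall>k. (f ^^ k) x $ 3 \<ge> R \<and> norm (hor ((f ^^ Suc k) x)) \<le> exp (\<epsilon> * (f ^^ k) x $ 3)}"

lemma slow_f: "x \<in> slow \<epsilon> R \<Longrightarrow> f x \<in> slow \<epsilon> R"
proof -
  assume x: "x \<in> slow \<epsilon> R"
  have eq: "(f ^^ k) (f x) = (f ^^ Suc k) x" for k by (simp add: funpow_swap1)
  have "f x \<in> J" using x J_fn[of x 1] by (simp add: slow_def)
  then show ?thesis using x unfolding slow_def mem_Collect_eq eq by blast
qed

definition slab :: "int \<times> int \<Rightarrow> nat \<Rightarrow> (real^3) set" where
  "slab r N = {x. in_beam r x \<and> real N \<le> x $ 3 \<and> x $ 3 < real N + 1}"

lemma in_slab: "x $ 3 \<ge> 0 \<Longrightarrow> x \<in> slab (beam_index x) (nat \<lfloor>x $ 3\<rfloor>)"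
  using floor_correct[of "x $ 3"] by (simp add: slab_def in_beam_index)

lemma slab_diam: "x \<in> slab r N \<Longrightarrow> y \<in> slab r N \<Longrightarrow> norm (x - y) \<le> 4"
  using norm_le_hor[of "x - y"] in_beam_hor[of r x y] by (auto simp: slab_def hor_diff)

lemma hcontent_slab:
  assumes "s > 0" shows "hcontent s (S \<inter> slab r N) \<le> ennreal (4 powr s)"
proof -
  have "bounded (slab r N)"
    using slab_diam[of _ r N] unfolding bounded_def dist_norm by blast
  then have b: "bounded (S \<inter> slab r N)" by (rule bounded_subset) auto
  have "diameter (S \<inter> slab r N) \<le> 4" using slab_diam[of _ r N] by (intro diameter_le) auto
  then have "diameter (S \<inter> slab r N) powr s \<le> 4 powr s"
    using assms diameter_ge_0[OF b] by (intro powr_mono2) auto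
  then show ?thesis using hcontent_bounded_le[OF b assms] ennreal_leI order_trans by blast
qed

text \<open>The cells that can meet the image of a slow point at height about \<open>N\<close>: the
  horizontal indices are limited to the order of \<open>exp (\<epsilon> * N)\<close>, the vertical
  one only to \<open>exp N\<close>. This single full factor is the origin of dimension 1.\<close>

definition slabs :: "real \<Rightarrow> nat \<Rightarrow> ((int \<times> int) \<times> nat) set" where
  "slabs \<epsilon> N = (let K = \<lceil>exp (\<epsilon> * (real N + 1))\<rceil> + 1 in ({-K..K} \<times> {-K..K}) \<times> {..nat \<lfloor>exp (real N + 1)\<rfloor>})"

lemma slabs_card:
  assumes "\<epsilon> \<ge> 0"
  shows "finite (slabs \<epsilon> N)" "real (card (slabs \<epsilon> N)) \<le> 98 * exp (2 * \<epsilon> * (real N + 1) + (real N + 1))"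
proof -
  let ?E = "exp (\<epsilon> * (real N + 1))" and ?G = "exp (real N + 1)"
  define K where "K = \<lceil>?E\<rceil> + 1"
  have E: "?E \<ge> 1" using assms by simp
  have G: "?G \<ge> 1" by simp
  have K: "real_of_int K \<le> ?E + 2" "K \<ge> 0"
    unfolding K_def using E by (linarith, smt (verit) ceiling_le_zero exp_gt_zero)
  show "finite (slabs \<epsilon> N)" by (simp add: slabs_def Let_def)
  have "card (slabs \<epsilon> N) = nat (2 * K + 1) * nat (2 * K + 1) * (nat \<lfloor>?G\<rfloor> + 1)"
    unfolding slabs_def Let_def K_def[symmetric] by (simp add: card_cartesian_product)
  then have "real (card (slabs \<epsilon> N)) = (2 * real_of_int K + 1) * (2 * real_of_int K + 1) * (real_of_int \<lfloor>?G\<rfloor> + 1)"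
    using K(2) G by (simp add: algebra_simps)
  also have "\<dots> \<le> (7 * ?E) * (7 * ?E) * (2 * ?G)"
  proof (intro mult_mono)
    show "2 * real_of_int K + 1 \<le> 7 * ?E" using K E by linarith
    show "2 * real_of_int K + 1 \<le> 7 * ?E" using K E by linarith
    show "real_of_int \<lfloor>?G\<rfloor> + 1 \<le> 2 * ?G" using G of_int_floor_le[of ?G] by linarith
    have "\<lfloor>?G\<rfloor> \<ge> 0" using G by simp
    then show "0 \<le> real_of_int \<lfloor>?G\<rfloor> + 1" by linarith
  qed (use K(2) in auto)
  also have "\<dots> = 98 * exp (2 * \<epsilon> * (real N + 1) + (real N + 1))"
    by (simp add: exp_add[symmetric] algebra_simps)
  finally show "real (card (slabs \<epsilon> N)) \<le> 98 * exp (2 * \<epsilon> * (real N + 1) + (real N + 1))" .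
qed

lemma slow_slab_subset:
  assumes \<epsilon>: "\<epsilon> \<ge> 0"
  shows "slow \<epsilon> R \<inter> slab r N \<subseteq>
    (\<Union>(q, n)\<in>slabs \<epsilon> N. \<Lambda> r ` (slow \<epsilon> R \<inter> slab q n \<inter> {y. exp N \<le> norm (up y)}))"
proof
  fix x assume x: "x \<in> slow \<epsilon> R \<inter> slab r N"
  define y where "y = f x"
  have xJ: "x \<in> J" using x by (simp add: slow_def)
  have y: "y \<in> slow \<epsilon> R" using slow_f x by (simp add: y_def)
  then have "real R \<le> (f ^^ 0) y $ 3" unfolding slow_def by blast
  then have y3: "y $ 3 \<ge> 0" by (simp add: order_trans[OF of_nat_0_le_iff])
  have beam: "in_beam r x" and xN: "real N \<le> x $ 3" "x $ 3 < real N + 1" using x by (auto simp: slab_def)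
  have eq: "\<Lambda> r y = x" using \<Lambda>_f(1)[OF beam] J_gt[OF xJ, of 1] by (simp add: y_def)
  have n: "norm (up y) = exp (x $ 3)" unfolding y_def by (simp only: exp_3)
  have h: "norm (hor y) \<le> exp (\<epsilon> * (real N + 1))"
  proof -
    have "norm (hor ((f ^^ Suc 0) x)) \<le> exp (\<epsilon> * (f ^^ 0) x $ 3)" using x unfolding slow_def by blast
    also have "\<dots> \<le> exp (\<epsilon> * (real N + 1))" using xN \<epsilon> by (simp add: mult_left_mono)
    finally show ?thesis by (simp add: y_def)
  qed
  have c: "\<bar>\<lfloor>(u + 1) / 2\<rfloor>\<bar> \<le> \<lceil>exp (\<epsilon> * (real N + 1))\<rceil> + 1" if "\<bar>u\<bar> \<le> exp (\<epsilon> * (real N + 1))" for u :: real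
  proof -
    have "\<bar>real_of_int \<lfloor>(u + 1) / 2\<rfloor>\<bar> \<le> \<bar>u\<bar> + 1"
      using floor_correct[of "(u + 1) / 2"] by (auto simp: abs_le_iff field_simps abs_if split: if_splits)
    also have "\<dots> \<le> real_of_int \<lceil>exp (\<epsilon> * (real N + 1))\<rceil> + 1" using that le_of_int_ceiling order_trans by fastforce
    finally show ?thesis by linarith
  qed
  have "\<bar>y $ 1\<bar> \<le> norm (hor y)" "\<bar>y $ 2\<bar> \<le> norm (hor y)"
    using component_le_norm_cart[of "hor y" 1] component_le_norm_cart[of "hor y" 2] by auto
  then have c12: "\<bar>\<lfloor>(y $ 1 + 1) / 2\<rfloor>\<bar> \<le> \<lceil>exp (\<epsilon> * (real N + 1))\<rceil> + 1"
    "\<bar>\<lfloor>(y $ 2 + 1) / 2\<rfloor>\<bar> \<le> \<lceil>exp (\<epsilon> * (real N + 1))\<rceil> + 1" using c h by force+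
  have "y $ 3 \<le> exp (real N + 1)"
  proof -
    have "y $ 3 \<le> norm (up y)" using norm_up_ge[of y] a_pos by linarith
    also have "\<dots> \<le> exp (real N + 1)" using xN by (simp add: n)
    finally show ?thesis .
  qed
  then have "nat \<lfloor>y $ 3\<rfloor> \<le> nat \<lfloor>exp (real N + 1)\<rfloor>" by (intro nat_mono floor_mono)
  then have "(beam_index y, nat \<lfloor>y $ 3\<rfloor>) \<in> slabs \<epsilon> N"
    using c12 by (auto simp: slabs_def Let_def beam_index_def abs_le_iff)
  moreover have "x \<in> \<Lambda> r ` (slow \<epsilon> R \<inter> slab (beam_index y) (nat \<lfloor>y $ 3\<rfloor>) \<inter> {y. exp N \<le> norm (up y)})"
    using eq y in_slab[OF y3] n xN by (intro image_eqI[of _ _ y]) auto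
  ultimately show "x \<in> (\<Union>(q, n)\<in>slabs \<epsilon> N. \<Lambda> r ` (slow \<epsilon> R \<inter> slab q n \<inter> {y. exp N \<le> norm (up y)}))"
    by (intro UN_I[of "(beam_index y, nat \<lfloor>y $ 3\<rfloor>)"]) auto
qed

lemma \<Lambda>_lipschitz_far:
  assumes "y $ 3 > M" "z $ 3 > M" "norm (up y) \<ge> \<rho>" "norm (up z) \<ge> \<rho>" "\<rho> > 0"
  shows "norm (\<Lambda> r y - \<Lambda> r z) \<le> (2 * L + 1) / \<rho> * norm (y - z)"
  using branch_lipschitz[of \<rho> "up y" "up z" r] assms up_pos(1)[of y] up_pos(1)[of z]
  by (simp add: \<Lambda>_def del: up_nth)

text \<open>The first factor counts the cells met by the image, the second is the s-th power of the
  contraction of the branch on points of norm at least \<open>exp N\<close>.\<close>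

lemma hcontent_slow_slab_le:
  assumes \<epsilon>: "\<epsilon> \<ge> 0" and s: "s > 0" and \<kappa>: "\<And>q n. hcontent s (slow \<epsilon> R \<inter> slab q n) \<le> \<kappa>"
  shows "hcontent s (slow \<epsilon> R \<inter> slab r N) \<le>
    ennreal (98 * exp (2 * \<epsilon> * (real N + 1) + (real N + 1)) * ((2 * L + 1) / exp N) powr s) * \<kappa>"
proof -
  let ?c = "(2 * L + 1) / exp (real N)"
  have c: "?c > 0" using L0 by (simp add: add_nonneg_pos)
  let ?Y = "\<lambda>q n. slow \<epsilon> R \<inter> slab q n \<inter> {y. exp N \<le> norm (up y)}"
  have "hcontent s (slow \<epsilon> R \<inter> slab r N) \<le> hcontent s (\<Union>z\<in>slabs \<epsilon> N. \<Lambda> r ` ?Y (fst z) (snd z))"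
    using slow_slab_subset[OF \<epsilon>, of R r N] by (intro hcontent_mono) (auto simp: case_prod_unfold)
  also have "\<dots> \<le> (\<Sum>z\<in>slabs \<epsilon> N. hcontent s (\<Lambda> r ` ?Y (fst z) (snd z)))"
    using slabs_card(1)[OF \<epsilon>] s by (rule hcontent_finite_UN_le)
  also have "\<dots> \<le> (\<Sum>z\<in>slabs \<epsilon> N. ennreal (?c powr s) * \<kappa>)"
  proof (rule sum_mono)
    fix z
    have "hcontent s (\<Lambda> r ` ?Y (fst z) (snd z)) \<le> ennreal (?c powr s) * hcontent s (?Y (fst z) (snd z))"
    proof (rule hcontent_lipschitz_image[OF s c])
      fix x y assume "x \<in> ?Y (fst z) (snd z)" "y \<in> ?Y (fst z) (snd z)"
      then show "dist (\<Lambda> r x) (\<Lambda> r y) \<le> ?c * dist x y"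
        unfolding dist_norm using J_gt[of _ 0] by (intro \<Lambda>_lipschitz_far) (auto simp: slow_def)
    qed
    also have "\<dots> \<le> ennreal (?c powr s) * \<kappa>"
      by (intro mult_left_mono order_trans[OF hcontent_mono \<kappa>[of "fst z" "snd z"]]) auto
    finally show "hcontent s (\<Lambda> r ` ?Y (fst z) (snd z)) \<le> ennreal (?c powr s) * \<kappa>" .
  qed
  also have "\<dots> = ennreal (real (card (slabs \<epsilon> N)) * ?c powr s) * \<kappa>"
    by (simp add: ennreal_mult ennreal_of_nat_eq_real_of_nat mult.assoc)
  also have "\<dots> \<le> ennreal (98 * exp (2 * \<epsilon> * (real N + 1) + (real N + 1)) * ?c powr s) * \<kappa>"
    using slabs_card(2)[OF \<epsilon>] by (intro mult_right_mono ennreal_leI) auto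
  finally show ?thesis .
qed

text \<open>For \<open>\<epsilon> = (s - 1) / 4\<close> the exponent
  \<open>(1 + 2 * \<epsilon> - s) * N\<close> equals \<open>- (s - 1) / 2 * N\<close>. The factor
  thus drops below 1/2 for \<open>N \<ge> R\<close>, and lower cells contain no slow points.\<close>

lemma hcontent_slow:
  assumes s: "s > 1" shows "\<exists>R. hcontent s (slow ((s - 1) / 4) R) = 0"
proof -
  define \<epsilon> where "\<epsilon> = (s - 1) / 4"
  have \<epsilon>: "\<epsilon> \<ge> 0" using s by (simp add: \<epsilon>_def)
  have C: "2 * L + 1 > 0" using L0 by linarith
  define k where "k = 98 * (2 * L + 1) powr s * exp ((s - 1) / 2 + 1)"
  have fac: "98 * exp (2 * \<epsilon> * (real N + 1) + (real N + 1)) * ((2 * L + 1) / exp N) powr s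
      = k * exp (- ((s - 1) / 2 * real N))" for N
  proof -
    have 1: "((2 * L + 1) / exp (real N)) powr s = (2 * L + 1) powr s * exp (- (s * real N))"
    proof -
      have 1: "((2 * L + 1) / exp (real N)) powr s = (2 * L + 1) powr s / exp (real N) powr s"
        by (rule powr_divide)
      also have "exp (real N) powr s = exp (s * real N)" by (simp add: powr_def)
      finally show ?thesis by (simp add: exp_minus divide_inverse)
    qed
    have "exp (2 * \<epsilon> * (real N + 1) + (real N + 1)) * exp (- (s * real N))
        = exp (2 * \<epsilon> * (real N + 1) + (real N + 1) + (- (s * real N)))" by (rule exp_add[symmetric])
    also have "2 * \<epsilon> * (real N + 1) + (real N + 1) + (- (s * real N))
        = ((s - 1) / 2 + 1) + (- ((s - 1) / 2 * real N))" by (simp add: \<epsilon>_def field_simps)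
    also have "exp \<dots> = exp ((s - 1) / 2 + 1) * exp (- ((s - 1) / 2 * real N))" by (rule exp_add)
    finally have 2: "exp (2 * \<epsilon> * (real N + 1) + (real N + 1)) * exp (- (s * real N))
        = exp ((s - 1) / 2 + 1) * exp (- ((s - 1) / 2 * real N))" .
    have "98 * exp (2 * \<epsilon> * (real N + 1) + (real N + 1)) * ((2 * L + 1) powr s * exp (- (s * real N)))
        = 98 * (2 * L + 1) powr s * (exp (2 * \<epsilon> * (real N + 1) + (real N + 1)) * exp (- (s * real N)))"
      by (simp only: mult_ac)
    then show ?thesis unfolding 1 2 k_def by (simp only: mult.assoc)
  qed
  have "(\<lambda>N. k * exp (- ((s - 1) / 2 * real N))) \<longlonglongrightarrow> 0"
  proof -
    have "filterlim (\<lambda>N. (s - 1) / 2 * real N) at_top sequentially"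
      by (rule filterlim_tendsto_pos_mult_at_top[OF tendsto_const _ filterlim_real_sequentially]) (use s in simp)
    then have "filterlim (\<lambda>N. - ((s - 1) / 2 * real N)) at_bot sequentially"
      by (simp only: filterlim_uminus_at_top)
    then have "(\<lambda>N. exp (- ((s - 1) / 2 * real N))) \<longlonglongrightarrow> 0"
      by (rule filterlim_compose[OF exp_at_bot])
    then show ?thesis by (rule tendsto_mult_right_zero)
  qed
  then have "\<forall>\<^sub>F N in sequentially. k * exp (- ((s - 1) / 2 * real N)) < 1/2"
    by (rule order_tendstoD(2)) simp
  then obtain R where R: "\<And>N. N \<ge> R \<Longrightarrow> k * exp (- ((s - 1) / 2 * real N)) < 1/2"
    unfolding eventually_sequentially by blast
  have s0: "s > 0" using s by simp
  define \<kappa> where "\<kappa> = (SUP z. hcontent s (slow \<epsilon> R \<inter> slab (fst z) (snd z)))"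
  have up\<kappa>: "hcontent s (slow \<epsilon> R \<inter> slab q n) \<le> \<kappa>" for q n
    unfolding \<kappa>_def by (rule SUP_upper2[of "(q, n)"]) auto
  have "\<kappa> \<le> ennreal (4 powr s)" unfolding \<kappa>_def by (intro SUP_least hcontent_slab s0)
  then have fin: "\<kappa> < \<infinity>" by (rule order_le_less_trans) simp
  have "(SUP z. hcontent s (slow \<epsilon> R \<inter> slab (fst z) (snd z))) \<le> ennreal (1/2) * \<kappa>"
  proof (rule SUP_least)
    fix z :: "(int \<times> int) \<times> nat"
    obtain r N where z: "z = (r, N)" by (cases z)
    show "hcontent s (slow \<epsilon> R \<inter> slab (fst z) (snd z)) \<le> ennreal (1/2) * \<kappa>"
    proof (cases "N \<ge> R")
      case True
      have "hcontent s (slow \<epsilon> R \<inter> slab r N) \<le> ennreal (k * exp (- ((s - 1) / 2 * real N))) * \<kappa>"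
        using hcontent_slow_slab_le[OF \<epsilon> s0 up\<kappa>, of r N] unfolding fac .
      also have "\<dots> \<le> ennreal (1/2) * \<kappa>"
        using R[OF True] by (intro mult_right_mono ennreal_leI) auto
      finally show ?thesis by (simp add: z)
    next
      case False
      have "slow \<epsilon> R \<inter> slab r N = {}"
      proof (rule ccontr)
        assume "slow \<epsilon> R \<inter> slab r N \<noteq> {}"
        then obtain x where x: "x \<in> slow \<epsilon> R" "x $ 3 < real N + 1" by (auto simp: slab_def)
        from x(1) have "real R \<le> (f ^^ 0) x $ 3" unfolding slow_def by blast
        then show False using x(2) False by simp
      qed
      then show ?thesis using s0 by (simp add: z)
    qed
  qed
  then have "\<kappa> \<le> ennreal (1/2) * \<kappa>" unfolding \<kappa>_def[symmetric] .
  then have \<kappa>0: "\<kappa> = 0" by (rule ennreal_contraction_0) (use fin in auto)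
  have "slow \<epsilon> R \<subseteq> (\<Union>z\<in>UNIV. slow \<epsilon> R \<inter> slab (fst z) (snd z))"
  proof
    fix x assume x: "x \<in> slow \<epsilon> R"
    then have "real R \<le> (f ^^ 0) x $ 3" unfolding slow_def by blast
    then have "x $ 3 \<ge> 0" by (simp add: order_trans[OF of_nat_0_le_iff])
    then have "x \<in> slow \<epsilon> R \<inter> slab (beam_index x) (nat \<lfloor>x $ 3\<rfloor>)" using x in_slab by blast
    then show "x \<in> (\<Union>z\<in>UNIV. slow \<epsilon> R \<inter> slab (fst z) (snd z))"
      by (intro UN_I[of "(beam_index x, nat \<lfloor>x $ 3\<rfloor>)"]) auto
  qed
  moreover have "hcontent s (\<Union>z\<in>UNIV. slow \<epsilon> R \<inter> slab (fst z) (snd z)) = 0"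
  proof (rule hcontent_countable_UN_0[OF _ _ s0])
    fix z show "hcontent s (slow \<epsilon> R \<inter> slab (fst z) (snd z)) = 0"
      using up\<kappa>[of "fst z" "snd z"] \<kappa>0 by simp
  qed simp
  ultimately have "hcontent s (slow \<epsilon> R) = 0" by (rule hcontent_0_subset)
  then show ?thesis unfolding \<epsilon>_def by blast
qed

text \<open>There are countably many inverse branches, and those with even index sum are Lipschitz
  above height \<open>M\<close>.\<close>

lemma hcontent_preimage:
  assumes "hcontent s X = 0" "s > 0" "X \<subseteq> J"
  shows "hcontent s {x\<in>J. (f ^^ K) x \<in> X} = 0"
proof (induction K)
  case 0
  show ?case using assms hcontent_mono[of "{x\<in>J. x \<in> X}" X s] by auto
next
  case (Suc K)
  let ?Z = "{x\<in>J. (f ^^ K) x \<in> X}"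
  have "{x\<in>J. (f ^^ Suc K) x \<in> X} \<subseteq> (\<Union>r\<in>{r. even (fst r + snd r)}. \<Lambda> r ` ?Z)"
  proof
    fix x assume x: "x \<in> {x\<in>J. (f ^^ Suc K) x \<in> X}"
    have fx: "f x \<in> ?Z" using x J_fn[of x 1] by (simp add: funpow_swap1)
    have gt: "f x $ 3 > M" using J_gt[of x 1] x by simp
    note * = \<Lambda>_f[OF in_beam_index gt]
    show "x \<in> (\<Union>r\<in>{r. even (fst r + snd r)}. \<Lambda> r ` ?Z)"
      using fx *(1)[symmetric] *(2) by blast
  qed
  moreover have "hcontent s (\<Union>r\<in>{r. even (fst r + snd r)}. \<Lambda> r ` ?Z) = 0"
  proof (rule hcontent_countable_UN_0[OF _ _ assms(2)])
    fix r :: "int \<times> int" assume "r \<in> {r. even (fst r + snd r)}"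
    then show "hcontent s (\<Lambda> r ` ?Z) = 0"
      using \<Lambda>_lipschitz[of r] J_gt[of _ 0]
      by (intro hcontent_lipschitz_image_0[OF Suc assms(2), where c = \<alpha>]) (auto simp: dist_norm)
  qed (rule countable_subset[OF subset_UNIV], simp)
  ultimately show ?case by (rule hcontent_0_subset)
qed

text \<open>The horizontal part of the orbit of \<open>x\<close> is within 3 of that of
  \<open>z\<close>, which is at most \<open>exp\<close> of the previous height of \<open>z\<close>.
  A large constant gap \<open>D\<close> makes that height a small fraction of the height of
  \<open>x\<close> one step later.\<close>

lemma eventually_slow:
  assumes x: "x \<in> track s" and z: "z \<in> track s" and less: "height z < height x" and \<epsilon>: "\<epsilon> > 0"
  shows "\<exists>K. (f ^^ K) x \<in> slow \<epsilon> R"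
proof -
  \<comment> \<open>In this order the entries allow the growth estimate, make
    \<open>2 * exp (- D)\<close> at most \<open>\<epsilon> / 2\<close>, lift the orbit above
    \<open>R\<close>, and absorb the additive 3 of the horizontal comparison.\<close>
  define D where "D = Max {4, ln (4 / \<epsilon>), R - M, 2 / \<epsilon> * ln 3 - M}"
  have D: "D \<ge> 4" "D \<ge> ln (4 / \<epsilon>)" "D \<ge> R - M" "D \<ge> 2 / \<epsilon> * ln 3 - M" by (simp_all add: D_def)
  obtain K where K: "\<And>k. k \<ge> K \<Longrightarrow> (f ^^ k) z $ 3 + D \<le> (f ^^ k) x $ 3"
    using height_gap[OF z x less, of D] unfolding eventually_sequentially by blast
  have xJ: "x \<in> J" and zJ: "z \<in> J" using x z track_J by blast+
  have e: "16 * exp (- D) \<le> 1/2" by (rule exp_minus_d[OF D(1)])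
  have e2: "2 * exp (- D) \<le> \<epsilon> / 2"
  proof -
    have "exp (- D) \<le> exp (- ln (4 / \<epsilon>))" using D(2) by simp
    also have "\<dots> = \<epsilon> / 4" using \<epsilon> by (simp add: exp_minus)
    finally show ?thesis by simp
  qed
  have big: "(f ^^ k) x $ 3 \<ge> R" "(f ^^ k) x $ 3 \<ge> 2 / \<epsilon> * ln 3" if "k \<ge> K" for k
    using K[OF that] J_gt[OF zJ, of k] D by linarith+
  \<comment> \<open>The ratio of heights is read off from the gap one step earlier, hence
    \<open>Suc K\<close>.\<close>
  have small: "(f ^^ k) z $ 3 \<le> \<epsilon> / 2 * (f ^^ k) x $ 3" if k: "k \<ge> Suc K" for k
  proof -
    obtain j where j: "k = Suc j" "j \<ge> K" using k by (cases k) auto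
    let ?P = "(f ^^ j) z" and ?Q = "(f ^^ j) x"
    let ?q = "exp (?Q $ 3)"
    have fP: "f ?P = (f ^^ k) z" and fQ: "f ?Q = (f ^^ k) x" by (simp_all add: j)
    have "f ?Q $ 3 + a \<ge> ?q * (1 - 4 * exp (- D))"
      using K[OF j(2)] D(1) J_gt[OF zJ, of k] J_gt[OF xJ, of k] track_hor[OF z x, of k]
      by (intro growth_step) (auto simp: fP fQ)
    also have "?q * (1 - 4 * exp (- D)) \<ge> ?q * (1/2)" using e by (intro mult_left_mono) auto
    finally have Q: "?q \<le> 2 * (f ?Q $ 3 + a)" by simp
    have "f ?P $ 3 + a \<le> exp (?P $ 3)" unfolding exp_3 by (rule norm_up_ge)
    also have "\<dots> \<le> exp (?Q $ 3 - D)" using K[OF j(2)] by simp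
    also have "\<dots> = ?q * exp (- D)" by (simp add: exp_diff exp_minus divide_inverse)
    also have "\<dots> \<le> 2 * (f ?Q $ 3 + a) * exp (- D)" using Q by (intro mult_right_mono) auto
    finally have "f ?P $ 3 + a \<le> 2 * exp (- D) * (f ?Q $ 3) + 2 * exp (- D) * a" by (simp add: algebra_simps)
    moreover have "2 * exp (- D) * a \<le> 1 * a" using e a_pos by (intro mult_right_mono) auto
    moreover have "2 * exp (- D) * (f ?Q $ 3) \<le> \<epsilon> / 2 * (f ?Q $ 3)"
      using e2 big(1)[of k] k by (intro mult_right_mono) (auto simp: fQ intro: order_trans[OF of_nat_0_le_iff])
    ultimately show ?thesis by (simp add: fP fQ)
  qed
  have hor: "norm (hor ((f ^^ Suc k) x)) \<le> exp (\<epsilon> * (f ^^ k) x $ 3)" if k: "k \<ge> Suc K" for k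
  proof -
    let ?w = "(f ^^ k) x $ 3"
    have "norm (hor ((f ^^ Suc k) x)) \<le> norm (hor ((f ^^ Suc k) z)) + 3"
      using track_hor[OF x z, of "Suc k"] norm_triangle_ineq2[of "hor ((f ^^ Suc k) x)" "hor ((f ^^ Suc k) z)"] by linarith
    also have "norm (hor ((f ^^ Suc k) z)) \<le> exp ((f ^^ k) z $ 3)"
      using norm_hor_le[of "up (f ((f ^^ k) z))"] by (simp only: hor_up exp_3 funpow.simps comp_apply)
    also have "\<dots> \<le> exp (\<epsilon> / 2 * ?w)" using small[OF k] by simp
    finally have 1: "norm (hor ((f ^^ Suc k) x)) \<le> exp (\<epsilon> / 2 * ?w) + 3" by simp
    have "ln 3 \<le> \<epsilon> / 2 * ?w" using big(2)[of k] k \<epsilon> by (simp add: field_simps)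
    then have u: "exp (\<epsilon> / 2 * ?w) \<ge> 3" by (metis exp_le_cancel_iff exp_ln zero_less_numeral)
    have "exp (\<epsilon> / 2 * ?w) + 3 \<le> 3 * exp (\<epsilon> / 2 * ?w)" using u by linarith
    also have "\<dots> \<le> exp (\<epsilon> / 2 * ?w) * exp (\<epsilon> / 2 * ?w)" using u by (intro mult_right_mono) auto
    also have "\<dots> = exp (\<epsilon> * ?w)" by (simp add: exp_add[symmetric])
    finally show ?thesis using 1 by linarith
  qed
  have "(f ^^ Suc K) x \<in> slow \<epsilon> R"
  proof -
    have eq: "(f ^^ k) ((f ^^ Suc K) x) = (f ^^ (k + Suc K)) x" for k by (simp only: funpow_add comp_apply)
    have "real R \<le> (f ^^ (k + Suc K)) x $ 3 \<and>
        norm (hor ((f ^^ Suc (k + Suc K)) x)) \<le> exp (\<epsilon> * (f ^^ (k + Suc K)) x $ 3)" for k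
      using big(1)[of "k + Suc K"] hor[of "k + Suc K"] by (simp del: funpow.simps)
    then show ?thesis using J_fn[OF xJ, of "Suc K"] unfolding slow_def mem_Collect_eq eq add_Suc by blast
  qed
  then show ?thesis by blast
qed

lemma hcontent_above_endpoints:
  assumes "s > 1"
  shows "hcontent s {x. \<exists>t z. x \<in> track t \<and> z \<in> track t \<and> height z < height x} = 0"
proof -
  obtain R where R: "hcontent s (slow ((s - 1) / 4) R) = 0" using hcontent_slow[OF assms] by blast
  have "{x. \<exists>t z. x \<in> track t \<and> z \<in> track t \<and> height z < height x}
      \<subseteq> (\<Union>K\<in>UNIV. {x\<in>J. (f ^^ K) x \<in> slow ((s - 1) / 4) R})"
  proof
    fix x assume "x \<in> {x. \<exists>t z. x \<in> track t \<and> z \<in> track t \<and> height z < height x}"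
    then obtain t z where *: "x \<in> track t" "z \<in> track t" "height z < height x" by blast
    have "(s - 1) / 4 > 0" using assms by simp
    then obtain K where "(f ^^ K) x \<in> slow ((s - 1) / 4) R" using eventually_slow[OF *] by blast
    then show "x \<in> (\<Union>K\<in>UNIV. {x\<in>J. (f ^^ K) x \<in> slow ((s - 1) / 4) R})" using track_J[OF *(1)] by blast
  qed
  moreover have "hcontent s (\<Union>K\<in>UNIV. {x\<in>J. (f ^^ K) x \<in> slow ((s - 1) / 4) R}) = 0"
    using R assms by (intro hcontent_countable_UN_0 hcontent_preimage) (auto simp: slow_def)
  ultimately show ?thesis by (rule hcontent_0_subset)
qed

end

section \<open>Dimension of the set of endpoints\<close>

lemma card_nat_le_diameter:
  fixes Z :: "nat set"
  assumes "\<And>i j. i \<in> Z \<Longrightarrow> j \<in> Z \<Longrightarrow> real i - real j \<le> D" "D \<ge> 0"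
  shows "finite Z" "real (card Z) \<le> D + 1"
proof -
  have "finite Z \<and> real (card Z) \<le> D + 1"
  proof (cases "Z = {}")
    case False
    define m where "m = (LEAST i. i \<in> Z)"
    have m: "m \<in> Z" "\<And>i. i \<in> Z \<Longrightarrow> m \<le> i"
      using False unfolding m_def by (auto intro: LeastI Least_le)
    have sub: "Z \<subseteq> {m..m + nat \<lfloor>D\<rfloor>}"
    proof
      fix i assume i: "i \<in> Z"
      have "real (i - m) \<le> D" using assms(1)[OF i m(1)] m(2)[OF i] by simp
      then have "i - m \<le> nat \<lfloor>D\<rfloor>" by (simp add: le_nat_floor)
      then show "i \<in> {m..m + nat \<lfloor>D\<rfloor>}" using m(2)[OF i] by auto
    qed
    then have "card Z \<le> nat \<lfloor>D\<rfloor> + 1" using card_mono[OF _ sub] by simp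
    then have "real (card Z) \<le> real (nat \<lfloor>D\<rfloor>) + 1" by linarith
    also have "real (nat \<lfloor>D\<rfloor>) \<le> D" using assms(2) by simp
    finally show ?thesis using finite_subset[OF sub] by simp
  qed (use assms(2) in auto)
  then show "finite Z" "real (card Z) \<le> D + 1" by blast+
qed

lemma cube_volume_le:
  fixes U :: "(real^3) set"
  assumes "bounded U" shows "\<exists>c. U \<subseteq> cbox (c - vec (diameter U)) (c + vec (diameter U))"
proof (cases "U = {}")
  case False
  then obtain c where c: "c \<in> U" by blast
  have "x \<in> cbox (c - vec (diameter U)) (c + vec (diameter U))" if "x \<in> U" for x
  proof -
    have "norm (x - c) \<le> diameter U" using diameter_bounded_bound[OF assms that c] by (simp add: dist_norm)
    then have "\<bar>x $ i - c $ i\<bar> \<le> diameter U" for i using component_le_norm_cart[of "x - c" i] by simp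
    then show ?thesis by (simp add: mem_box_cart abs_le_iff) (smt (verit))
  qed
  then show ?thesis by blast
qed simp

lemma emeasure_cbox_real3:
  fixes p q :: "real^3"
  assumes "p $ 1 \<le> q $ 1" "p $ 2 \<le> q $ 2" "p $ 3 \<le> q $ 3"
  shows "emeasure lborel (cbox p q) = ennreal ((q $ 1 - p $ 1) * (q $ 2 - p $ 2) * (q $ 3 - p $ 3))"
proof -
  have "p \<in> cbox p q" using assms by (simp add: mem_box_cart forall_3)
  then have "measure lborel (cbox p q) = (\<Prod>i\<in>UNIV. q $ i - p $ i)" by (intro content_cbox_cart) blast
  also have "\<dots> = (q $ 1 - p $ 1) * (q $ 2 - p $ 2) * (q $ 3 - p $ 3)" unfolding UNIV_3 by simp
  finally have "measure lborel (cbox p q) = (q $ 1 - p $ 1) * (q $ 2 - p $ 2) * (q $ 3 - p $ 3)" .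
  moreover have "emeasure lborel (cbox p q) = ennreal (measure lborel (cbox p q))"
    by (intro emeasure_eq_ennreal_measure less_imp_neq emeasure_lborel_cbox_finite[unfolded infinity_ennreal_def])
  ultimately show ?thesis by simp
qed

section \<open>A tree of boxes\<close>

type_synonym node = "nat \<times> nat \<times> nat"

text \<open>A positive proportion of all boxes suffices. Both beam indices are even, so every beam
  that occurs maps to the upper half-space, and beams with different indices are disjoint.\<close>

definition node_box :: "node \<Rightarrow> (real^3) set" where
  "node_box = (\<lambda>(i, j, l). {x. \<bar>x $ 1 - 4 * real i\<bar> \<le> 1 \<and> \<bar>x $ 2 - 4 * real j\<bar> \<le> 1 \<and> real l \<le> x $ 3 \<and> x $ 3 \<le> real l + 1})"

definition node_beam :: "node \<Rightarrow> int \<times> int" where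
  "node_beam = (\<lambda>(i, j, l). (2 * int i, 2 * int j))"

abbreviation level :: "node \<Rightarrow> nat" where "level b \<equiv> snd (snd b)"

abbreviation reach :: "node \<Rightarrow> real" where "reach b \<equiv> exp (real (level b))"

text \<open>These boxes lie inside the image of the node box: after \<open>up\<close>, their points
  have norm between \<open>reach b\<close> and \<open>exp 1 * reach b\<close>. Index ranges of
  length \<open>reach b / 20\<close> keep the horizontal coordinates below
  \<open>reach b / 5\<close>.\<close>

definition children :: "node \<Rightarrow> node set" where
  "children b = (let n = nat \<lfloor>reach b / 20\<rfloor>; l = nat \<lceil>reach b\<rceil>
     in {..<n} \<times> {..<n} \<times> {l..<l + n})"

lemma node_box_beam: "x \<in> node_box b \<Longrightarrow> in_beam (node_beam b) x"
  by (auto simp: node_box_def node_beam_def in_beam_def case_prod_unfold)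

lemma node_box_3: "x \<in> node_box b \<Longrightarrow> real (level b) \<le> x $ 3 \<and> x $ 3 \<le> real (level b) + 1"
  by (auto simp: node_box_def case_prod_unfold)

lemma node_box_cbox: "node_box (i, j, l) =
    cbox (vector [4 * real i - 1, 4 * real j - 1, real l]) (vector [4 * real i + 1, 4 * real j + 1, real l + 1])"
  by (auto simp: node_box_def mem_box_cart forall_3 abs_le_iff)

lemma node_box_volume: "emeasure lborel (node_box b) = 4"
proof -
  obtain i j l where b: "b = (i, j, l)" by (cases b)
  show ?thesis
    unfolding b node_box_cbox by (subst emeasure_cbox_real3) simp_all
qed

lemma node_box_compact: "compact (node_box b)"
  by (cases b) (simp add: node_box_cbox compact_cbox)

lemma finite_children: "finite (children b)" by (simp add: children_def Let_def)

text \<open>Rounding \<open>reach b / 20\<close> down costs at most a factor 2 here.\<close>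

lemma card_children:
  assumes "reach b \<ge> 40"
  shows "real (card (children b)) \<ge> (reach b / 40) ^ 3"
proof -
  let ?e = "reach b"
  have "card (children b) = nat \<lfloor>?e / 20\<rfloor> ^ 3"
    by (simp add: children_def Let_def card_cartesian_product power3_eq_cube)
  moreover have "?e / 40 \<le> real (nat \<lfloor>?e / 20\<rfloor>)"
  proof -
    have "?e / 20 - 1 < real_of_int \<lfloor>?e / 20\<rfloor>" "\<lfloor>?e / 20\<rfloor> \<ge> 0" by (linarith, simp)
    moreover have "real (nat \<lfloor>?e / 20\<rfloor>) = real_of_int \<lfloor>?e / 20\<rfloor>" by simp
    ultimately show ?thesis using assms by linarith
  qed
  then have "(?e / 40) ^ 3 \<le> real (nat \<lfloor>?e / 20\<rfloor>) ^ 3" by (intro power_mono) auto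
  ultimately show ?thesis by simp
qed

lemma child_level: "c \<in> children b \<Longrightarrow> level c \<ge> level b"
proof -
  assume "c \<in> children b"
  then have "nat \<lceil>reach b\<rceil> \<le> level c" by (auto simp: children_def Let_def)
  moreover have "real (level b) \<le> reach b"
    using exp_ge_add_one_self[of "real (level b)"] by linarith
  then have "level b \<le> nat \<lceil>reach b\<rceil>"
    by (metis le_of_int_ceiling of_nat_le_iff order_trans of_nat_nat ceiling_le_zero linorder_not_le nat_le_0 exp_gt_zero of_nat_ceiling)
  ultimately show ?thesis by linarith
qed

lemma card_hit_le:
  assumes V: "bounded V"
  shows "finite {c. V \<inter> node_box c \<noteq> {}}" "real (card {c. V \<inter> node_box c \<noteq> {}}) \<le> (diameter V + 4) ^ 3"
proof -
  let ?d = "diameter V"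
  have d: "?d \<ge> 0" using V by (rule diameter_ge_0)
  define Z1 where "Z1 = {i::nat. \<exists>x\<in>V. \<bar>x $ 1 - 4 * real i\<bar> \<le> 1}"
  define Z2 where "Z2 = {i::nat. \<exists>x\<in>V. \<bar>x $ 2 - 4 * real i\<bar> \<le> 1}"
  define Z3 where "Z3 = {l::nat. \<exists>x\<in>V. real l \<le> x $ 3 \<and> x $ 3 \<le> real l + 1}"
  have comp: "x $ i - y $ i \<le> ?d" if "x \<in> V" "y \<in> V" for x y i
    using diameter_bounded_bound[OF V that] component_le_norm_cart[of "x - y" i] by (simp add: dist_norm)
  have 1: "real i - real j \<le> ?d + 2" if "i \<in> Z1" "j \<in> Z1" for i j
    using that comp[of _ _ 1] d unfolding Z1_def by clarsimp (smt (verit))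
  have 2: "real i - real j \<le> ?d + 2" if "i \<in> Z2" "j \<in> Z2" for i j
    using that comp[of _ _ 2] d unfolding Z2_def by clarsimp (smt (verit))
  have 3: "real i - real j \<le> ?d + 2" if "i \<in> Z3" "j \<in> Z3" for i j
    using that comp[of _ _ 3] d unfolding Z3_def by clarsimp (smt (verit))
  have d2: "?d + 2 \<ge> 0" using d by simp
  note f1 = card_nat_le_diameter[of Z1 "?d + 2", OF 1 d2] and f2 = card_nat_le_diameter[of Z2 "?d + 2", OF 2 d2]
    and f3 = card_nat_le_diameter[of Z3 "?d + 2", OF 3 d2]
  have sub: "{c. V \<inter> node_box c \<noteq> {}} \<subseteq> Z1 \<times> Z2 \<times> Z3"
    by (auto simp: node_box_def Z1_def Z2_def Z3_def)
  have fin: "finite (Z1 \<times> Z2 \<times> Z3)" using f1(1) f2(1) f3(1) by simp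
  show "finite {c. V \<inter> node_box c \<noteq> {}}" using finite_subset[OF sub fin] .
  have "real (card {c. V \<inter> node_box c \<noteq> {}}) \<le> real (card (Z1 \<times> Z2 \<times> Z3))"
    using card_mono[OF fin sub] by simp
  also have "\<dots> = real (card Z1) * (real (card Z2) * real (card Z3))" by (simp add: card_cartesian_product)
  also have "\<dots> \<le> (?d + 4) * ((?d + 4) * (?d + 4))"
    using f1(2) f2(2) f3(2) d by (intro mult_mono) auto
  finally show "real (card {c. V \<inter> node_box c \<noteq> {}}) \<le> (?d + 4) ^ 3" by (simp add: power3_eq_cube mult.assoc)
qed

context zorich_system
begin

text \<open>Compact approximations from outside: a point in all \<open>approx n b\<close> has its
  whole orbit at heights at least \<open>level b\<close>, so it belongs to \<open>J\<close> if the
  level exceeds \<open>M\<close>.\<close>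

fun approx :: "nat \<Rightarrow> node \<Rightarrow> (real^3) set" where
  "approx 0 b = node_box b"
| "approx (Suc n) b = {x \<in> node_box b. \<exists>c\<in>children b. f x \<in> approx n c}"

lemma approx_box: "approx n b \<subseteq> node_box b"
  by (cases n) auto

lemma approx_compact: "compact (approx n b)"
proof (induction n arbitrary: b)
  case (Suc n)
  have eq: "approx (Suc n) b = node_box b \<inter> f -` (\<Union>c\<in>children b. approx n c)" by auto
  have "closed (\<Union>c\<in>children b. approx n c)"
    using Suc finite_children by (intro closed_UN) (auto intro: compact_imp_closed)
  then have "closed (f -` (\<Union>c\<in>children b. approx n c))" using closed_vimage[OF _ continuous_f] by blast
  then show ?case unfolding eq by (intro compact_Int_closed node_box_compact)
qed (simp add: node_box_compact)

lemma approx_decreasing: "approx (Suc n) b \<subseteq> approx n b"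
proof (induction n arbitrary: b)
  case (Suc n)
  then show ?case by (simp only: approx.simps) blast
qed auto

lemma approx_level: "x \<in> approx n b \<Longrightarrow> k \<le> n \<Longrightarrow> (f ^^ k) x $ 3 \<ge> real (level b)"
proof (induction n arbitrary: x b k)
  case (Suc n)
  then obtain c where c: "x \<in> node_box b" "c \<in> children b" "f x \<in> approx n c" by auto
  show ?case
  proof (cases k)
    case 0
    then show ?thesis using node_box_3[OF c(1)] by simp
  next
    case (Suc j)
    have "(f ^^ j) (f x) $ 3 \<ge> real (level c)" using Suc.IH[OF c(3), of j] Suc Suc.prems by simp
    then show ?thesis using child_level[OF c(2)] by (simp add: Suc funpow_swap1)
  qed
qed (use node_box_3 in auto)

lemma child_in_range:
  assumes c: "c \<in> children b" and y: "y \<in> node_box c" and b: "reach b \<ge> 4 * (a + 1)"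
    and M: "real (level b) \<ge> M"
  shows "y $ 3 > M" "reach b \<le> norm (up y)" "norm (up y) \<le> exp (real (level b) + 1)"
proof -
  let ?e = "reach b" and ?n = "nat \<lfloor>reach b / 20\<rfloor>" and ?l = "nat \<lceil>reach b\<rceil>"
  have n: "real ?n \<le> ?e / 20" using of_int_floor_le[of "?e / 20"] by simp
  have l: "?e \<le> real ?l" "real ?l \<le> ?e + 1"
  proof -
    have "real ?l = real_of_int \<lceil>?e\<rceil>" by simp
    then show "?e \<le> real ?l" "real ?l \<le> ?e + 1" using ceiling_correct[of ?e] by linarith+
  qed
  obtain i j k where cc: "c = (i, j, k)" by (cases c)
  have ijk: "i < ?n" "j < ?n" "?l \<le> k" "k < ?l + ?n" using c by (auto simp: children_def cc Let_def)
  have ij: "real i + 1 \<le> ?e / 20" "real j + 1 \<le> ?e / 20" using ijk n by linarith+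
  have k: "?e \<le> real k" "real k + 1 \<le> ?e + 1 + ?e / 20" using ijk n l by linarith+
  have y': "\<bar>y $ 1\<bar> \<le> ?e / 5" "\<bar>y $ 2\<bar> \<le> ?e / 5" "?e \<le> y $ 3" "y $ 3 \<le> ?e + 1 + ?e / 20"
    using y ij k by (auto simp: node_box_def cc)
  have "a \<ge> 1" by (rule a_pos)
  then show 1: "?e \<le> norm (up y)" using norm_up_ge[of y] y' by linarith
  have "norm (up y) \<le> \<bar>y $ 1\<bar> + \<bar>y $ 2\<bar> + \<bar>y $ 3 + a\<bar>" using norm_real3_le[of "up y"] by simp
  also have "\<bar>y $ 3 + a\<bar> = y $ 3 + a" using y'(3) \<open>a \<ge> 1\<close> exp_gt_zero[of "real (level b)"] by linarith
  \<comment> \<open>The multiples of \<open>?e\<close> are 1/5, 1/5 and 1 + 1/20, and the remaining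
    \<open>a + 1\<close> is at most \<open>?e / 4\<close>.\<close>
  also have "\<bar>y $ 1\<bar> + \<bar>y $ 2\<bar> + (y $ 3 + a) \<le> 2 * ?e" using y' b by argo
  also have "\<dots> \<le> exp 1 * ?e" using exp_ge_add_one_self[of 1] by (intro mult_right_mono) auto
  finally show "norm (up y) \<le> exp (real (level b) + 1)" by (simp add: exp_add mult.commute)
  show "y $ 3 > M" using y'(3) M exp_ge_add_one_self[of "real (level b)"] by linarith
qed

lemma child_lift:
  assumes c: "c \<in> children b" and y: "y \<in> approx n c" and b: "reach b \<ge> 4 * (a + 1)"
    and M: "real (level b) \<ge> M"
  obtains x where "x \<in> approx (Suc n) b" "f x = y"
proof
  let ?r = "node_beam b" and ?x = "\<Lambda> (node_beam b) y"
  have yb: "y \<in> node_box c" using y approx_box by blast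
  note range = child_in_range[OF c yb b M]
  have ev: "even (fst ?r + snd ?r)" by (simp add: node_beam_def case_prod_unfold)
  show fx: "f ?x = y" using f_\<Lambda>[OF ev range(1)] .
  have pos: "norm (up y) > 0" using range(2) exp_gt_zero[of "real (level b)"] by linarith
  have "ln (reach b) \<le> ln (norm (up y))" "ln (norm (up y)) \<le> ln (exp (real (level b) + 1))"
    using range(2,3) pos by (intro ln_mono; simp)+
  then have "real (level b) \<le> ?x $ 3" "?x $ 3 \<le> real (level b) + 1" by (simp_all add: \<Lambda>_3)
  then have "?x \<in> node_box b"
    using \<Lambda>_beam[OF range(1), of ?r] by (auto simp: node_box_def node_beam_def in_beam_def case_prod_unfold)
  then show "?x \<in> approx (Suc n) b" using c y fx by auto
qed

lemma f_lipschitz_box: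
  assumes "x \<in> node_box b" "y \<in> node_box b"
  shows "dist (f x) (f y) \<le> exp (real (level b) + 1) * (1 + L) * dist x y"
proof -
  have "f x - f y = F x - F y" by (simp add: zorich_shift_def)
  then show ?thesis
    unfolding dist_norm using F_lipschitz_beam[OF node_box_beam[OF assms(1)] node_box_beam[OF assms(2)]]
      node_box_3[OF assms(1)] node_box_3[OF assms(2)] by simp
qed

text \<open>Comparison of volumes: a set of diameter d lies in a cube of volume
  \<open>8 * d ^ 3\<close>, the box has volume 4, and \<open>d ^ 3 \<le> d powr s\<close> for d at
  most 1.\<close>

lemma box_content_ge:
  assumes I: "finite I" and U: "\<And>i. i \<in> I \<Longrightarrow> bounded (U i)" and cov: "node_box b \<subseteq> (\<Union>i\<in>I. U i)"
    and s: "0 < s" "s \<le> 3"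
  shows "(\<Sum>i\<in>I. diameter (U i) powr s) \<ge> 1/2"
proof (cases "\<exists>i\<in>I. diameter (U i) \<ge> 1")
  case True
  then obtain i where i: "i \<in> I" "diameter (U i) \<ge> 1" by blast
  have "1 \<le> diameter (U i) powr s" using i s by (intro ge_one_powr_ge_zero) auto
  also have "\<dots> \<le> (\<Sum>i\<in>I. diameter (U i) powr s)" using I i by (intro member_le_sum) auto
  finally show ?thesis by simp
next
  case False
  have "\<exists>c. U i \<subseteq> cbox (c - vec (diameter (U i))) (c + vec (diameter (U i)))" if "i \<in> I" for i
    using cube_volume_le[OF U[OF that]] .
  then obtain c where c: "\<And>i. i \<in> I \<Longrightarrow> U i \<subseteq> cbox (c i - vec (diameter (U i))) (c i + vec (diameter (U i)))"
    by metis
  let ?Q = "\<lambda>i. cbox (c i - vec (diameter (U i))) (c i + vec (diameter (U i))) :: (real^3) set"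
  have Q: "emeasure lborel (?Q i) = ennreal (8 * diameter (U i) ^ 3)" if "i \<in> I" for i
  proof -
    have d: "diameter (U i) \<ge> 0" using U[OF that] by (rule diameter_ge_0)
    then show ?thesis by (subst emeasure_cbox_real3) (simp_all add: power3_eq_cube)
  qed
  have "4 = emeasure lborel (node_box b)" by (simp add: node_box_volume)
  also have "\<dots> \<le> emeasure lborel (\<Union>i\<in>I. ?Q i)"
    using I by (intro emeasure_mono order_trans[OF cov] UN_mono c) auto
  also have "\<dots> \<le> (\<Sum>i\<in>I. emeasure lborel (?Q i))"
    using I by (intro emeasure_subadditive_finite) auto
  also have "\<dots> = (\<Sum>i\<in>I. ennreal (8 * diameter (U i) ^ 3))" using Q by (intro sum.cong) auto
  also have "\<dots> = ennreal (\<Sum>i\<in>I. 8 * diameter (U i) ^ 3)"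
    using U by (intro sum_ennreal) (auto intro: diameter_ge_0)
  finally have "ennreal 4 \<le> ennreal (\<Sum>i\<in>I. 8 * diameter (U i) ^ 3)" by simp
  then have "4 \<le> (\<Sum>i\<in>I. 8 * diameter (U i) ^ 3)"
    using U by (subst (asm) ennreal_le_iff) (auto intro!: sum_nonneg mult_nonneg_nonneg zero_le_power diameter_ge_0)
  also have "\<dots> \<le> (\<Sum>i\<in>I. 8 * diameter (U i) powr s)"
  proof (intro sum_mono mult_left_mono)
    fix i assume i: "i \<in> I"
    have d: "diameter (U i) \<ge> 0" "diameter (U i) \<le> 1" using U[OF i] False i by (auto intro: diameter_ge_0 less_imp_le simp: not_le)
    show "diameter (U i) ^ 3 \<le> diameter (U i) powr s"
    proof (cases "diameter (U i) = 0")
      case False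
      then have "diameter (U i) ^ 3 = diameter (U i) powr 3" using d by simp
      also have "\<dots> \<le> diameter (U i) powr s" using d s by (intro powr_mono') auto
      finally show ?thesis .
    qed simp
  qed simp
  finally show ?thesis by (simp add: sum_distrib_left[symmetric])
qed

text \<open>Push a cover of an approximation forward by \<open>f\<close>. A child that meets no image of diameter at
  least 1 is covered by small images, each of which meets boundedly many children; comparing with the
  number of children, which is of the order of \<open>exp (3 l)\<close>, the lower bound \<open>\<kappa>\<close> reproduces itself
  from level to level since \<open>s < 3\<close>.\<close>

lemma approx_content_step:
  assumes s: "0 < s" "s \<le> 3" and \<kappa>: "0 < \<kappa>" "\<kappa> \<le> 1"
    and b: "reach b \<ge> 40" "reach b \<ge> 4 * (a + 1)" "real (level b) \<ge> M"
    and IH: "\<And>c I U. c \<in> children b \<Longrightarrow> finite (I :: 'i set) \<Longrightarrow> (\<And>i. i \<in> I \<Longrightarrow> bounded (U i)) \<Longrightarrow>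
       approx n c \<subseteq> (\<Union>i\<in>I. U i) \<Longrightarrow> \<kappa> \<le> (\<Sum>i\<in>I. diameter (U i) powr s)"
    and \<mu>: "\<mu> = exp (real (level b) + 1) * (1 + L)"
    and big: "125 * \<mu> ^ 3 * \<kappa> + 125 * \<mu> powr s \<le> (reach b / 40) ^ 3"
    and I: "finite (I :: 'i set)" and U: "\<And>i. i \<in> I \<Longrightarrow> bounded (U i)" and cov: "approx (Suc n) b \<subseteq> (\<Union>i\<in>I. U i)"
  shows "\<kappa> \<le> (\<Sum>i\<in>I. diameter (U i) powr s)"
proof (rule ccontr)
  assume less: "\<not> \<kappa> \<le> (\<Sum>i\<in>I. diameter (U i) powr s)"
  let ?u = "\<lambda>i. diameter (U i)"
  define V where "V i = f ` (U i \<inter> node_box b)" for i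
  let ?d = "\<lambda>i. diameter (V i)"
  have \<mu>0: "\<mu> > 0" using L0 by (simp add: \<mu>)
  have u0: "?u i \<ge> 0" if "i \<in> I" for i using U[OF that] by (rule diameter_ge_0)
  have u1: "?u i \<le> 1" if "i \<in> I" for i
  proof (rule ccontr)
    assume "\<not> ?u i \<le> 1"
    then have "1 \<le> ?u i powr s" using s by (intro ge_one_powr_ge_zero) auto
    also have "\<dots> \<le> (\<Sum>i\<in>I. ?u i powr s)" using I that by (intro member_le_sum) auto
    finally show False using less \<kappa> by linarith
  qed
  have Ub: "bounded (U i \<inter> node_box b)" if "i \<in> I" for i using U[OF that] by (rule bounded_subset) auto
  have V: "bounded (V i)" "?d i \<le> \<mu> * ?u i" if "i \<in> I" for i
  proof -
    note im = diameter_lipschitz_image[OF Ub[OF that], of \<mu> f]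
    have lip: "dist (f x) (f y) \<le> \<mu> * dist x y" if "x \<in> U i \<inter> node_box b" "y \<in> U i \<inter> node_box b" for x y
      unfolding \<mu> using f_lipschitz_box that by blast
    show "bounded (V i)" unfolding V_def using im(1) \<mu>0 lip by simp
    have "?d i \<le> \<mu> * diameter (U i \<inter> node_box b)" unfolding V_def using im(2) \<mu>0 lip by simp
    also have "\<dots> \<le> \<mu> * ?u i" using \<mu>0 U[OF that] by (intro mult_left_mono diameter_subset) auto
    finally show "?d i \<le> \<mu> * ?u i" .
  qed
  have d0: "?d i \<ge> 0" if "i \<in> I" for i using V(1)[OF that] by (rule diameter_ge_0)
  define Ch where "Ch = children b"
  define hits where "hits i = {c \<in> Ch. V i \<inter> node_box c \<noteq> {}}" for i
  define Ibig where "Ibig = {i \<in> I. ?d i \<ge> 1}"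
  define Ismall where "Ismall = {i \<in> I. ?d i < 1}"
  have finCh: "finite Ch" unfolding Ch_def by (rule finite_children)
  have finhits: "finite (hits i)" for i unfolding hits_def using finCh by simp
  have fin: "finite Ibig" "finite Ismall" using I by (auto simp: Ibig_def Ismall_def)
  have card_hits: "real (card (hits i)) \<le> (?d i + 4) ^ 3" if "i \<in> I" for i
  proof -
    have "card (hits i) \<le> card {c. V i \<inter> node_box c \<noteq> {}}"
      using card_hit_le(1)[OF V(1)[OF that]] by (intro card_mono) (auto simp: hits_def)
    then show ?thesis using card_hit_le(2)[OF V(1)[OF that]] by linarith
  qed
  \<comment> \<open>The children met by no big image; their approximations are covered by small
    images alone, so \<open>IH\<close> applies to them.\<close>
  define nb where "nb = Ch - (\<Union>i\<in>Ibig. hits i)"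
  have cover: "approx n c \<subseteq> (\<Union>i\<in>{i \<in> Ismall. c \<in> hits i}. V i)" if c: "c \<in> nb" for c
  proof
    fix y assume y: "y \<in> approx n c"
    have cCh: "c \<in> children b" using c by (simp add: nb_def Ch_def)
    obtain x where x: "x \<in> approx (Suc n) b" "f x = y" using child_lift[OF cCh y b(2,3)] by blast
    then obtain i where i: "i \<in> I" "x \<in> U i" using cov by blast
    have "y \<in> V i" using x i approx_box[of "Suc n" b] by (auto simp: V_def)
    moreover have "c \<in> hits i" using \<open>y \<in> V i\<close> y approx_box[of n c] cCh by (auto simp: hits_def Ch_def)
    moreover have "i \<in> Ismall"
      using c \<open>c \<in> hits i\<close> i(1) by (auto simp: nb_def Ibig_def Ismall_def not_le)
    ultimately show "y \<in> (\<Union>i\<in>{i \<in> Ismall. c \<in> hits i}. V i)" by blast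
  qed
  \<comment> \<open>A double count: an image of diameter below 1 meets at most \<open>5 ^ 3\<close>
    children.\<close>
  have small: "\<kappa> * real (card nb) \<le> 125 * (\<Sum>i\<in>Ismall. ?d i powr s)"
  proof -
    have "\<kappa> * real (card nb) = (\<Sum>c\<in>nb. \<kappa>)" by simp
    also have "\<dots> \<le> (\<Sum>c\<in>nb. \<Sum>i\<in>{i \<in> Ismall. c \<in> hits i}. ?d i powr s)"
    proof (rule sum_mono)
      fix c assume c: "c \<in> nb"
      show "\<kappa> \<le> (\<Sum>i\<in>{i \<in> Ismall. c \<in> hits i}. ?d i powr s)"
      proof (rule IH)
        show "approx n c \<subseteq> (\<Union>i\<in>{i \<in> Ismall. c \<in> hits i}. V i)" by (rule cover[OF c])
      qed (use c I fin V(1) in \<open>auto simp: nb_def Ch_def Ismall_def\<close>)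
    qed
    also have "\<dots> = (\<Sum>i\<in>Ismall. \<Sum>c\<in>{c \<in> nb. c \<in> hits i}. ?d i powr s)"
      using fin finCh by (intro sum.swap_restrict) (auto simp: nb_def)
    also have "\<dots> \<le> (\<Sum>i\<in>Ismall. 125 * ?d i powr s)"
    proof (rule sum_mono)
      fix i assume i: "i \<in> Ismall"
      have iI: "i \<in> I" and d1: "?d i < 1" using i by (auto simp: Ismall_def)
      have "real (card {c \<in> nb. c \<in> hits i}) \<le> real (card (hits i))"
        using finhits by (intro of_nat_mono card_mono) auto
      also have "\<dots> \<le> (?d i + 4) ^ 3" by (rule card_hits[OF iI])
      also have "\<dots> \<le> 5 ^ 3" using d1 d0[OF iI] by (intro power_mono) auto
      finally have "real (card {c \<in> nb. c \<in> hits i}) * ?d i powr s \<le> 125 * ?d i powr s"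
        by (intro mult_right_mono) auto
      then show "(\<Sum>c\<in>{c \<in> nb. c \<in> hits i}. ?d i powr s) \<le> 125 * ?d i powr s" by simp
    qed
    finally show ?thesis by (simp add: sum_distrib_left)
  qed
  have "(\<Sum>i\<in>Ismall. ?d i powr s) \<le> (\<Sum>i\<in>Ismall. \<mu> powr s * ?u i powr s)"
  proof (rule sum_mono)
    fix i assume "i \<in> Ismall"
    then have i: "i \<in> I" by (simp add: Ismall_def)
    have "?d i powr s \<le> (\<mu> * ?u i) powr s" using V(2)[OF i] d0[OF i] s by (intro powr_mono2) auto
    then show "?d i powr s \<le> \<mu> powr s * ?u i powr s" using \<mu>0 u0[OF i] by (simp add: powr_mult)
  qed
  also have "\<dots> = \<mu> powr s * (\<Sum>i\<in>Ismall. ?u i powr s)" by (simp add: sum_distrib_left)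
  also have "\<dots> \<le> \<mu> powr s * \<kappa>"
  proof (rule mult_left_mono)
    have "(\<Sum>i\<in>Ismall. ?u i powr s) \<le> (\<Sum>i\<in>I. ?u i powr s)"
      using I by (intro sum_mono2) (auto simp: Ismall_def)
    then show "(\<Sum>i\<in>Ismall. ?u i powr s) \<le> \<kappa>" using less by linarith
  qed simp
  finally have "\<kappa> * real (card nb) \<le> 125 * (\<mu> powr s * \<kappa>)" using small by linarith
  \<comment> \<open>Here \<open>\<kappa>\<close> cancels, because the bound refuted for
    \<open>b\<close> is the one known for the children.\<close>
  then have nb: "real (card nb) \<le> 125 * \<mu> powr s" using \<kappa> by (simp add: mult.commute mult.assoc)
  have "real (card (\<Union>i\<in>Ibig. hits i)) \<le> (\<Sum>i\<in>Ibig. real (card (hits i)))"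
    using card_UN_le[OF fin(1), of hits] by (metis of_nat_le_iff of_nat_sum)
  \<comment> \<open>For an image of diameter at least 1 the count is at most the cube of 5 times its
    diameter; then \<open>?u i \<le> 1\<close> lowers the exponent 3 to \<open>s\<close>.\<close>
  also have "\<dots> \<le> (\<Sum>i\<in>Ibig. 125 * \<mu> ^ 3 * ?u i powr s)"
  proof (rule sum_mono)
    fix i assume "i \<in> Ibig"
    then have i: "i \<in> I" "?d i \<ge> 1" by (auto simp: Ibig_def)
    have "real (card (hits i)) \<le> (?d i + 4) ^ 3" by (rule card_hits[OF i(1)])
    also have "\<dots> \<le> (5 * ?d i) ^ 3" using i(2) by (intro power_mono) auto
    also have "\<dots> \<le> (5 * (\<mu> * ?u i)) ^ 3" using V(2)[OF i(1)] d0[OF i(1)] by (intro power_mono) auto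
    also have "\<dots> = 125 * \<mu> ^ 3 * ?u i ^ 3" by (simp add: power_mult_distrib)
    also have "\<dots> \<le> 125 * \<mu> ^ 3 * ?u i powr s"
    proof (rule mult_left_mono)
      have "?u i \<noteq> 0" using V(2)[OF i(1)] i(2) by auto
      then have "?u i ^ 3 = ?u i powr 3" using u0[OF i(1)] by simp
      also have "\<dots> \<le> ?u i powr s" using u0[OF i(1)] u1[OF i(1)] s by (intro powr_mono') auto
      finally show "?u i ^ 3 \<le> ?u i powr s" .
    qed (use \<mu>0 in simp)
    finally show "real (card (hits i)) \<le> 125 * \<mu> ^ 3 * ?u i powr s" .
  qed
  also have "\<dots> = 125 * \<mu> ^ 3 * (\<Sum>i\<in>Ibig. ?u i powr s)" by (simp add: sum_distrib_left)
  also have "\<dots> \<le> 125 * \<mu> ^ 3 * (\<Sum>i\<in>I. ?u i powr s)"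
    using I \<mu>0 by (intro mult_left_mono sum_mono2) (auto simp: Ibig_def)
  also have "\<dots> < 125 * \<mu> ^ 3 * \<kappa>"
    using less \<mu>0 by (intro mult_strict_left_mono) auto
  finally have "real (card (\<Union>i\<in>Ibig. hits i)) < 125 * \<mu> ^ 3 * \<kappa>" .
  moreover have "real (card Ch) \<le> real (card nb) + real (card (\<Union>i\<in>Ibig. hits i))"
  proof -
    have "Ch \<subseteq> nb \<union> (\<Union>i\<in>Ibig. hits i)" by (auto simp: nb_def)
    then have "card Ch \<le> card (nb \<union> (\<Union>i\<in>Ibig. hits i))"
      using finCh fin finhits by (intro card_mono) (auto simp: nb_def)
    then show ?thesis using card_Un_le[of nb "\<Union>i\<in>Ibig. hits i"] by linarith
  qed
  ultimately have "real (card Ch) < 125 * \<mu> ^ 3 * \<kappa> + 125 * \<mu> powr s" using nb by linarith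
  then show False using card_children[OF b(1)] big unfolding Ch_def by linarith
qed

lemma approx_content:
  assumes s: "0 < s" "s < 3"
  obtains \<kappa> R where "\<kappa> > 0" "real R > M" "\<And>n b I U. level b \<ge> R \<Longrightarrow> finite (I :: nat set) \<Longrightarrow> (\<And>i. i \<in> I \<Longrightarrow> bounded (U i)) \<Longrightarrow>
       approx n b \<subseteq> (\<Union>i\<in>I. U i) \<Longrightarrow> \<kappa> \<le> (\<Sum>i\<in>I. diameter (U i) powr s)"
proof -
  define G where "G = exp 1 * (1 + L)"
  have G: "G \<ge> 1"
  proof -
    have "1 * 1 \<le> exp 1 * (1 + L)" using L0 by (intro mult_mono) auto
    then show ?thesis by (simp add: G_def)
  qed
  \<comment> \<open>Since \<open>16000000 = 2 * 125 * 40 ^ 3\<close>, each of the two terms in the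
    counting condition is at most half of \<open>(reach b / 40) ^ 3\<close>.\<close>
  define \<kappa> where "\<kappa> = 1 / (16000000 * G ^ 3)"
  have G3: "G ^ 3 \<ge> 1" using G by (rule one_le_power)
  have G2: "16000000 * G ^ 3 \<ge> 2" using G3 by linarith
  have \<kappa>: "0 < \<kappa>" "\<kappa> \<le> 1/2"
    unfolding \<kappa>_def using frac_le[of 1 1 2 "16000000 * G ^ 3"] G2 G by auto
  \<comment> \<open>The last entry ensures that \<open>exp (3 * l)\<close> dominates
    \<open>16000000 * G ^ 3 * exp (s * l)\<close> for l at least \<open>T\<close>; the others serve
    the geometry of the children.\<close>
  define T where "T = max (max M 40) (max (4 * (a + 1)) (ln (16000000 * G ^ 3) / (3 - s)))"
  obtain R :: nat where R: "real R > T" using reals_Archimedean2 by blast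
  have main: "\<kappa> \<le> (\<Sum>i\<in>I. diameter (U i) powr s)"
    if "level b \<ge> R" "finite (I :: nat set)" "\<And>i. i \<in> I \<Longrightarrow> bounded (U i)" "approx n b \<subseteq> (\<Union>i\<in>I. U i)" for n b I U
    using that
  proof (induction n arbitrary: b I U)
    case 0
    then have "1/2 \<le> (\<Sum>i\<in>I. diameter (U i) powr s)"
      using s by (intro box_content_ge) auto
    then show ?case using \<kappa> by linarith
  next
    case (Suc n)
    let ?l = "real (level b)"
    have l: "?l \<ge> M" "?l \<ge> 40" "?l \<ge> 4 * (a + 1)" "?l \<ge> ln (16000000 * G ^ 3) / (3 - s)"
      using order_less_le_trans[OF R, of ?l] Suc.prems(1) by (simp_all add: T_def)
    have e: "exp ?l \<ge> ?l" using exp_ge_add_one_self[of ?l] by linarith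
    have \<mu>: "exp (?l + 1) * (1 + L) = G * exp ?l" by (simp add: G_def exp_add)
    have "(G * exp ?l) powr s \<le> G ^ 3 * exp (s * ?l)"
    proof -
      have "(G * exp ?l) powr s = G powr s * exp (s * ?l)" using G by (simp add: powr_mult powr_def[of "exp _"])
      also have "\<dots> \<le> G powr 3 * exp (s * ?l)" using G s by (intro mult_right_mono powr_mono) auto
      finally show ?thesis using G by simp
    qed
    moreover have "16000000 * G ^ 3 * exp (s * ?l) \<le> exp (3 * ?l)"
    proof -
      have "ln (16000000 * G ^ 3) \<le> (3 - s) * ?l" using l(4) s by (simp add: pos_divide_le_eq mult.commute)
      then have "16000000 * G ^ 3 \<le> exp ((3 - s) * ?l)"
        using G2 by (metis exp_le_cancel_iff exp_ln less_le_trans zero_less_numeral)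
      then have "16000000 * G ^ 3 * exp (s * ?l) \<le> exp ((3 - s) * ?l) * exp (s * ?l)"
        by (intro mult_right_mono) auto
      also have "\<dots> = exp (3 * ?l)" by (simp add: exp_add[symmetric] algebra_simps)
      finally show ?thesis .
    qed
    moreover have "(G * exp ?l) ^ 3 * \<kappa> = exp (3 * ?l) / 16000000"
    proof -
      have "exp ?l ^ 3 = exp (3 * ?l)" using exp_of_nat_mult[of 3 ?l] by simp
      then show ?thesis using G by (simp add: \<kappa>_def power_mult_distrib)
    qed
    moreover have "(exp ?l / 40) ^ 3 = exp (3 * ?l) / 64000"
      using exp_of_nat_mult[of 3 ?l] by (simp add: power_divide)
    ultimately have big: "125 * (G * exp ?l) ^ 3 * \<kappa> + 125 * (G * exp ?l) powr s \<le> (exp ?l / 40) ^ 3"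
      by linarith
    show ?case
    proof (rule approx_content_step[where b = b and \<mu> = "G * exp ?l" and n = n])
      fix c I U
      assume "c \<in> children b" "finite (I :: nat set)" "\<And>i. i \<in> I \<Longrightarrow> bounded (U i)" "approx n c \<subseteq> (\<Union>i\<in>I. U i)"
      then show "\<kappa> \<le> (\<Sum>i\<in>I. diameter (U i) powr s)"
        using child_level[of c b] Suc.prems(1) by (intro Suc.IH[of c]) auto
    qed (use s \<kappa> l e \<mu> big Suc.prems in auto)
  qed
  have "real R > M" using R by (simp add: T_def)
  then show thesis using that \<kappa>(1) main by blast
qed

text \<open>A cover with small sum is enlarged to an open one. By compactness it then covers some
  \<open>approx n b\<close> with finitely many sets, and their sum is bounded below independently of
  n.\<close>

lemma hcontent_J:
  assumes s: "0 < s" "s < 3" shows "hcontent s J \<noteq> 0"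
proof
  assume 0: "hcontent s J = 0"
  obtain \<kappa> R where \<kappa>: "\<kappa> > 0" and R: "real R > M"
    and main: "\<And>n b I U. level b \<ge> R \<Longrightarrow> finite (I :: nat set) \<Longrightarrow> (\<And>i. i \<in> I \<Longrightarrow> bounded (U i)) \<Longrightarrow>
       approx n b \<subseteq> (\<Union>i\<in>I. U i) \<Longrightarrow> \<kappa> \<le> (\<Sum>i\<in>I. diameter (U i) powr s)"
    using approx_content[OF s] by metis
  define b :: node where "b = (0, 0, R)"
  have J: "x \<in> J" if "\<And>n. x \<in> approx n b" for x
  proof -
    have "(f ^^ k) x $ 3 \<ge> real R" for k using approx_level[OF that[of k], of k] by (simp add: b_def)
    then show ?thesis using R unfolding J_def by (auto intro: less_le_trans)
  qed
  \<comment> \<open>Enlarging adds \<open>e\<close> to the sum and multiplies by at most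
    \<open>2 powr 3\<close>; \<open>8 * (e + e)\<close> is half of \<open>\<kappa>\<close>.\<close>
  define e where "e = \<kappa> / 32"
  have e: "e > 0" using \<kappa> by (simp add: e_def)
  have "hcontent s J < ennreal e" using 0 e by simp
  from hcontent_approx[OF this] obtain U where U: "J \<subseteq> (\<Union>i. U i)" "\<And>i. bounded (U i)"
    "cover_sum s U < ennreal e" by auto
  define t where "t i = (e * (1/2) ^ Suc i) powr (1 / s)" for i :: nat
  have t: "t i > 0" "t i powr s = e * (1/2) ^ Suc i" for i
    using e s by (simp_all add: t_def powr_powr)
  define V where "V i = (\<Union>x\<in>U i. ball x (t i / 2))" for i
  have UV: "U i \<subseteq> V i" for i using t(1)[of i] by (force simp: V_def)
  have openV: "open (V i)" for i by (auto simp: V_def)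
  have dV: "dist x y \<le> diameter (U i) + t i" if "x \<in> V i" "y \<in> V i" for x y i
  proof -
    obtain x' y' where "x' \<in> U i" "y' \<in> U i" "dist x' x < t i / 2" "dist y' y < t i / 2"
      using \<open>x \<in> V i\<close> \<open>y \<in> V i\<close> by (auto simp: V_def)
    moreover have "dist x y \<le> dist x' x + dist x' y' + dist y' y"
      by (smt (verit) dist_commute dist_triangle)
    ultimately show ?thesis using diameter_bounded_bound[OF U(2), of x' i y'] by linarith
  qed
  have bV: "bounded (V i)" for i using dV[of _ i] unfolding bounded_def by blast
  have diamV: "diameter (V i) powr s \<le> 8 * (diameter (U i) powr s + e * (1/2) ^ Suc i)" for i
  proof -
    let ?m = "max (diameter (U i)) (t i)"
    have u0: "diameter (U i) \<ge> 0" using U(2) by (rule diameter_ge_0)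
    have "diameter (V i) \<le> diameter (U i) + t i"
      using dV[of _ i] t(1)[of i] u0 by (intro diameter_le) (auto simp: dist_norm[symmetric])
    then have "diameter (V i) \<le> 2 * ?m" by linarith
    then have "diameter (V i) powr s \<le> (2 * ?m) powr s"
      using s diameter_ge_0[OF bV[of i]] by (intro powr_mono2) auto
    also have "\<dots> = 2 powr s * ?m powr s" using t(1)[of i] by (intro powr_mult)
    also have "2 powr s \<le> 2 powr (3::real)" using s by (intro powr_mono) auto
    also have "2 powr (3::real) = 8" by simp
    finally have "diameter (V i) powr s \<le> 8 * ?m powr s" by (simp add: mult_right_mono)
    also have "?m powr s \<le> diameter (U i) powr s + t i powr s" by (simp add: max_def)
    finally show ?thesis unfolding t(2) by simp
  qed
  have "cover_sum s V \<le> (\<Sum>i. 8 * (ennreal (diameter (U i) powr s) + ennreal (e * (1/2) ^ Suc i)))"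
  proof (intro suminf_le allI)
    fix i
    have "ennreal (diameter (V i) powr s) \<le> ennreal (8 * (diameter (U i) powr s + e * (1/2) ^ Suc i))"
      using diamV[of i] by (rule ennreal_leI)
    also have "\<dots> = 8 * (ennreal (diameter (U i) powr s) + ennreal (e * (1/2) ^ Suc i))"
    proof -
      have gen: "ennreal (8 * (x + y)) = 8 * (ennreal x + ennreal y)" if "x \<ge> 0" "y \<ge> 0" for x y :: real
        using that by (simp add: ennreal_mult)
      show ?thesis by (rule gen) (use e in simp_all)
    qed
    finally show "ennreal (diameter (V i) powr s) \<le> 8 * (ennreal (diameter (U i) powr s) + ennreal (e * (1/2) ^ Suc i))" .
  qed auto
  also have "\<dots> = 8 * (cover_sum s U + (\<Sum>i. ennreal (e * (1/2) ^ Suc i)))"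
    by (subst ennreal_suminf_cmult, subst suminf_add[symmetric]) auto
  also have "(\<Sum>i. ennreal (e * (1/2) ^ Suc i)) = ennreal e"
    using sums_mult[OF power_half_series, of e] e by (intro suminf_ennreal_eq) auto
  also have "8 * (cover_sum s U + ennreal e) \<le> 8 * (ennreal e + ennreal e)"
    using U(3) by (intro mult_left_mono add_right_mono) auto
  also have "\<dots> = ennreal (8 * (e + e))" using e by (simp add: ennreal_mult ennreal_plus[symmetric] del: ennreal_plus)
  also have "8 * (e + e) = \<kappa> / 2" by (simp add: e_def)
  finally have sumV: "cover_sum s V \<le> ennreal (\<kappa> / 2)" .
  have "\<exists>n. approx n b \<subseteq> (\<Union>i. V i)"
  proof (rule ccontr)
    assume no: "\<not> ?thesis"
    define W where "W n = approx n b - (\<Union>i. V i)" for n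
    have "(\<Inter>n. W n) \<noteq> {}"
    proof (rule compact_nest)
      show "compact (W n)" for n
        unfolding W_def using approx_compact openV by (intro compact_diff) auto
      show "W n \<noteq> {}" for n using no by (auto simp: W_def)
      have "W (Suc n) \<subseteq> W n" for n using approx_decreasing[of n b] by (auto simp: W_def)
      then show "W n \<subseteq> W m" if "m \<le> n" for m n using that by (rule lift_Suc_antimono_le)
    qed
    then obtain x where x: "\<And>n. x \<in> W n" by auto
    then have "x \<in> J" by (intro J) (simp add: W_def)
    then show False using U(1) UV x[of 0] by (auto simp: W_def)
  qed
  then obtain n where "approx n b \<subseteq> (\<Union>i. V i)" by blast
  then obtain I where I: "finite I" "approx n b \<subseteq> (\<Union>i\<in>I. V i)"
    using compactE_image[OF approx_compact[of n b], of UNIV V] openV by metis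
  have "\<kappa> \<le> (\<Sum>i\<in>I. diameter (V i) powr s)"
    using I bV by (intro main[of b I V n]) (auto simp: b_def)
  then have "ennreal \<kappa> \<le> (\<Sum>i\<in>I. ennreal (diameter (V i) powr s))"
    by (subst sum_ennreal) (auto intro: ennreal_leI)
  also have "\<dots> \<le> cover_sum s V"
    using I(1) by (intro sum_le_suminf) auto
  also have "\<dots> \<le> ennreal (\<kappa> / 2)" by (rule sumV)
  finally show False using \<kappa> by (simp add: ennreal_le_iff)
qed


section \<open>The family of hairs and the dimensions\<close>

definition hairs :: "(real^3) set set" where "hairs = {track s | s. track s \<noteq> {}}"

definition endpoints :: "(real^3) set" where "endpoints = {e. \<exists>H\<in>hairs. hair_endpoint H e}"

lemma Union_hairs: "\<Union>hairs = J"
  unfolding hairs_def by (auto simp: track_def)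

lemma disjoint_hairs: "disjoint hairs"
  unfolding hairs_def pairwise_def disjnt_def by (auto simp: track_def)

lemma hairs_are_hairs: "H \<in> hairs \<Longrightarrow> hair H"
  unfolding hairs_def hair_def using track_endpoint by blast

lemma hair_endpoint_in: "hair_endpoint H e \<Longrightarrow> e \<in> H"
  unfolding hair_endpoint_def homeomorphism_def by auto

lemma J_minus_endpoints_subset:
  "J - endpoints \<subseteq> {x. \<exists>t z. x \<in> track t \<and> z \<in> track t \<and> height z < height x}"
proof
  fix x assume x: "x \<in> J - endpoints"
  then have xt: "x \<in> track (itin x)" by (simp add: track_def)
  obtain e where e: "e \<in> track (itin x)" "hair_endpoint (track (itin x)) e"
    "\<And>y. y \<in> track (itin x) \<Longrightarrow> height e \<le> height y" using track_endpoint[OF xt] by metis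
  have "e \<in> endpoints" using e xt unfolding endpoints_def hairs_def by blast
  then have "e \<noteq> x" using x by blast
  then have "height e \<noteq> height x" using inj_onD[OF inj_height _ e(1) xt] by blast
  then have "height e < height x" using e(3)[OF xt] by simp
  then show "x \<in> {x. \<exists>t z. x \<in> track t \<and> z \<in> track t \<and> height z < height x}" using xt e(1) by blast
qed

lemma hcontent_J_minus_endpoints: "s > 1 \<Longrightarrow> hcontent s (J - endpoints) = 0"
  using hcontent_0_subset[OF J_minus_endpoints_subset hcontent_above_endpoints] .

text \<open>The exponent \<open>max s 2\<close> lies strictly between 1 and 3, where
  \<open>J\<close> has positive content but \<open>J - endpoints\<close> has none.\<close>

lemma hcontent_endpoints: assumes "0 < s" "s < 3" shows "hcontent s endpoints \<noteq> 0"
proof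
  assume 0: "hcontent s endpoints = 0"
  define t where "t = max s 2"
  have t: "1 < t" "t < 3" "s \<le> t" using assms by (auto simp: t_def)
  have "hcontent t J \<le> hcontent t (endpoints \<union> (J - endpoints))" by (rule hcontent_mono) auto
  also have "\<dots> \<le> hcontent t endpoints + hcontent t (J - endpoints)" using t by (intro hcontent_Un_le) auto
  also have "\<dots> = 0"
    using hcontent_0_mono_exponent[OF 0 assms(1) t(3)] hcontent_J_minus_endpoints[OF t(1)] by simp
  finally show False using hcontent_J[of t] t by simp
qed

lemma uncountable_hairs: "uncountable hairs"
proof
  assume c: "countable hairs"
  have "endpoints \<subseteq> (\<lambda>H. THE e. hair_endpoint H e) ` hairs"
  proof
    fix e assume "e \<in> endpoints"
    then obtain H where H: "H \<in> hairs" "hair_endpoint H e" unfolding endpoints_def by blast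
    have "(THE e. hair_endpoint H e) = e"
      using H(2) hair_endpoint_unique by (intro the_equality)
    then show "e \<in> (\<lambda>H. THE e. hair_endpoint H e) ` hairs" using H(1) by (intro image_eqI[of _ _ H]) auto
  qed
  then have "countable endpoints" using c by (meson countable_image countable_subset)
  then show False using hcontent_countable[of endpoints 2] hcontent_endpoints[of 2] by simp
qed

lemma hausdorff_dim_endpoints: "hausdorff_dim endpoints = 3"
proof (rule antisym)
  have "hausdorff_dim endpoints \<le> ennreal 3"
    by (rule hausdorff_dim_le) (auto intro!: hcontent_euclidean_0)
  then show "hausdorff_dim endpoints \<le> 3" by simp
  have "ennreal 3 \<le> hausdorff_dim endpoints" by (rule hausdorff_dim_ge) (rule hcontent_endpoints)
  then show "3 \<le> hausdorff_dim endpoints" by simp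
qed

text \<open>For the lower bound, a single hair without its endpoint is a connected subset with more
  than one point. It meets no other endpoint because tracks are disjoint.\<close>

lemma hausdorff_dim_J_minus_endpoints: "hausdorff_dim (J - endpoints) = 1"
proof (rule antisym)
  have "hausdorff_dim (J - endpoints) \<le> ennreal 1"
    by (rule hausdorff_dim_le) (auto intro: hcontent_J_minus_endpoints)
  then show "hausdorff_dim (J - endpoints) \<le> 1" by simp
  have "J \<noteq> {}" using hcontent_J[of 1] by auto
  then obtain x where "x \<in> J" by blast
  then have xt: "x \<in> track (itin x)" by (simp add: track_def)
  let ?H = "track (itin x)"
  obtain e where e: "hair_endpoint ?H e" using track_endpoint[OF xt] by metis
  obtain \<gamma> \<gamma>' where \<gamma>: "homeomorphism {0::real..} ?H \<gamma> \<gamma>'" "\<gamma> 0 = e"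
    using e unfolding hair_endpoint_def by blast
  have inj: "s = t" if "\<gamma> s = \<gamma> t" "s \<ge> 0" "t \<ge> 0" for s t
    using \<gamma>(1) that unfolding homeomorphism_def by (metis atLeast_iff)
  have sub: "\<gamma> ` {0<..} \<subseteq> J - endpoints"
  proof
    fix y assume "y \<in> \<gamma> ` {0<..}"
    then obtain t where t: "t > 0" "y = \<gamma> t" by auto
    have yH: "y \<in> ?H" using \<gamma>(1) t unfolding homeomorphism_def by auto
    have "y \<notin> endpoints"
    proof
      assume "y \<in> endpoints"
      then obtain s where s: "hair_endpoint (track s) y" unfolding endpoints_def hairs_def by blast
      then have "y \<in> track s" by (rule hair_endpoint_in)
      then have "s = itin x" using yH by (simp add: track_def)
      then have "y = e" using hair_endpoint_unique[OF s] e by blast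
      then show False using inj[of t 0] t \<gamma>(2) by simp
    qed
    then show "y \<in> J - endpoints" using track_J[OF yH] by blast
  qed
  have "connected (\<gamma> ` {0<..})"
    using \<gamma>(1) by (intro connected_continuous_image) (auto simp: homeomorphism_def intro: continuous_on_subset)
  moreover have "\<gamma> 1 \<in> \<gamma> ` {0<..}" "\<gamma> 2 \<in> \<gamma> ` {0<..}" "\<gamma> 1 \<noteq> \<gamma> 2" using inj[of 1 2] by auto
  ultimately have "hcontent s (\<gamma> ` {0<..}) \<noteq> 0" if "0 < s" "s \<le> 1" for s
    using hcontent_connected that by blast
  then have "hcontent s (J - endpoints) \<noteq> 0" if "0 < s" "s < 1" for s
    using hcontent_0_subset[OF sub] that by (metis less_imp_le)
  then have "ennreal 1 \<le> hausdorff_dim (J - endpoints)" by (intro hausdorff_dim_ge) auto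
  then show "1 \<le> hausdorff_dim (J - endpoints)" by simp
qed

end

theorem theorem1:
  fixes h :: "real^2 \<Rightarrow> real^3" and \<alpha> m M a :: real
  assumes h: "bilipschitz_homeomorphism unit_square upper_hemisphere h"
    and \<alpha>: "0 < \<alpha>" "\<alpha> < 1"
    and mM: "m < M"
    and contracting: "AE x in lebesgue. x$3 \<le> m \<longrightarrow>
          (\<exists>D. (zorich h has_derivative D) (at x) \<and> onorm D \<le> \<alpha>)"
    and expanding: "AE x in lebesgue. x$3 \<ge> M \<longrightarrow>
          (\<exists>D. (zorich h has_derivative D) (at x) \<and> lower_norm D \<ge> 1 / \<alpha>)"
    and a: "a \<ge> exp M - m"
  shows "(\<exists>!\<xi>. zorich_shift h a \<xi> = \<xi> \<and> \<xi>$3 \<le> m) \<and>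
    (\<forall>\<xi>. zorich_shift h a \<xi> = \<xi> \<and> \<xi>$3 \<le> m \<longrightarrow>
      (\<exists>\<H>. uncountable \<H> \<and> disjoint \<H> \<and> (\<forall>H\<in>\<H>. hair H) \<and>
         \<Union>\<H> = non_convergence_set (zorich_shift h a) \<xi> \<and>
         (let C = {e. \<exists>H\<in>\<H>. hair_endpoint H e}
          in hausdorff_dim C = 3 \<and>
             hausdorff_dim (non_convergence_set (zorich_shift h a) \<xi> - C) = 1)))"
proof -
  obtain g L where "homeomorphism unit_square upper_hemisphere h g"
    "L-lipschitz_on unit_square h" "L-lipschitz_on upper_hemisphere g"
    using h unfolding bilipschitz_homeomorphism_def by blast
  then interpret zorich_system h g L \<alpha> m M a
    using \<alpha> mM contracting expanding a by unfold_locales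
  show ?thesis
  proof (intro conjI allI impI)
    show "\<exists>!\<xi>. zorich_shift h a \<xi> = \<xi> \<and> \<xi>$3 \<le> m" by (rule fixed_point)
    fix \<xi> assume "zorich_shift h a \<xi> = \<xi> \<and> \<xi>$3 \<le> m"
    then have J: "non_convergence_set (zorich_shift h a) \<xi> = J" by (intro J_eq) auto
    show "\<exists>\<H>. uncountable \<H> \<and> disjoint \<H> \<and> (\<forall>H\<in>\<H>. hair H) \<and>
         \<Union>\<H> = non_convergence_set (zorich_shift h a) \<xi> \<and>
         (let C = {e. \<exists>H\<in>\<H>. hair_endpoint H e}
          in hausdorff_dim C = 3 \<and>
             hausdorff_dim (non_convergence_set (zorich_shift h a) \<xi> - C) = 1)"
      unfolding J Let_def
      using uncountable_hairs disjoint_hairs hairs_are_hairs Union_hairs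
        hausdorff_dim_endpoints[unfolded endpoints_def]
        hausdorff_dim_J_minus_endpoints[unfolded endpoints_def]
      by (intro exI[of _ hairs] conjI ballI)
  qed
qed

end
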